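(* Let $f \in \mathbb{C}[X]$ be a polynomial of degree $d \geq 2$. Then there exists $r > 0$ such that $L_r$ contains a connected semi-algebraic curve if and only if $f$ is exceptional.
   Context: $g_f(z) = \lim_{n\to\infty} d^{-n}\log^+|f^{\circ n}(z)|$ with $\log^+ t = \log\max\{1,t\}$, and $L_r = \{z \in \mathbb{C} : g_f(z) = r\}$; semi-algebraic is meant with respect to $\mathbb{C} = \mathbb{R}^2$. $f$ is exceptional if it is conjugate by an affine linear polynomial to $X^d$ or to a Chebyshev polynomial.
   Formalization: "Chebyshev polynomial" is taken to mean T_d or −T_d; with T_d alone the claim fails for odd d, e.g. f = −T_3, whose curves L_r are ellipses although f is conjugate neither to X^3 nor to T_3. *)

theory Defs
  imports "HOL-Analysis.Analysis" "HOL-Computational_Algebra.Polynomial"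
begin

definition log_plus :: "real \<Rightarrow> real" where
  "log_plus t = ln (max 1 t)"

text \<open>The limit exists for every \<open>f\<close> of degree at least 2; below that, \<^const>\<open>lim\<close> may be
  an arbitrary value.\<close>

definition green :: "complex poly \<Rightarrow> complex \<Rightarrow> real" where
  "green f z = lim (\<lambda>n. log_plus (cmod ((poly f ^^ n) z)) / real (degree f) ^ n)"

definition level_curve :: "complex poly \<Rightarrow> real \<Rightarrow> complex set" where
  "level_curve f r = {z. green f z = r}"

text \<open>An element \<open>\<Sum>j. p\<^sub>j Y^j\<close> of \<open>\<real>[X][Y]\<close> evaluated at the point \<open>(Re z, Im z)\<close> of the plane.\<close>

definition eval_plane :: "real poly poly \<Rightarrow> complex \<Rightarrow> real" where
  "eval_plane P z = poly (poly P [:Im z:]) (Re z)"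

text \<open>Finite unions of sets given by finitely many polynomial equations (\<open>E\<close>) and strict
  polynomial inequalities (\<open>G\<close>).\<close>

definition semialgebraic :: "complex set \<Rightarrow> bool" where
  "semialgebraic S \<longleftrightarrow>
     (\<exists>F :: (real poly poly set \<times> real poly poly set) set.
        finite F \<and> (\<forall>(E, G) \<in> F. finite E \<and> finite G) \<and>
        S = (\<Union>(E, G) \<in> F. {z. (\<forall>P\<in>E. eval_plane P z = 0) \<and> (\<forall>Q\<in>G. eval_plane Q z > 0)}))"

definition contains_cell :: "complex set \<Rightarrow> nat \<Rightarrow> bool" where
  "contains_cell S k \<longleftrightarrow> (\<exists>U\<subseteq>S. top_of_set U homeomorphic_space Euclidean_space k)"

text \<open>A semi-algebraic set is a finite disjoint union of copies of open cubes, and its dimension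
  is the largest dimension of a cube that occurs, equivalently of a cube that embeds in it
  topologically. The dimension is a predicate so that the empty set has no dimension.\<close>

definition has_dimension :: "complex set \<Rightarrow> nat \<Rightarrow> bool" where
  "has_dimension S k \<longleftrightarrow> contains_cell S k \<and> (\<forall>m. contains_cell S m \<longrightarrow> m \<le> k)"

definition semialgebraic_curve :: "complex set \<Rightarrow> bool" where
  "semialgebraic_curve S \<longleftrightarrow> semialgebraic S \<and> has_dimension S 1"

definition affine_conjugate :: "complex poly \<Rightarrow> complex poly \<Rightarrow> bool" where
  "affine_conjugate f g \<longleftrightarrow> (\<exists>L. degree L = 1 \<and> pcompose L f = pcompose g L)"

fun chebyshev_T :: "nat \<Rightarrow> complex poly" where
  "chebyshev_T 0 = 1"
| "chebyshev_T (Suc 0) = [:0, 1:]"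
| "chebyshev_T (Suc (Suc n)) = [:0, 2:] * chebyshev_T (Suc n) - chebyshev_T n"

text \<open>As usual in polynomial dynamics, both signs \<open>\<plusminus>T\<^sub>d\<close> count as Chebyshev polynomials. For even
  \<open>d\<close> they are conjugate by \<open>z \<mapsto> -z\<close>. For odd \<open>d\<close> they are not affinely conjugate, but
  \<open>-T\<^sub>d\<close> has the same Green function as \<open>T\<^sub>d\<close>, whose level curves are ellipses.\<close>

definition exceptional :: "complex poly \<Rightarrow> bool" where
  "exceptional f \<longleftrightarrow>
     affine_conjugate f (monom 1 (degree f)) \<or>
     affine_conjugate f (chebyshev_T (degree f)) \<or>
     affine_conjugate f (- chebyshev_T (degree f))"

end

theory Submission
  imports Defs "HOL-Complex_Analysis.Complex_Analysis"
    "HOL-Computational_Algebra.Fundamental_Theorem_Algebra"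
begin

text \<open>
  Let \<open>k\<close> be the inverse of the Boettcher coordinate of \<open>f\<close> at infinity, read in the local
  coordinate \<open>w\<close> at \<open>w = 0\<close>, where \<open>k\<close> has a simple pole; thus \<open>f (k w) = k (w ^ d)\<close> and the
  Green function at \<open>k w\<close> is \<open>- ln |w|\<close>. Put \<open>\<Psi> z = k (exp (- z))\<close>, so \<open>\<Psi>\<close> has period
  \<open>2 \<pi> i\<close> and \<open>f (\<Psi> z) = \<Psi> (d z)\<close> for \<open>Re z\<close> large.

  An iterate of \<open>f\<close> carries an infinite algebraic subset of a level curve to an infinite algebraic
  subset of \<open>\<Psi> {Re z = r}\<close> with \<open>r\<close> large. On that line \<open>cnj \<Psi>\<close> coincides with the holomorphic
  function \<open>z \<mapsto> cnj (\<Psi> (2 r - cnj z))\<close>, which is therefore an algebraic function of \<open>\<Psi>\<close>. Unlike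
  \<open>\<Psi>\<close> itself, an algebraic function of \<open>\<Psi>\<close> can be continued to the right along any horizontal
  ray that avoids the discrete set of branch points. Reflected back, this continues \<open>\<Psi>\<close> to a thin
  rectangle that crosses the imaginary axis. The substitution \<open>z \<mapsto> d ^ n z\<close> magnifies the rectangle
  beyond height \<open>2 \<pi>\<close>, and by periodicity \<open>k\<close> extends to \<open>0 < |w| < exp (d ^ n)\<close> with a
  bound \<open>C ^ (d ^ n)\<close>. By Cauchy's estimate \<open>k\<close> is a Laurent polynomial. Its degree at infinity
  is at most 1, so up to affine conjugation \<open>k\<close> is \<open>1 / w\<close> or \<open>w + 1 / w\<close>, and \<open>f\<close> is a power
  map or \<open>\<plusminus>\<close> a Chebyshev polynomial.
\<close>

section \<open>Algebraic relations in two variables\<close>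

text \<open>The line \<open>Re z = 0\<close>, that is \<open>|w| = 1\<close>, is the real barrier:
  \<open>z \<mapsto> d ^ n z\<close> moves a left edge with \<open>Re z > 0\<close> to the right,
  but one with \<open>Re z < 0\<close> to the left, so any gain beyond the axis, however small, is
  amplified without limit. The obstacle to gaining it is monodromy: paths around branch points may
  end on different branches. Hence the algebraic function is followed along one segment only, and
  single-valuedness in \<open>w\<close> is recovered afterwards from the period of \<Psi>.

  Branch points are discrete because a relation \<open>H\<close> of least degree satisfies
  \<open>A * H + B * pderiv H = [:D:]\<close> with \<open>D \<noteq> 0\<close>, and \<open>D\<close>
  composed with \<Psi> cannot vanish identically, as \<Psi> is unbounded.

  The curve supplies an uncountable set. Each of its points needs its own number of iterations to
  reach the region where the Boettcher coordinate is inverted; by uncountability one number serves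
  infinitely many points.

  For the converse \<open>r = 1\<close> is chosen: up to an affine map the level curve then contains
  the circle of radius \<open>exp 1\<close> or the ellipse with semi-axes \<open>cosh 1\<close> and
  \<open>sinh 1\<close>.\<close>

lemma fraction_free_dependence:
  fixes v :: "'i \<Rightarrow> nat \<Rightarrow> 'a::idom"
  assumes "finite K" "card K > m"
  shows "\<exists>c. (\<exists>k\<in>K. c k \<noteq> 0) \<and> (\<forall>i<m. (\<Sum>k\<in>K. c k * v k i) = 0)"
  using assms
proof (induction m arbitrary: K v)
  case 0
  then have "K \<noteq> {}" by auto
  then show ?case by (intro exI[of _ "\<lambda>_. 1"]) auto
next
  case (Suc m)
  show ?case
  proof (cases "\<forall>k\<in>K. v k m = 0")
    case True
    obtain c where "\<exists>k\<in>K. c k \<noteq> 0" and c: "\<forall>i<m. (\<Sum>k\<in>K. c k * v k i) = 0"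
      using Suc.IH[of K v] Suc.prems by auto
    then show ?thesis using True by (intro exI[of _ c]) (auto simp: less_Suc_eq)
  next
    case False
    then obtain p where p: "p \<in> K" "v p m \<noteq> 0" by auto
    \<comment> \<open>Gaussian elimination with pivot row \<open>p\<close>, cross-multiplied instead
      of divided because the entries will be polynomials. Component \<open>m\<close> of every
      \<open>u k\<close> is zero; a dependence of the \<open>u k\<close> turns into one of the
      \<open>v k\<close> in which the coefficient of row \<open>p\<close> collects the subtracted
      multiples.\<close>
    define u where "u k i = v p m * v k i - v k m * v p i" for k i
    have "card (K - {p}) > m" using Suc.prems p by simp
    then obtain c where c0: "\<exists>k\<in>K-{p}. c k \<noteq> 0"
      and c: "\<And>i. i < m \<Longrightarrow> (\<Sum>k\<in>K-{p}. c k * u k i) = 0"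
      using Suc.IH[of "K - {p}" u] Suc.prems by auto
    have c': "(\<Sum>k\<in>K-{p}. c k * u k i) = 0" if "i < Suc m" for i
      using that c[of i] by (cases "i = m") (auto simp: u_def)
    define c2 where "c2 k = (if k = p then - (\<Sum>k\<in>K-{p}. c k * v k m) else c k * v p m)" for k
    have "(\<Sum>k\<in>K. c2 k * v k i) = 0" if "i < Suc m" for i
    proof -
      have "(\<Sum>k\<in>K. c2 k * v k i) = c2 p * v p i + (\<Sum>k\<in>K-{p}. c2 k * v k i)"
        using Suc.prems p by (simp add: sum.remove)
      also have "(\<Sum>k\<in>K-{p}. c2 k * v k i) = (\<Sum>k\<in>K-{p}. c k * v p m * v k i)"
        by (intro sum.cong) (auto simp: c2_def)
      also have "c2 p * v p i = (\<Sum>k\<in>K-{p}. - (c k * v k m * v p i))"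
        by (simp add: c2_def sum_negf sum_distrib_right)
      also have "(\<Sum>k\<in>K-{p}. - (c k * v k m * v p i)) + (\<Sum>k\<in>K-{p}. c k * v p m * v k i)
          = (\<Sum>k\<in>K-{p}. c k * u k i)"
        by (simp add: u_def sum.distrib[symmetric] algebra_simps)
      finally show ?thesis using c'[OF that] by simp
    qed
    moreover have "\<exists>k\<in>K. c2 k \<noteq> 0" using c0 p by (auto simp: c2_def)
    ultimately show ?thesis by blast
  qed
qed

text \<open>\<open>eval_plane\<close> over an arbitrary ring: \<open>x\<close> goes to the inner
  (coefficient) variable and \<open>y\<close> to the outer one.\<close>

definition eval2 :: "'a::comm_ring_1 poly poly \<Rightarrow> 'a \<Rightarrow> 'a \<Rightarrow> 'a" where
  "eval2 F x y = poly (poly F [:y:]) x"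

lemma eval2_simps [simp]:
  "eval2 (A + B) x y = eval2 A x y + eval2 B x y"
  "eval2 (A - B) x y = eval2 A x y - eval2 B x y"
  "eval2 (A * B) x y = eval2 A x y * eval2 B x y"
  "eval2 (A ^ n) x y = eval2 A x y ^ n"
  "eval2 0 x y = 0"
  "eval2 [:c:] x y = poly c x"
  "eval2 (smult c A) x y = poly c x * eval2 A x y"
  "eval2 [:0, 1:] x y = y"
  by (simp_all add: eval2_def)

lemma eval2_sum [simp]: "eval2 (\<Sum>i\<in>I. f i) x y = (\<Sum>i\<in>I. eval2 (f i) x y)"
  by (induction I rule: infinite_finite_induct) auto

lemma eval2_monom [simp]: "eval2 (monom c n) x y = poly c x * y ^ n"
  by (simp add: eval2_def poly_monom)

lemma eval2_altdef: "eval2 F x y = poly (map_poly (\<lambda>c. poly c x) F) y"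
  by (induction F) (auto simp: eval2_def map_poly_pCons algebra_simps)

lemma eval2_lift [simp]: "eval2 (map_poly (\<lambda>a. [:a:]) f) x y = poly f y"
  by (induction f) (auto simp: eval2_def map_poly_pCons)

lemma eval2_eq_sum:
  "eval2 F x y = (\<Sum>j\<le>degree F. \<Sum>i\<le>degree (coeff F j). coeff (coeff F j) i * x ^ i * y ^ j)"
  by (simp add: eval2_def poly_altdef[of F] poly_sum poly_altdef[of "coeff F _"] sum_distrib_right
     flip: poly_const_pow)

lemma eval2_eq_0_imp:
  fixes F :: "'a::{idom, ring_char_0} poly poly"
  assumes inf: "infinite A" "infinite B" and "\<And>a b. a \<in> A \<Longrightarrow> b \<in> B \<Longrightarrow> eval2 F a b = 0"
  shows "F = 0"
proof -
  have 1: "poly F [:b:] = 0" if "b \<in> B" for b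
  proof (rule ccontr)
    assume "poly F [:b:] \<noteq> 0"
    from poly_roots_finite[OF this] have "finite {x. poly (poly F [:b:]) x = 0}" .
    moreover have "A \<subseteq> {x. poly (poly F [:b:]) x = 0}"
      using assms(3) that by (auto simp: eval2_def)
    ultimately show False using inf finite_subset by blast
  qed
  show ?thesis
  proof (rule ccontr)
    assume "F \<noteq> 0"
    from poly_roots_finite[OF this] have "finite {x. poly F x = 0}" .
    moreover have "(\<lambda>b. [:b:]) ` B \<subseteq> {x. poly F x = 0}" using 1 by auto
    ultimately have "finite ((\<lambda>b. [:b:]) ` B)" using finite_subset by blast
    then show False using inf by (auto dest: finite_imageD simp: inj_on_def)
  qed
qed

lemma eval2_swap:
  fixes F :: "'a::{idom, ring_char_0} poly poly"
  assumes "F \<noteq> 0"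
  obtains G where "G \<noteq> 0" "\<And>x y. eval2 G x y = eval2 F y x"
proof
  define G where "G = (\<Sum>j\<le>degree F. \<Sum>i\<le>degree (coeff F j). monom (monom (coeff (coeff F j) i) j) i)"
  show eq: "eval2 G x y = eval2 F y x" for x y
    by (simp add: G_def eval2_eq_sum[of F] poly_monom mult_ac)
  show "G \<noteq> 0"
  proof
    assume "G = 0"
    then have "eval2 F y x = 0" for x y using eq[of x y] by simp
    then have "F = 0" by (intro eval2_eq_0_imp[of UNIV UNIV]) (auto simp: infinite_UNIV_char_0)
    with assms show False by simp
  qed
qed

text \<open>A substitute for the resultant. Modulo \<open>F\<close> every polynomial in
  \<open>y\<close> reduces to one with only \<open>m = degree F\<close> coefficients, so the
  \<open>m + 1\<close> powers of \<open>f\<close> up to exponent \<open>m\<close> are linearly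
  dependent. Pseudo-division keeps all coefficients polynomial in \<open>x\<close>, at the price of
  the factors \<open>a k\<close>.\<close>

lemma eliminate_outer:
  fixes F :: "'a::{idom, ring_char_0} poly poly" and f :: "'a poly"
  assumes "F \<noteq> 0"
  obtains G where "G \<noteq> 0" "\<And>x y. eval2 F x y = 0 \<Longrightarrow> eval2 G x (poly f y) = 0"
proof (cases "degree F = 0")
  case True
  then obtain c where c: "F = [:c:]" by (metis degree_eq_zeroE)
  show ?thesis by (rule that[of F]) (use assms c in auto)
next
  case False
  define m where "m = degree F"
  define g where "g = map_poly (\<lambda>a. [:a:]) f"
  define R where "R k = pseudo_mod (g ^ k) F" for k
  have "\<forall>k. \<exists>a q. a \<noteq> 0 \<and> smult a (g ^ k) = F * q + R k"
    using pseudo_mod(1)[OF assms] by (auto simp: R_def)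
  then obtain a q where aq: "\<And>k. a k \<noteq> 0" "\<And>k. smult (a k) (g ^ k) = F * q k + R k"
    by metis
  have degR: "coeff (R k) i = 0" if "i \<ge> m" for k i
    using pseudo_mod(2)[OF assms, of "g ^ k"] that coeff_eq_0[of "R k" i] False
    by (auto simp: R_def m_def)
  obtain c where c0: "\<exists>k\<le>m. c k \<noteq> 0" and c: "\<And>i. i < m \<Longrightarrow> (\<Sum>k\<le>m. c k * coeff (R k) i) = 0"
    using fraction_free_dependence[of "{..m}" m "\<lambda>k. coeff (R k)"] by auto
  have R0: "(\<Sum>k\<le>m. smult (c k) (R k)) = 0"
  proof (rule poly_eqI)
    fix i show "coeff (\<Sum>k\<le>m. smult (c k) (R k)) i = coeff 0 i"
      using c[of i] degR[of i] by (cases "i < m") (auto simp: coeff_sum)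
  qed
  define G where "G = (\<Sum>k\<le>m. monom (c k * a k) k)"
  show ?thesis
  proof (rule that[of G])
    from c0 obtain k where k: "k \<le> m" "c k \<noteq> 0" by blast
    have "coeff G k = c k * a k" using k by (simp add: G_def coeff_sum)
    then show "G \<noteq> 0" using k aq(1)[of k] by auto
  next
    fix x y assume F0: "eval2 F x y = 0"
    have "eval2 (smult (a k) (g ^ k)) x y = eval2 (F * q k + R k) x y" for k
      using aq(2) by simp
    then have *: "poly (a k) x * poly f y ^ k = eval2 (R k) x y" for k
      using F0 by (simp add: g_def)
    have "eval2 G x (poly f y) = (\<Sum>k\<le>m. poly (c k) x * (poly (a k) x * poly f y ^ k))"
      by (simp add: G_def mult_ac)
    also have "\<dots> = eval2 (\<Sum>k\<le>m. smult (c k) (R k)) x y"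
      by (simp add: *)
    also have "\<dots> = 0" by (simp add: R0)
    finally show "eval2 G x (poly f y) = 0" .
  qed
qed

text \<open>Pushes an algebraic relation forward along polynomial maps of both variables; it will
  transport a relation between \<open>z\<close> and \<open>cnj z\<close> along an iterate of
  \<open>f\<close>. The variables are swapped because elimination acts on the outer one.\<close>

lemma eliminate_both:
  fixes F :: "'a::{idom, ring_char_0} poly poly" and f g :: "'a poly"
  assumes "F \<noteq> 0"
  obtains G where "G \<noteq> 0" "\<And>x y. eval2 F x y = 0 \<Longrightarrow> eval2 G (poly f x) (poly g y) = 0"
proof -
  obtain G1 where G1: "G1 \<noteq> 0" "\<And>x y. eval2 F x y = 0 \<Longrightarrow> eval2 G1 x (poly g y) = 0"
    using eliminate_outer[OF assms] by blast
  obtain G2 where G2: "G2 \<noteq> 0" "\<And>x y. eval2 G2 x y = eval2 G1 y x"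
    using eval2_swap[OF G1(1)] by blast
  obtain G3 where G3: "G3 \<noteq> 0" "\<And>x y. eval2 G2 x y = 0 \<Longrightarrow> eval2 G3 x (poly f y) = 0"
    using eliminate_outer[OF G2(1)] by blast
  obtain G where G: "G \<noteq> 0" "\<And>x y. eval2 G x y = eval2 G3 y x"
    using eval2_swap[OF G3(1)] by blast
  show ?thesis by (rule that[of G]) (use G G3 G2 G1 in auto)
qed

text \<open>Substitute \<open>Re z = (z + cnj z) / 2\<close> and
  \<open>Im z = (-\<i>/2) * (z - cnj z)\<close>, then treat \<open>cnj z\<close> as an independent
  variable. If \<open>F\<close> were zero, \<open>P\<close> would vanish on the whole plane.\<close>

lemma complexify_plane_polynomial:
  fixes P :: "real poly poly"
  assumes "P \<noteq> 0"
  obtains F :: "complex poly poly" where "F \<noteq> 0" "\<And>z. eval2 F z (cnj z) = of_real (eval_plane P z)"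
proof
  let ?X = "[:[:0, 1:]:] :: complex poly poly" and ?Y = "[:0, 1:] :: complex poly poly"
  let ?c = "\<lambda>a. [:[:a:]:] :: complex poly poly"
  define F where "F = (\<Sum>j\<le>degree P. \<Sum>i\<le>degree (coeff P j).
    ?c (of_real (coeff (coeff P j) i)) * (?c (1/2) * (?X + ?Y)) ^ i * (?c (-\<i>/2) * (?X - ?Y)) ^ j)"
  have F: "eval2 F x y = (\<Sum>j\<le>degree P. \<Sum>i\<le>degree (coeff P j).
    of_real (coeff (coeff P j) i) * ((x + y)/2) ^ i * ((-\<i>/2) * (x - y)) ^ j)" for x y
    by (simp add: F_def del: pCons_eq_0_iff mult_pCons_left mult_pCons_right add_pCons diff_pCons)
  show eq: "eval2 F z (cnj z) = of_real (eval_plane P z)" for z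
  proof -
    have 1: "(z + cnj z) / 2 = of_real (Re z)" "(-\<i>/2) * (z - cnj z) = of_real (Im z)"
      by (auto simp: complex_eq_iff)
    show ?thesis
      unfolding F 1 eval_plane_def eval2_def[symmetric] eval2_eq_sum[of P] by simp
  qed
  show "F \<noteq> 0"
  proof
    assume "F = 0"
    then have "eval_plane P z = 0" for z using eq[of z] by simp
    then have "eval2 P a b = 0" for a b
      by (metis eval_plane_def eval2_def complex.sel)
    then have "P = 0" by (intro eval2_eq_0_imp[of UNIV UNIV]) (auto simp: infinite_UNIV_char_0)
    with assms show False by simp
  qed
qed

section \<open>A relation of least degree and its discriminant\<close>

lemma degree_pderiv_less: "degree p > 0 \<Longrightarrow> degree (pderiv p) < degree (p :: 'a :: {idom, ring_char_0} poly)"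
  by (simp add: degree_pderiv)

text \<open>A polynomial of least degree in the ideal generated by \<open>G\<close> and \<open>pderiv G\<close> divides both up to
  constants; if \<open>G\<close> has least degree in the prime ideal \<open>N\<close>, it must itself be constant. The
  conclusion says that the roots of \<open>G\<close> are simple wherever \<open>D\<close> does not vanish.\<close>

lemma vanishing_with_discriminant:
  fixes N :: "'a::{idom, ring_char_0} poly poly set"
  assumes prime: "\<And>A B. A * B \<in> N \<Longrightarrow> A \<in> N \<or> B \<in> N"
    and add: "\<And>A B. A \<in> N \<Longrightarrow> B \<in> N \<Longrightarrow> A + B \<in> N"
    and mult: "\<And>A B. A \<in> N \<Longrightarrow> A * B \<in> N"
    and const: "\<And>c. c \<noteq> 0 \<Longrightarrow> [:c:] \<notin> N"
    and ex: "F \<in> N" "F \<noteq> 0"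
  obtains G A B D where "G \<in> N" "degree G > 0" "D \<noteq> 0" "A * G + B * pderiv G = [:D:]"
proof -
  define P where "P G \<longleftrightarrow> G \<in> N \<and> G \<noteq> 0" for G
  obtain G where G: "P G" and minG: "\<And>H. P H \<Longrightarrow> degree G \<le> degree H"
    using arg_min_nat_lemma[of P F degree] ex by (auto simp: P_def)
  have dG: "degree G > 0"
  proof (rule ccontr)
    assume "\<not> degree G > 0"
    then obtain c where "G = [:c:]" by (metis degree_eq_zeroE gr0I)
    then show False using G const[of c] by (auto simp: P_def)
  qed
  have zero: "0 \<in> N" using mult[OF ex(1), of 0] by simp
  define I where "I E \<longleftrightarrow> E \<noteq> 0 \<and> (\<exists>A B. E = A * G + B * pderiv G)" for E
  have pd: "pderiv G \<noteq> 0" using dG by (simp add: pderiv_eq_0_iff)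
  have "I G" using G unfolding I_def P_def by (metis add.right_neutral mult_1 mult_zero_left)
  then obtain E where E: "I E" and minE: "\<And>H. I H \<Longrightarrow> degree E \<le> degree H"
    using arg_min_nat_lemma[of I G degree] by auto
  obtain A B where AB: "E = A * G + B * pderiv G" and E0: "E \<noteq> 0" using E by (auto simp: I_def)
  have dvd: "\<exists>a q. a \<noteq> 0 \<and> smult a H = E * q" if "H = A' * G + B' * pderiv G" for H A' B'
  proof -
    obtain a q where a: "a \<noteq> 0" "smult a H = E * q + pseudo_mod H E"
      using pseudo_mod(1)[OF E0] by blast
    have "pseudo_mod H E = smult a H - E * q" using a by simp
    also have "\<dots> = ([:a:] * A' - A * q) * G + ([:a:] * B' - B * q) * pderiv G"
      by (simp add: that AB algebra_simps smult_add_right)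
    finally have "pseudo_mod H E \<noteq> 0 \<Longrightarrow> I (pseudo_mod H E)"
      unfolding I_def by blast
    then have "pseudo_mod H E = 0"
      using pseudo_mod(2)[OF E0, of H] minE[of "pseudo_mod H E"] by force
    with a show ?thesis by auto
  qed
  have "degree E = 0"
  proof (rule ccontr)
    assume dE: "degree E \<noteq> 0"
    obtain a q where a: "a \<noteq> 0" "smult a G = E * q" using dvd[of G 1 0] by auto
    obtain a' q' where a': "a' \<noteq> 0" "smult a' (pderiv G) = E * q'" using dvd[of "pderiv G" 0 1] by auto
    have pdN: "smult a' (pderiv G) \<notin> N"
    proof
      assume *: "smult a' (pderiv G) \<in> N"
      have "[:a':] * pderiv G \<in> N" using * by simp
      then have "pderiv G \<in> N" using prime const[OF a'(1)] by blast
      then show False using minG[of "pderiv G"] pd degree_pderiv_less[OF dG] by (auto simp: P_def)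
    qed
    \<comment> \<open>\<open>E\<close> divides a multiple of \<open>pderiv G\<close>, whose degree
      is too small for \<open>N\<close>. So in the factorization \<open>E * q\<close> of a multiple
      of \<open>G\<close> primality puts the cofactor \<open>q\<close> into \<open>N\<close>;
      minimality of \<open>G\<close> then leaves no degree for \<open>E\<close>.\<close>
    have "E \<notin> N" using pdN mult[of E q'] a' by auto
    moreover have "E * q \<in> N" using mult[of G "[:a:]"] G a by (simp add: P_def mult.commute)
    ultimately have "q \<in> N" using prime by blast
    moreover have "q \<noteq> 0" using a G by (auto simp: P_def)
    ultimately have "degree G \<le> degree q" using minG by (auto simp: P_def)
    moreover have "degree G = degree E + degree q"
      using a E0 \<open>q \<noteq> 0\<close> by (metis degree_mult_eq degree_smult_eq)
    ultimately show False using dE by simp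
  qed
  then obtain D where "E = [:D:]" by (metis degree_eq_zeroE)
  with AB E0 G dG show ?thesis by (intro that[of G D A B]) (auto simp: P_def)
qed

section \<open>Analytic continuation of algebraic functions\<close>

lemma holomorphic_poly [holomorphic_intros]:
  "F holomorphic_on S \<Longrightarrow> (\<lambda>z. poly c (F z)) holomorphic_on S"
  unfolding poly_altdef by (intro holomorphic_intros)

text \<open>In \<open>cmod (poly p x) = cmod (lead_coeff p) * (\<Prod>i. cmod (x - r i))\<close>
  each factor is at least the distance to the nearest root.\<close>

lemma near_root:
  fixes p :: "complex poly"
  assumes "degree p > 0"
  obtains y where "poly p y = 0" "cmod (x - y) ^ degree p * cmod (lead_coeff p) \<le> cmod (poly p x)"
proof -
  obtain r where r: "smult (lead_coeff p) (\<Prod>i<degree p. [:- r i, 1:]) = p"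
    using complex_poly_decompose' by blast
  have px: "poly p z = lead_coeff p * (\<Prod>i<degree p. z - r i)" for z
    using arg_cong[OF r, of "\<lambda>q. poly q z"] by (simp add: poly_prod)
  obtain k where k: "k < degree p" "\<And>i. i < degree p \<Longrightarrow> cmod (x - r k) \<le> cmod (x - r i)"
    using ex_min_if_finite[of "(\<lambda>i. cmod (x - r i)) ` {..<degree p}"] assms
    by (auto simp: not_less)
  have "poly p (r k) = 0" using k by (auto simp: px)
  moreover have "cmod (x - r k) ^ degree p \<le> (\<Prod>i<degree p. cmod (x - r i))"
    using prod_mono[of "{..<degree p}" "\<lambda>_. cmod (x - r k)" "\<lambda>i. cmod (x - r i)"] k by simp
  ultimately show ?thesis
    by (intro that[of "r k"]) (auto simp: px[of x] norm_mult prod_norm mult.commute mult_left_mono)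
qed

text \<open>The quotient \<open>(poly p a - poly p b) / (a - b)\<close>, continued to
  \<open>a = b\<close>, where it is the derivative. The summation bound \<open>m\<close> is a
  parameter so that the expression depends continuously on the coefficients of a varying
  \<open>p\<close>.\<close>

definition diff_quot :: "nat \<Rightarrow> complex poly \<Rightarrow> complex \<Rightarrow> complex \<Rightarrow> complex" where
  "diff_quot m p a b = (\<Sum>i\<le>m. coeff p i * (\<Sum>j<i. b ^ (i - Suc j) * a ^ j))"

lemma poly_diff_quot:
  assumes "degree p \<le> m"
  shows "poly p a - poly p b = (a - b) * diff_quot m p a b"
proof -
  have "poly p x = (\<Sum>i\<le>m. coeff p i * x ^ i)" for x
    unfolding poly_altdef using assms
    by (intro sum.mono_neutral_left) (auto simp: coeff_eq_0)
  then show ?thesis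
    by (simp add: diff_quot_def sum_subtractf[symmetric] right_diff_distrib[symmetric] power_diff_sumr2
        sum_distrib_left mult_ac)
qed

lemma diff_quot_same:
  assumes "degree p \<le> m"
  shows "diff_quot m p a a = poly (pderiv p) a"
proof -
  have "p = (\<Sum>i\<le>m. monom (coeff p i) i)"
    using poly_as_sum_of_monoms'[OF assms] by simp
  then have "poly (pderiv p) a = poly (pderiv (\<Sum>i\<le>m. monom (coeff p i) i)) a" by simp
  also have "\<dots> = (\<Sum>i\<le>m. coeff p i * (\<Sum>j<i. a ^ (i - Suc j) * a ^ j))"
    by (auto simp: higher_pderiv_sum[of 1, simplified] poly_sum pderiv_monom poly_monom power_add[symmetric] intro!: sum.cong)
  finally show ?thesis by (simp add: diff_quot_def)
qed

lemma card_simple_roots: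
  fixes p :: "complex poly"
  assumes "p \<noteq> 0" "\<And>y. poly p y = 0 \<Longrightarrow> poly (pderiv p) y \<noteq> 0"
  shows "card {y. poly p y = 0} = degree p"
proof -
  have "rsquarefree p" unfolding rsquarefree_roots using assms(2) by auto
  then have "degree p = degree (smult (lead_coeff p) (\<Prod>z|poly p z = 0. [:-z, 1:]))"
    by (simp add: complex_poly_decompose_rsquarefree)
  also have "\<dots> = card {y. poly p y = 0}"
    using assms(1) by (simp add: degree_prod_sum_eq)
  finally show ?thesis by simp
qed

section \<open>Holomorphic families of simple roots and their continuation along a segment\<close>

definition rect :: "real \<Rightarrow> real \<Rightarrow> real \<Rightarrow> real \<Rightarrow> complex set" where
  "rect a b t e = {z. a < Re z \<and> Re z < b \<and> \<bar>Im z - t\<bar> < e}"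

lemma rect_eq: "rect a b t e = {z. Re z > a} \<inter> {z. Re z < b} \<inter> {z. Im z > t - e} \<inter> {z. Im z < t + e}"
  by (auto simp: rect_def)

lemma open_rect [simp, intro]: "open (rect a b t e)"
  unfolding rect_eq by (intro open_Int open_halfspace_Re_gt open_halfspace_Re_lt open_halfspace_Im_gt open_halfspace_Im_lt)

lemma convex_rect: "convex (rect a b t e)"
  unfolding rect_eq by (intro convex_Int convex_halfspace_Re_gt convex_halfspace_Re_lt convex_halfspace_Im_gt convex_halfspace_Im_lt)

lemma connected_rect [simp, intro]: "connected (rect a b t e)"
  by (rule convex_connected[OF convex_rect])

text \<open>Over \<open>S\<close> the roots of \<open>p z\<close> form an unbranched covering with
  \<open>m\<close> sheets: constant degree keeps roots from escaping to infinity, simplicity keeps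
  them from colliding.\<close>

locale simple_root_family =
  fixes S :: "complex set" and p :: "complex \<Rightarrow> complex poly" and m :: nat
  assumes open_S: "open S"
    and hol: "\<And>i. (\<lambda>z. coeff (p z) i) holomorphic_on S"
    and deg: "\<And>z. z \<in> S \<Longrightarrow> degree (p z) = m"
    and m_pos: "m > 0"
    and simple: "\<And>z y. z \<in> S \<Longrightarrow> poly (p z) y = 0 \<Longrightarrow> poly (pderiv (p z)) y \<noteq> 0"
begin

lemma p_nz: "z \<in> S \<Longrightarrow> p z \<noteq> 0"
  using deg m_pos by fastforce

lemma poly_p: "z \<in> S \<Longrightarrow> poly (p z) y = (\<Sum>i\<le>m. coeff (p z) i * y ^ i)"
  using deg[of z] by (simp add: poly_altdef)

lemma holomorphic_poly_p: "(\<lambda>z. poly (p z) y) holomorphic_on S"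
proof -
  have "(\<lambda>z. \<Sum>i\<le>m. coeff (p z) i * y ^ i) holomorphic_on S"
    by (intro holomorphic_intros hol)
  then show ?thesis by (rule holomorphic_transform) (simp add: poly_p)
qed

lemma continuous_diff_quot:
  "continuous_on (S \<times> UNIV) (\<lambda>(z, a, b). diff_quot m (p z) a b)"
proof -
  have "continuous_on (S \<times> UNIV) (\<lambda>w. coeff (p (fst w)) i)" for i
    by (rule continuous_on_compose2[OF holomorphic_on_imp_continuous_on[OF hol[of i]]])
       (auto intro!: continuous_intros)
  then show ?thesis
    unfolding diff_quot_def case_prod_unfold by (intro continuous_intros)
qed

text \<open>Local uniqueness of roots: near a simple root the quotient stays nonzero by continuity,
  so two distinct nearby values cannot both be roots of the same \<open>p z\<close>.\<close>

lemma diff_quot_nonzero: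
  assumes "z0 \<in> S" "poly (p z0) y0 = 0"
  shows "\<exists>e>0. \<forall>z a b. dist z z0 < e \<longrightarrow> dist a y0 < e \<longrightarrow> dist b y0 < e \<longrightarrow>
     z \<in> S \<and> diff_quot m (p z) a b \<noteq> 0"
proof -
  define U where "U = {w \<in> S \<times> UNIV. (\<lambda>(z, a, b). diff_quot m (p z) a b) w \<in> - {0}}"
  have "open U" unfolding U_def Int_def[symmetric] vimage_def[symmetric]
    using continuous_open_preimage[OF continuous_diff_quot, of "-{0}"] open_S
    by (auto simp: open_Times vimage_def Int_def conj_commute)
  moreover have "(z0, y0, y0) \<in> U"
    using assms simple[OF assms] deg[of z0] by (simp add: U_def diff_quot_same)
  ultimately obtain e where e: "e > 0" "ball (z0, y0, y0) e \<subseteq> U"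
    using open_contains_ball by blast
  show ?thesis
  proof (intro exI[of _ "e / 3"] conjI allI impI)
    fix z a b assume *: "dist z z0 < e/3" "dist a y0 < e/3" "dist b y0 < e/3"
    have "dist (z0, y0, y0) (z, a, b) \<le> dist z0 z + dist (y0, y0) (a, b)"
      by (simp add: dist_Pair_Pair[of z0] sqrt_sum_squares_le_sum)
    also have "dist (y0, y0) (a, b) \<le> dist y0 a + dist y0 b"
      by (simp add: dist_Pair_Pair sqrt_sum_squares_le_sum)
    finally have "dist (z0, y0, y0) (z, a, b) < e" using * by (simp add: dist_commute)
    then have "(z, a, b) \<in> U" using e by auto
    then show "z \<in> S" "diff_quot m (p z) a b \<noteq> 0" by (simp_all add: U_def)
  qed (use e in auto)
qed

text \<open>Continuity of roots: \<open>poly (p z) y0\<close> is small for \<open>z\<close> near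
  \<open>z0\<close> while the leading coefficient stays away from zero, so \<open>near_root\<close>
  finds a root within \<open>e\<close> of \<open>y0\<close>.\<close>

lemma nearby_root:
  assumes "z0 \<in> S" "poly (p z0) y0 = 0" "e > 0"
  shows "\<exists>\<delta>>0. ball z0 \<delta> \<subseteq> S \<and> (\<forall>z\<in>ball z0 \<delta>. \<exists>y. poly (p z) y = 0 \<and> dist y y0 < e)"
proof -
  let ?h = "\<lambda>z. e ^ m * cmod (coeff (p z) m) - cmod (poly (p z) y0)"
  have "continuous_on S ?h"
    by (intro continuous_intros holomorphic_on_imp_continuous_on hol holomorphic_poly_p)
  then have "open (?h -` {0<..} \<inter> S)"
    by (simp add: continuous_on_open_vimage open_S)
  moreover have "z0 \<in> ?h -` {0<..} \<inter> S"
    using assms deg[OF assms(1)] p_nz[OF assms(1)] leading_coeff_neq_0[of "p z0"] by auto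
  ultimately obtain \<delta> where d: "\<delta> > 0" "ball z0 \<delta> \<subseteq> ?h -` {0<..} \<inter> S"
    using open_contains_ball by blast
  show ?thesis
  proof (intro exI[of _ \<delta>] conjI ballI)
    show "\<delta> > 0" by fact
    show "ball z0 \<delta> \<subseteq> S" using d by blast
    fix z assume "z \<in> ball z0 \<delta>"
    then have z: "z \<in> S" "?h z > 0" using d by auto
    obtain y where y: "poly (p z) y = 0"
      "cmod (y0 - y) ^ degree (p z) * cmod (lead_coeff (p z)) \<le> cmod (poly (p z) y0)"
      using near_root[of "p z" y0] deg[OF z(1)] m_pos by metis
    have "cmod (y0 - y) ^ m * cmod (coeff (p z) m) < e ^ m * cmod (coeff (p z) m)"
      using y z deg[OF z(1)] by auto
    then have "cmod (y0 - y) ^ m < e ^ m"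
      by (rule mult_right_less_imp_less) simp
    then have "cmod (y0 - y) < e" using assms(3) by (simp add: power_less_imp_less_base)
    then show "\<exists>y. poly (p z) y = 0 \<and> dist y y0 < e" using y by (auto simp: dist_norm norm_minus_commute)
  qed
qed

text \<open>The implicit function theorem by hand. With \<open>y1 = Y z1\<close>, the identity
  \<open>- poly (p z) y1 = (Y z - y1) * diff_quot m (p z) (Y z) y1\<close> expresses the difference
  quotient of \<open>Y\<close> through that of \<open>\<lambda>z. poly (p z) y1\<close>, and the
  divisor has a nonzero limit.\<close>

lemma continuous_root_holomorphic:
  assumes "open T" "T \<subseteq> S" "continuous_on T Y" "\<And>z. z \<in> T \<Longrightarrow> poly (p z) (Y z) = 0"
  shows "Y holomorphic_on T"
proof (subst holomorphic_on_open[OF assms(1)], intro ballI)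
  fix z1 assume z1: "z1 \<in> T"
  define y1 where "y1 = Y z1"
  have z1S: "z1 \<in> S" and y1: "poly (p z1) y1 = 0" using z1 assms by (auto simp: y1_def)
  obtain F' where F': "((\<lambda>z. poly (p z) y1) has_field_derivative F') (at z1)"
    using holomorphic_poly_p[of y1] open_S z1S by (auto simp: holomorphic_on_open)
  have contY: "(Y \<longlongrightarrow> y1) (at z1)"
    using assms(1,3) z1 by (simp add: continuous_on_eq_continuous_at isCont_def y1_def)
  have "isCont (\<lambda>(z, a, b). diff_quot m (p z) a b) (z1, y1, y1)"
    using continuous_diff_quot z1S open_S
    by (subst (asm) continuous_on_eq_continuous_at) (auto simp: open_Times)
  moreover have "((\<lambda>z. (z, Y z, y1)) \<longlongrightarrow> (z1, y1, y1)) (at z1)"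
    by (intro tendsto_intros contY)
  ultimately have lim: "((\<lambda>z. diff_quot m (p z) (Y z) y1) \<longlongrightarrow> diff_quot m (p z1) y1 y1) (at z1)"
    using isCont_tendsto_compose by force
  have nz: "diff_quot m (p z1) y1 y1 \<noteq> 0"
    using simple[OF z1S y1] deg[OF z1S] by (simp add: diff_quot_same)
  have "((\<lambda>z. - ((poly (p z) y1 - poly (p z1) y1) / (z - z1)) / diff_quot m (p z) (Y z) y1)
      \<longlongrightarrow> - F' / diff_quot m (p z1) y1 y1) (at z1)"
    using F' unfolding has_field_derivative_iff by (intro tendsto_intros lim nz)
  moreover have "eventually (\<lambda>z. - ((poly (p z) y1 - poly (p z1) y1) / (z - z1)) / diff_quot m (p z) (Y z) y1
      = (Y z - Y z1) / (z - z1)) (at z1)"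
  proof -
    have "eventually (\<lambda>z. diff_quot m (p z) (Y z) y1 \<noteq> 0) (at z1)"
      using tendsto_imp_eventually_ne[OF lim nz] .
    moreover have "eventually (\<lambda>z. z \<in> T) (at z1)"
      using assms(1) z1 by (simp add: eventually_at_in_open')
    ultimately show ?thesis
    proof eventually_elim
      case (elim z)
      have "0 - poly (p z) y1 = (Y z - y1) * diff_quot m (p z) (Y z) y1"
        using poly_diff_quot[of "p z" m "Y z" y1] deg[of z] assms(2,4) elim by auto
      then have "Y z - Y z1 = - (poly (p z) y1 - poly (p z1) y1) / diff_quot m (p z) (Y z) y1"
        using elim y1 by (simp add: y1_def field_simps)
      then show ?case by (simp only:) (simp add: minus_divide_left mult.commute del: divide_minus_left)
    qed
  qed
  ultimately have "((\<lambda>z. (Y z - Y z1) / (z - z1)) \<longlongrightarrow> - F' / diff_quot m (p z1) y1 y1) (at z1)"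
    by (rule Lim_transform_eventually)
  then show "\<exists>f'. (Y has_field_derivative f') (at z1)"
    unfolding has_field_derivative_iff by blast
qed

lemma roots_agree:
  assumes "open T" "connected T" "T \<subseteq> S" "Y holomorphic_on T" "y holomorphic_on T"
    and "\<And>z. z \<in> T \<Longrightarrow> poly (p z) (Y z) = 0" "\<And>z. z \<in> T \<Longrightarrow> poly (p z) (y z) = 0"
    and "z1 \<in> T" "Y z1 = y z1" "z \<in> T"
  shows "Y z = y z"
proof -
  have z1S: "z1 \<in> S" using assms by auto
  obtain e where e: "e > 0" "\<And>z a b. dist z z1 < e \<Longrightarrow> dist a (Y z1) < e \<Longrightarrow> dist b (Y z1) < e \<Longrightarrow>
     z \<in> S \<and> diff_quot m (p z) a b \<noteq> 0"
    using diff_quot_nonzero[OF z1S assms(6)[OF \<open>z1 \<in> T\<close>]] by blast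
  have cY: "continuous_on T Y" "continuous_on T y"
    by (rule holomorphic_on_imp_continuous_on[OF assms(4)], rule holomorphic_on_imp_continuous_on[OF assms(5)])
  define U where "U = ball z1 e \<inter> (T \<inter> Y -` ball (Y z1) e) \<inter> (T \<inter> y -` ball (Y z1) e)"
  have "open U"
    unfolding U_def by (rule open_Int[OF open_Int[OF open_ball]];
      rule continuous_open_preimage[OF _ assms(1) open_ball]; fact)
  moreover have "z1 \<in> U" using assms(8,9) e(1) by (simp add: U_def)
  moreover have "Y w = y w" if "w \<in> U" for w
  proof -
    have w: "w \<in> T" "dist w z1 < e" "dist (Y w) (Y z1) < e" "dist (y w) (Y z1) < e"
      using that by (auto simp: U_def dist_commute)
    have "0 = (Y w - y w) * diff_quot m (p w) (Y w) (y w)"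
      using poly_diff_quot[of "p w" m "Y w" "y w"] deg[of w] assms(3,6,7) w by auto
    then show ?thesis using e(2)[OF w(2-4)] by auto
  qed
  moreover have "U \<subseteq> T" by (auto simp: U_def)
  ultimately show ?thesis
    using analytic_continuation_open[of U T Y y z] assms(1,2,4,5,10) by blast
qed

text \<open>Each of the \<open>m\<close> roots at \<open>z0\<close> has a root of \<open>p z\<close>
  within \<open>e\<close> of it; since the roots at \<open>z0\<close> are \<open>2 * e\<close>
  apart, these are \<open>m\<close> different roots and hence all of them. The ball serves roots
  over all its points, not only over the centre, which makes it usable in a compactness
  argument.\<close>

lemma local_branches:
  assumes z0: "z0 \<in> S"
  obtains \<delta> where "\<delta> > 0" "ball z0 \<delta> \<subseteq> S"
    "\<And>z1 y1. z1 \<in> ball z0 \<delta> \<Longrightarrow> poly (p z1) y1 = 0 \<Longrightarrow>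
      \<exists>y. y holomorphic_on ball z0 \<delta> \<and> y z1 = y1 \<and> (\<forall>z\<in>ball z0 \<delta>. poly (p z) (y z) = 0)"
proof -
  define R where "R z = {y. poly (p z) y = 0}" for z
  have finR: "finite (R z)" and cardR: "card (R z) = m" if "z \<in> S" for z
    unfolding R_def using that card_simple_roots[of "p z"] simple[of z] p_nz[of z] deg[of z]
      poly_roots_finite[of "p z"] by auto
  obtain e where e: "e > 0" "\<And>a b. a \<in> R z0 \<Longrightarrow> b \<in> R z0 \<Longrightarrow> a \<noteq> b \<Longrightarrow> 2 * e \<le> dist a b"
  proof -
    define D where "D = (\<lambda>(a, b). dist a b) ` {(a, b) \<in> R z0 \<times> R z0. a \<noteq> b}"
    have "finite D" unfolding D_def
      by (intro finite_imageI finite_subset[OF _ finite_cartesian_product[OF finR finR]]) (use z0 in auto)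
    \<comment> \<open>The element 1 keeps the minimum meaningful when there is only one root and
      \<open>D\<close> is empty.\<close>
    then have "finite (insert 1 D)" by simp
    have "Min (insert 1 D) > 0" using \<open>finite D\<close> by (subst Min_gr_iff) (auto simp: D_def)
    moreover have "Min (insert 1 D) \<le> dist a b" if "a \<in> R z0" "b \<in> R z0" "a \<noteq> b" for a b
      using \<open>finite D\<close> that by (intro Min_le) (auto simp: D_def)
    ultimately show ?thesis by (intro that[of "Min (insert 1 D) / 2"]) auto
  qed
  have "\<exists>\<delta>>0. ball z0 \<delta> \<subseteq> S \<and> (\<forall>z\<in>ball z0 \<delta>. \<exists>y. poly (p z) y = 0 \<and> dist y y0 < e)"
    if "y0 \<in> R z0" for y0
    using that by (intro nearby_root[OF z0 _ e(1)]) (simp add: R_def)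
  then have "\<forall>y0\<in>R z0. \<exists>\<delta>. \<delta> > 0 \<and> ball z0 \<delta> \<subseteq> S \<and>
      (\<forall>z\<in>ball z0 \<delta>. \<exists>y. poly (p z) y = 0 \<and> dist y y0 < e)" by blast
  from bchoice[OF this] obtain d where d: "\<And>y0. y0 \<in> R z0 \<Longrightarrow> d y0 > 0 \<and> ball z0 (d y0) \<subseteq> S \<and>
      (\<forall>z\<in>ball z0 (d y0). \<exists>y. poly (p z) y = 0 \<and> dist y y0 < e)" by blast
  have Rne: "R z0 \<noteq> {}" using cardR[OF z0] m_pos by auto
  define \<delta> where "\<delta> = Min (d ` R z0)"
  have \<delta>: "\<delta> > 0" unfolding \<delta>_def using d Rne finR[OF z0] by (subst Min_gr_iff) auto
  have \<delta>_le: "\<delta> \<le> d y0" if "y0 \<in> R z0" for y0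
    unfolding \<delta>_def using finR[OF z0] that by (intro Min_le) auto
  have ballS: "ball z0 \<delta> \<subseteq> S"
  proof -
    obtain y0 where "y0 \<in> R z0" using Rne by auto
    then have "ball z0 \<delta> \<subseteq> ball z0 (d y0)" "ball z0 (d y0) \<subseteq> S"
      using \<delta>_le[of y0] d[of y0] by (auto intro: less_le_trans)
    then show ?thesis by blast
  qed
  have "\<exists>y. poly (p z) y = 0 \<and> dist y y0 < e" if "z \<in> ball z0 \<delta>" "y0 \<in> R z0" for z y0
  proof -
    have "z \<in> ball z0 (d y0)" using \<delta>_le[OF that(2)] that(1) by simp
    then show ?thesis using d[OF that(2)] by blast
  qed
  note nb = this
  define Y where "Y y0 z = (SOME y. poly (p z) y = 0 \<and> dist y y0 < e)" for y0 z
  have Y: "poly (p z) (Y y0 z) = 0" "dist (Y y0 z) y0 < e" if "z \<in> ball z0 \<delta>" "y0 \<in> R z0" for y0 z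
    using someI_ex[OF nb[OF that]] by (simp_all add: Y_def)
  have sep: "a = b" if "a \<in> R z0" "b \<in> R z0" "dist x a < e" "dist x b < e" for a b x
  proof (rule ccontr)
    assume "a \<noteq> b"
    then have "2 * e \<le> dist a b" using e(2) that by blast
    also have "\<dots> \<le> dist x a + dist x b" by (rule dist_triangle3)
    finally show False using that by simp
  qed
  have all: "R z = (\<lambda>y0. Y y0 z) ` R z0" if "z \<in> ball z0 \<delta>" for z
  proof -
    have "inj_on (\<lambda>y0. Y y0 z) (R z0)"
    proof (rule inj_onI)
      fix a b assume "a \<in> R z0" "b \<in> R z0" "Y a z = Y b z"
      then show "a = b" using sep[of a b "Y a z"] Y(2)[OF that, of a] Y(2)[OF that, of b] by simp
    qed
    then have "card ((\<lambda>y0. Y y0 z) ` R z0) = card (R z)"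
      using that ballS cardR z0 by (simp add: card_image subset_iff)
    moreover have "(\<lambda>y0. Y y0 z) ` R z0 \<subseteq> R z" using Y(1)[OF that] by (auto simp: R_def)
    ultimately show ?thesis using finR[of z] that ballS card_subset_eq by (metis subset_iff)
  qed
  have uniq: "x = Y y0 z" if "z \<in> ball z0 \<delta>" "y0 \<in> R z0" "poly (p z) x = 0" "dist x y0 < e" for x y0 z
  proof -
    have "x \<in> (\<lambda>y0. Y y0 z) ` R z0" using that(3) all[OF that(1)] by (auto simp: R_def)
    then obtain b where b: "b \<in> R z0" "x = Y b z" by blast
    then have "b = y0" using sep[of b y0 x] Y(2)[of z b] \<open>z \<in> _\<close> \<open>y0 \<in> _\<close> \<open>dist x y0 < e\<close> by simp
    with b show ?thesis by simp
  qed
  have contY: "continuous_on (ball z0 \<delta>) (Y y0)" if y0: "y0 \<in> R z0" for y0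
    unfolding continuous_on_iff
  proof (intro ballI allI impI)
    fix z1 \<eta> assume z1: "z1 \<in> ball z0 \<delta>" and "(\<eta> :: real) > 0"
    \<comment> \<open>A root this close to \<open>Y y0 z1\<close> is still within \<open>e\<close>
      of \<open>y0\<close>, so \<open>uniq\<close> identifies it with \<open>Y y0 z\<close>.\<close>
    define \<eta>' where "\<eta>' = min \<eta> (e - dist (Y y0 z1) y0)"
    have \<eta>': "\<eta>' > 0" using \<open>\<eta> > 0\<close> Y(2)[OF z1 y0] by (simp add: \<eta>'_def)
    obtain r where r: "r > 0" "\<And>z. z \<in> ball z1 r \<Longrightarrow> \<exists>y. poly (p z) y = 0 \<and> dist y (Y y0 z1) < \<eta>'"
      using nearby_root[OF subsetD[OF ballS z1] Y(1)[OF z1 y0] \<eta>'] by blast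
    obtain r' where r': "r' > 0" "ball z1 r' \<subseteq> ball z0 \<delta>"
      using z1 open_ball open_contains_ball by metis
    have *: "dist (Y y0 z) (Y y0 z1) < \<eta>" if zr: "dist z z1 < min r r'" for z
    proof -
      obtain x where x: "poly (p z) x = 0" "dist x (Y y0 z1) < \<eta>'"
        using r(2)[of z] zr by (auto simp: dist_commute)
      have "dist x y0 < e" using x dist_triangle[of x y0 "Y y0 z1"] by (simp add: \<eta>'_def)
      moreover have "z \<in> ball z0 \<delta>" using r' zr by (auto simp: dist_commute)
      ultimately have "x = Y y0 z" using uniq y0 x by blast
      then show ?thesis using x by (simp add: \<eta>'_def)
    qed
    show "\<exists>d>0. \<forall>z\<in>ball z0 \<delta>. dist z z1 < d \<longrightarrow> dist (Y y0 z) (Y y0 z1) < \<eta>"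
    proof (intro exI[of _ "min r r'"] conjI ballI impI)
      show "min r r' > 0" using r(1) r'(1) by simp
    qed (rule *)
  qed
  show ?thesis
  proof (rule that[OF \<delta> ballS])
    fix z1 y1 assume z1: "z1 \<in> ball z0 \<delta>" and y1: "poly (p z1) y1 = 0"
    then obtain y0 where y0: "y0 \<in> R z0" "y1 = Y y0 z1" using all[OF z1] by (auto simp: R_def)
    have "Y y0 holomorphic_on ball z0 \<delta>"
      by (rule continuous_root_holomorphic[OF open_ball ballS contY[OF y0(1)]]) (rule Y(1)[OF _ y0(1)])
    then show "\<exists>y. y holomorphic_on ball z0 \<delta> \<and> y z1 = y1 \<and> (\<forall>z\<in>ball z0 \<delta>. poly (p z) (y z) = 0)"
      using y0(2) Y(1)[OF _ y0(1)] by (intro exI[of _ "Y y0"]) simp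
  qed
qed

text \<open>A Lebesgue number of the covering by good sets gives a step length \<open>h\<close> and
  a height \<open>e\<close> valid along the whole segment. Finitely many steps therefore reach
  \<open>c\<close> without the rectangle getting thinner.\<close>

lemma continue_root_along_segment:
  assumes ab: "a < b" and bc: "b \<le> c" and e0: "e0 > 0"
    and rectS: "rect a b t e0 \<subseteq> S" and Y: "Y holomorphic_on rect a b t e0"
    and root: "\<And>z. z \<in> rect a b t e0 \<Longrightarrow> poly (p z) (Y z) = 0"
    and segS: "\<And>x. b \<le> x \<Longrightarrow> x \<le> c \<Longrightarrow> Complex x t \<in> S"
  obtains e Y' where "e > 0" "e \<le> e0" "Y' holomorphic_on rect a c t e"
    "\<And>z. z \<in> rect a b t e \<Longrightarrow> Y' z = Y z"
proof -
  define K where "K = (\<lambda>x. Complex x t) ` {b..c}"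
  have "compact K" unfolding K_def Complex_eq
    by (intro compact_continuous_image continuous_intros compact_Icc)
  have KS: "K \<subseteq> S" using segS by (auto simp: K_def)
  define good where "good B \<longleftrightarrow> open B \<and> B \<subseteq> S \<and> (\<forall>z1\<in>B. \<forall>y1. poly (p z1) y1 = 0 \<longrightarrow>
      (\<exists>y. y holomorphic_on B \<and> y z1 = y1 \<and> (\<forall>z\<in>B. poly (p z) (y z) = 0)))" for B
  have "K \<subseteq> \<Union>{B. good B}"
  proof
    fix z assume "z \<in> K"
    then have "z \<in> S" using KS by auto
    then obtain \<delta> where "\<delta> > 0" "good (ball z \<delta>)"
      using local_branches[of z] unfolding good_def by (metis open_ball)
    then show "z \<in> \<Union>{B. good B}" by (auto intro!: exI[of _ "ball z \<delta>"])
  qed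
  then obtain \<delta> where \<delta>: "\<delta> > 0" "\<And>z. z \<in> K \<Longrightarrow> \<exists>B\<in>{B. good B}. ball z \<delta> \<subseteq> B"
    by (rule Heine_Borel_lemma[OF \<open>compact K\<close>]) (auto simp: good_def)
  \<comment> \<open>Half of the Lebesgue number, so that the square with half side \<open>h\<close>
    fits into a ball of radius \<delta>.\<close>
  define h where "h = \<delta> / 2"
  define e where "e = min h e0"
  have h: "h > 0" and e: "e > 0" "e \<le> e0" "e \<le> h" using \<delta> e0 by (auto simp: h_def e_def)
  have in_ball: "rect (x - h) (x + h) t h \<subseteq> ball (Complex x t) \<delta>" for x
  proof
    fix z assume "z \<in> rect (x - h) (x + h) t h"
    then have "\<bar>Re (z - Complex x t)\<bar> < h" "\<bar>Im (z - Complex x t)\<bar> < h" by (auto simp: rect_def abs_less_iff)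
    then have "cmod (z - Complex x t) < \<delta>"
      using cmod_le[of "z - Complex x t"] by (simp add: h_def)
    then show "z \<in> ball (Complex x t) \<delta>" by (simp add: dist_norm norm_minus_commute)
  qed
  define P where "P x \<longleftrightarrow> (\<exists>Y'. Y' holomorphic_on rect a x t e \<and> rect a x t e \<subseteq> S \<and>
    (\<forall>z\<in>rect a x t e. poly (p z) (Y' z) = 0) \<and> (\<forall>z\<in>rect a b t e. Y' z = Y z))" for x
  have step: "P (min c (x + h))" if Px: "P x" and x: "b \<le> x" "x \<le> c" for x
  proof -
    obtain Y1 where Y1: "Y1 holomorphic_on rect a x t e" "rect a x t e \<subseteq> S"
      "\<And>z. z \<in> rect a x t e \<Longrightarrow> poly (p z) (Y1 z) = 0" "\<And>z. z \<in> rect a b t e \<Longrightarrow> Y1 z = Y z"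
      using Px by (auto simp: P_def)
    \<comment> \<open>A point of the old rectangle less than \<open>h\<close> to the left of
      \<open>x\<close>: there the new branch is chosen to agree with the old one, and
      \<open>roots_agree\<close> spreads the agreement over the overlap.\<close>
    define x1 where "x1 = max (x - h / 2) ((a + x) / 2)"
    define z1 where "z1 = Complex x1 t"
    have x1: "a < x1" "x1 < x" "x - h < x1" using ab x h by (auto simp: x1_def max_def field_simps)
    have z1: "z1 \<in> rect a x t e" using x1 e by (auto simp: z1_def rect_def)
    obtain B where B: "good B" "ball (Complex x t) \<delta> \<subseteq> B"
      using \<delta>(2)[of "Complex x t"] x by (auto simp: K_def)
    have RB: "rect (x - h) (x + h) t e \<subseteq> B"
      using in_ball[of x] B e by (fastforce simp: rect_def)
    have z1B: "z1 \<in> B" using RB x1 e h by (auto simp: z1_def rect_def subset_iff)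
    obtain y where y: "y holomorphic_on B" "y z1 = Y1 z1" "\<And>z. z \<in> B \<Longrightarrow> poly (p z) (y z) = 0"
      using B(1) z1B Y1(3)[OF z1] unfolding good_def by blast
    have BS: "B \<subseteq> S" using B by (auto simp: good_def)
    define T where "T = rect (max a (x - h)) x t e"
    have T: "T \<subseteq> rect a x t e" "T \<subseteq> rect (x - h) (x + h) t e" "z1 \<in> T"
      using x1 h e by (auto simp: T_def rect_def z1_def)
    have agree: "Y1 z = y z" if "z \<in> T" for z
    proof (rule roots_agree[of T Y1 y z1 z])
      show "open T" "connected T" by (auto simp: T_def)
      show "T \<subseteq> S" using T(1) Y1(2) by blast
      show "Y1 holomorphic_on T" "y holomorphic_on T"
        using holomorphic_on_subset Y1(1) y(1) T RB by blast+
    qed (use Y1 y T RB that in auto)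
    define Y2 where "Y2 z = (if z \<in> rect a x t e then Y1 z else y z)" for z
    have Un: "rect a (x + h) t e \<subseteq> rect a x t e \<union> rect (x - h) (x + h) t e"
      using h by (auto simp: rect_def)
    have "Y2 holomorphic_on rect a x t e \<union> rect (x - h) (x + h) t e" unfolding Y2_def
    proof (rule holomorphic_on_If_Un)
      show "y holomorphic_on rect (x - h) (x + h) t e" using y RB holomorphic_on_subset by blast
      show "Y1 z = y z" if "z \<in> rect a x t e" "z \<in> rect (x - h) (x + h) t e" for z
        using that by (intro agree) (auto simp: T_def rect_def)
    qed (use Y1 in auto)
    then have "Y2 holomorphic_on rect a (min c (x + h)) t e"
      by (rule holomorphic_on_subset) (use Un in \<open>auto simp: rect_def\<close>)
    moreover have sub: "rect a (min c (x + h)) t e \<subseteq> rect a x t e \<union> rect (x - h) (x + h) t e"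
      using Un by (auto simp: rect_def)
    then have "rect a (min c (x + h)) t e \<subseteq> S" using Y1(2) RB BS by blast
    moreover have "poly (p z) (Y2 z) = 0" if "z \<in> rect a (min c (x + h)) t e" for z
      using that sub Y1(3) y(3) RB by (auto simp: Y2_def)
    moreover have "Y2 z = Y z" if "z \<in> rect a b t e" for z
      using that x Y1(4) by (auto simp: Y2_def rect_def)
    ultimately show ?thesis unfolding P_def by blast
  qed
  have sube: "rect a b t e \<subseteq> rect a b t e0" using e by (auto simp: rect_def)
  have P0: "P b" unfolding P_def
    using sube rectS Y root holomorphic_on_subset by (intro exI[of _ Y]) blast
  have "P (min c (b + real n * h))" for n
  proof (induction n)
    case 0 then show ?case using P0 bc by (simp add: min_absorb2)
  next
    case (Suc n)
    have "P (min c (min c (b + real n * h) + h))"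
      using step[OF Suc.IH] bc h by auto
    moreover have "min c (min c (b + real n * h) + h) = min c (b + real (Suc n) * h)"
      using h by (auto simp: min_def algebra_simps)
    ultimately show ?case by simp
  qed
  moreover obtain n where "c - b < real n * h" using reals_Archimedean3[OF h] by blast
  ultimately have "P c" by (metis add.commute diff_less_eq min.absorb1 less_imp_le)
  then show ?thesis using that e by (auto simp: P_def)
qed

end

section \<open>The Boettcher coordinate at infinity\<close>

text \<open>The map \<open>t \<mapsto> 1 / f (1 / t)\<close>, continued holomorphically to \<open>t = 0\<close>.\<close>

definition inf_conj :: "complex poly \<Rightarrow> complex \<Rightarrow> complex" where
  "inf_conj f t = t ^ degree f / poly (reflect_poly f) t"

lemma poly_inverse_inf_conj:
  assumes "t \<noteq> 0"
  shows "poly f (1 / t) = 1 / inf_conj f t"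
  using assms poly_reflect_poly_nz[of t f] by (simp add: inf_conj_def field_simps)

lemma inf_conj_small:
  fixes f :: "complex poly"
  assumes d: "degree f \<ge> 2"
  obtains \<delta> where "\<delta> > 0" "\<delta> < 1"
    "\<And>t. cmod t < \<delta> \<Longrightarrow> cmod (poly (reflect_poly f) t / lead_coeff f - 1) < 1 / 2"
    "\<And>t. cmod t < \<delta> \<Longrightarrow> cmod (inf_conj f t) \<le> cmod t / 2"
proof -
  let ?a = "lead_coeff f" and ?g = "\<lambda>t. poly (reflect_poly f) t / lead_coeff f"
  have a: "?a \<noteq> 0" using d by auto
  have "isCont ?g 0" by (intro continuous_intros) (use a in auto)
  moreover have "?g 0 = 1" using a by (simp add: reflect_poly_at_0_eq_0_iff poly_0_coeff_0)
  ultimately obtain e where e: "e > 0" "\<And>t. cmod t < e \<Longrightarrow> cmod (?g t - 1) < 1 / 2"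
    unfolding continuous_at_eps_delta dist_norm by (metis diff_zero half_gt_zero zero_less_one)
  \<comment> \<open>The denominator of \<open>inf_conj f t\<close> is at least
    \<open>cmod ?a / 2\<close>, and the numerator at most \<open>cmod t * (cmod ?a / 4)\<close>
    because the degree is at least 2.\<close>
  define \<delta> where "\<delta> = min e (min (1/2) (cmod ?a / 4))"
  have \<delta>: "\<delta> > 0" "\<delta> < 1" "\<delta> \<le> e" "\<delta> \<le> cmod ?a / 4" using e a by (auto simp: \<delta>_def)
  show ?thesis
  proof (rule that[OF \<delta>(1,2)])
    fix t :: complex assume t: "cmod t < \<delta>"
    show g: "cmod (?g t - 1) < 1 / 2" using e t \<delta> by auto
    have "1 / 2 \<le> cmod (?g t)"
      using norm_triangle_ineq2[of 1 "1 - ?g t"] g by (simp add: norm_minus_commute)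
    then have R: "cmod ?a / 2 \<le> cmod (poly (reflect_poly f) t)"
      using a by (simp add: norm_divide field_simps)
    have "cmod t ^ degree f \<le> cmod t ^ 2"
      using d t \<delta> by (intro power_decreasing) auto
    also have "\<dots> \<le> cmod t * (cmod ?a / 4)" using t \<delta>
      unfolding power2_eq_square by (intro mult_left_mono) auto
    also have "\<dots> \<le> cmod t / 2 * cmod (poly (reflect_poly f) t)"
      using mult_left_mono[OF R, of "cmod t / 2"] by simp
    finally show "cmod (inf_conj f t) \<le> cmod t / 2"
      using R a by (auto simp: inf_conj_def norm_divide norm_power divide_le_eq)
  qed
qed

text \<open>Boettcher's theorem at the superattracting fixed point 0 of \<open>inf_conj f\<close>,
  with the local inverse \<theta>. The last clause identifies the Green function near infinity with
  \<open>- ln (cmod (\<phi> t))\<close>.\<close>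

lemma boettcher:
  fixes f :: "complex poly"
  assumes d2: "degree f \<ge> 2"
  obtains \<phi> \<theta> \<delta> \<eta> where "\<delta> > 0" "\<delta> < 1" "\<eta> > 0"
    "\<phi> holomorphic_on ball 0 \<delta>" "\<phi> 0 = 0" "inj_on \<phi> (ball 0 \<delta>)" "deriv \<phi> 0 \<noteq> 0"
    "\<And>t. t \<in> ball 0 \<delta> \<Longrightarrow> inf_conj f t \<in> ball 0 \<delta>"
    "\<And>t. t \<in> ball 0 \<delta> \<Longrightarrow> \<phi> (inf_conj f t) = \<phi> t ^ degree f"
    "\<theta> holomorphic_on ball 0 \<eta>" "\<And>w. w \<in> ball 0 \<eta> \<Longrightarrow> \<theta> w \<in> ball 0 \<delta> \<and> \<phi> (\<theta> w) = w"
    "\<And>t. t \<in> ball 0 \<delta> \<Longrightarrow> t \<noteq> 0 \<Longrightarrow> \<phi> t \<noteq> 0 \<and>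
      (\<lambda>n. log_plus (cmod ((poly f ^^ n) (1 / t))) / real (degree f) ^ n) \<longlonglongrightarrow> - ln (cmod (\<phi> t))"
proof -
  define d where "d = degree f"
  define a where "a = lead_coeff f"
  define fr where "fr = poly (reflect_poly f)"
  define h where "h = inf_conj f"
  have h_eq: "h t = t ^ d / fr t" for t by (simp add: h_def inf_conj_def fr_def d_def)
  have a0: "a \<noteq> 0" and d: "d \<ge> 2" using d2 by (auto simp: a_def d_def)
  obtain \<delta>0 where \<delta>0: "\<delta>0 > 0" "\<delta>0 < 1"
    and near1: "\<And>t. cmod t < \<delta>0 \<Longrightarrow> cmod (fr t / a - 1) < 1 / 2"
    and h_half: "\<And>t. cmod t < \<delta>0 \<Longrightarrow> cmod (h t) \<le> cmod t / 2"
    using inf_conj_small[OF d2] unfolding fr_def a_def h_def by metis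
  \<comment> \<open>The bound \<open>1 / 2\<close> in \<open>near1\<close> keeps the argument of
    \<open>Ln\<close> in the right half-plane and makes \<open>s\<close> bounded by 1.\<close>
  define s where "s t = - Ln (fr t / a)" for t
  have pos: "Re (fr t / a) > 0" if "cmod t < \<delta>0" for t
    using near1[OF that] abs_Re_le_cmod[of "fr t / a - 1"] by auto
  have fr0: "fr t \<noteq> 0" if "cmod t < \<delta>0" for t using pos[OF that] by auto
  have exp_s: "exp (s t) = a / fr t" if "cmod t < \<delta>0" for t
    using fr0[OF that] a0 by (simp add: s_def exp_minus)
  have s_le: "cmod (s t) \<le> 1" if "cmod t < \<delta>0" for t
    using norm_Ln_le[of "fr t / a - 1"] near1[OF that] by (simp add: s_def)
  have nonpos: "z \<notin> \<real>\<^sub>\<le>\<^sub>0" if "Re z > 0" for z using that by (auto elim!: nonpos_Reals_cases)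
  have s_hol: "s holomorphic_on ball 0 \<delta>0"
    unfolding s_def fr_def by (intro holomorphic_intros) (use pos nonpos a0 fr_def in auto)
  have h_hol: "h holomorphic_on ball 0 \<delta>0"
    unfolding h_eq[abs_def] fr_def by (intro holomorphic_intros) (use fr0 fr_def in auto)
  have h_le: "cmod ((h ^^ n) t) \<le> cmod t" if "cmod t < \<delta>0" for n t
  proof (induction n)
    case (Suc n)
    then show ?case using h_half[of "(h ^^ n) t"] that norm_ge_zero[of "(h ^^ n) t"]
      unfolding funpow.simps o_apply by linarith
  qed auto
  have h_img: "(h ^^ n) ` ball 0 \<delta>0 \<subseteq> ball 0 \<delta>0" for n
  proof clarify
    fix t assume "t \<in> ball (0::complex) \<delta>0"
    then show "(h ^^ n) t \<in> ball 0 \<delta>0" using h_le[of t n] by simp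
  qed
  have hn_hol: "(h ^^ n) holomorphic_on ball 0 \<delta>0" for n
  proof (induction n)
    case (Suc n)
    show ?case unfolding funpow.simps by (rule holomorphic_on_compose_gen[OF Suc h_hol h_img])
  qed (simp add: id_def)
  \<comment> \<open>Since \<open>h t = t ^ d * exp (s t) / a\<close>, this series is the logarithm of the limit of
    the \<open>d ^ n\<close>-th roots of \<open>(h ^^ n) t\<close>, divided by \<open>c * t\<close>.\<close>
  define T where "T n t = s ((h ^^ n) t) / of_nat d ^ Suc n" for n t
  define S where "S t = (\<Sum>n. T n t)" for t
  have T_le: "cmod (T n t) \<le> (1 / 2) ^ Suc n" if "cmod t < \<delta>0" for n t
  proof -
    have "cmod (T n t) \<le> 1 / real d ^ Suc n"
      using s_le[of "(h ^^ n) t"] h_le[OF that, of n] that d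
      by (simp add: T_def norm_divide norm_power norm_mult divide_right_mono)
    also have "\<dots> \<le> 1 / 2 ^ Suc n"
      using d power_mono[of 2 "real d" "Suc n"] by (intro divide_left_mono) auto
    finally show ?thesis by (simp add: power_divide)
  qed
  have sum_half: "summable (\<lambda>n. (1 / 2 :: real) ^ Suc n)" using power_half_series sums_summable by blast
  have T_summable: "summable (\<lambda>n. T n t)" and S_le: "cmod (S t) \<le> 1" if "cmod t < \<delta>0" for t
  proof -
    show "summable (\<lambda>n. T n t)"
      by (rule summable_comparison_test'[OF sum_half, of 0]) (use T_le that in auto)
    have "cmod (S t) \<le> (\<Sum>n. (1 / 2 :: real) ^ Suc n)" unfolding S_def
      by (rule norm_suminf_le[OF _ sum_half]) (use T_le that in auto)
    also have "\<dots> = 1" using power_half_series sums_unique by metis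
    finally show "cmod (S t) \<le> 1" .
  qed
  have S_hol: "S holomorphic_on ball 0 \<delta>0"
  proof (rule holomorphic_uniform_sequence[of _ "\<lambda>N t. \<Sum>n<N. T n t"])
    show "(\<lambda>t. \<Sum>n<N. T n t) holomorphic_on ball 0 \<delta>0" for N
    proof (intro holomorphic_intros)
      fix n
      have "(\<lambda>t. s ((h ^^ n) t)) holomorphic_on ball 0 \<delta>0"
        using holomorphic_on_compose_gen[OF hn_hol s_hol h_img] by (simp add: o_def)
      then show "T n holomorphic_on ball 0 \<delta>0"
        unfolding T_def by (intro holomorphic_intros) (use d in auto)
    qed
    fix x :: complex assume "x \<in> ball 0 \<delta>0"
    then obtain e where e: "e > 0" "cball x e \<subseteq> ball 0 \<delta>0"
      using open_ball open_contains_cball by metis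
    have "uniform_limit (cball x e) (\<lambda>N t. \<Sum>n<N. T n t) (\<lambda>t. \<Sum>n. T n t) sequentially"
      by (rule Weierstrass_m_test[OF _ sum_half]) (use e T_le in auto)
    then show "\<exists>e>0. cball x e \<subseteq> ball 0 \<delta>0 \<and> uniform_limit (cball x e) (\<lambda>N t. \<Sum>n<N. T n t) S sequentially"
      using e unfolding S_def by blast
  qed auto
  have "d - 1 \<noteq> 0" using d by simp
  \<comment> \<open>The normalization forced by leading terms: \<phi> is \<open>c * t\<close> and
    \<open>h\<close> is \<open>t ^ d / a\<close> to first order, so
    \<open>\<phi> (h t) = \<phi> t ^ d\<close> requires \<open>c / a = c ^ d\<close>.\<close>
  then obtain c where "1 / a = c ^ (d - 1)" by (rule exists_complex_root)
  then have c: "c ^ (d - 1) = 1 / a" ..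
  have c0: "c \<noteq> 0"
  proof
    assume "c = 0"
    then have "c ^ (d - 1) = 0" using d by (simp add: zero_power)
    with c a0 show False by simp
  qed
  have cd: "c ^ d = c / a"
  proof -
    have "c ^ d = c * c ^ (d - 1)" using d by (cases d) auto
    then show ?thesis using c by simp
  qed
  define \<phi> where "\<phi> t = c * t * exp (S t)" for t
  have \<phi>_hol: "\<phi> holomorphic_on ball 0 \<delta>0" unfolding \<phi>_def by (intro holomorphic_intros S_hol)
  have \<phi>_h: "\<phi> (h t) = \<phi> t ^ d" if t: "cmod t < \<delta>0" for t
  proof -
    \<comment> \<open>The shift of the series that turns into
      \<open>S (h t) = d * S t - s t\<close>, the functional equation in logarithmic form.\<close>
    have T_h: "of_nat d * T (Suc n) t = T n (h t)" for n
      using d by (simp add: T_def funpow_swap1)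
    have "S t = T 0 t + (\<Sum>n. T (Suc n) t)"
      unfolding S_def using suminf_split_head[OF T_summable[OF t]] by simp
    then have "of_nat d * S t = of_nat d * T 0 t + of_nat d * (\<Sum>n. T (Suc n) t)"
      by (simp add: distrib_left)
    also have "of_nat d * T 0 t = s t" using d by (simp add: T_def)
    also have "of_nat d * (\<Sum>n. T (Suc n) t) = (\<Sum>n. of_nat d * T (Suc n) t)"
      using summable_ignore_initial_segment[OF T_summable[OF t], of 1] by (intro suminf_mult[symmetric]) simp
    also have "(\<Sum>n. of_nat d * T (Suc n) t) = S (h t)" unfolding T_h S_def ..
    finally have "S (h t) = of_nat d * S t - s t" by simp
    then have "exp (S (h t)) = exp (S t) ^ d * (fr t / a)"
      using exp_s[OF t] by (simp add: exp_diff exp_of_nat_mult)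
    then have "\<phi> (h t) = c * h t * (exp (S t) ^ d * (fr t / a))" by (simp only: \<phi>_def)
    also have "\<dots> = c / a * (t * exp (S t)) ^ d"
      using fr0[OF t] by (simp add: h_eq power_mult_distrib)
    also have "\<dots> = \<phi> t ^ d" by (simp add: cd[symmetric] \<phi>_def power_mult_distrib)
    finally show ?thesis .
  qed
  have "(\<phi> has_field_derivative c * exp (S 0)) (at 0)"
  proof -
    have "S field_differentiable at 0"
      using S_hol \<delta>0 holomorphic_on_imp_differentiable_at[of S "ball 0 \<delta>0" 0] by auto
    then obtain S' where "(S has_field_derivative S') (at 0)" by (auto simp: field_differentiable_def)
    then show ?thesis unfolding \<phi>_def by (auto intro!: derivative_eq_intros)
  qed
  then have d\<phi>: "deriv \<phi> 0 \<noteq> 0" using c0 by (simp add: DERIV_imp_deriv)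
  obtain \<delta> where \<delta>: "\<delta> > 0" "ball (0::complex) \<delta> \<subseteq> ball 0 \<delta>0" "open (\<phi> ` ball 0 \<delta>)" "inj_on \<phi> (ball 0 \<delta>)"
  proof (rule has_complex_derivative_locally_invertible[OF \<phi>_hol _ open_ball d\<phi>])
    show "0 \<in> ball 0 \<delta>0" using \<delta>0 by simp
  qed (rule that)
  have small: "cmod t < \<delta>0" if "t \<in> ball 0 \<delta>" for t using \<delta> that by auto
  have \<phi>_hol': "\<phi> holomorphic_on ball 0 \<delta>" by (rule holomorphic_on_subset[OF \<phi>_hol \<delta>(2)])
  obtain \<theta> where \<theta>: "\<theta> holomorphic_on \<phi> ` ball 0 \<delta>" "\<And>z. z \<in> ball 0 \<delta> \<Longrightarrow> \<theta> (\<phi> z) = z"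
    by (rule holomorphic_has_inverse[OF \<phi>_hol' open_ball \<delta>(4)]) (rule that)
  have \<phi>0: "\<phi> 0 = 0" by (simp add: \<phi>_def)
  have "0 \<in> \<phi> ` ball 0 \<delta>" using \<phi>0 \<delta>(1) by (intro image_eqI[of _ _ 0]) auto
  then obtain \<eta> where \<eta>: "\<eta> > 0" "ball 0 \<eta> \<subseteq> \<phi> ` ball 0 \<delta>" using \<delta>(3) open_contains_ball by blast
  have \<delta>1: "\<delta> < 1"
  proof (rule ccontr)
    assume "\<not> \<delta> < 1"
    then have "of_real \<delta>0 \<in> ball (0::complex) \<delta>" using \<delta>0 by simp
    from subsetD[OF \<delta>(2) this] show False by simp
  qed
  show ?thesis
  proof (rule that[OF \<delta>(1) \<delta>1 \<eta>(1) \<phi>_hol' \<phi>0 \<delta>(4) d\<phi>])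
    show "\<theta> holomorphic_on ball 0 \<eta>" using \<theta>(1) \<eta>(2) holomorphic_on_subset by blast
    show "\<theta> w \<in> ball 0 \<delta> \<and> \<phi> (\<theta> w) = w" if "w \<in> ball 0 \<eta>" for w
      using \<eta>(2) \<theta>(2) that by force
    show "inf_conj f t \<in> ball 0 \<delta>" if "t \<in> ball 0 \<delta>" for t
      using h_half[OF small[OF that]] that norm_ge_zero[of "inf_conj f t"]
      unfolding h_def mem_ball_0 by linarith
    show "\<phi> (inf_conj f t) = \<phi> t ^ degree f" if "t \<in> ball 0 \<delta>" for t
      using \<phi>_h[OF small[OF that]] by (simp add: h_def d_def)
  next
    fix t :: complex assume t: "t \<in> ball 0 \<delta>" "t \<noteq> 0"
    have t': "cmod t < \<delta>0" using small t by auto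
    have \<phi>t: "\<phi> t \<noteq> 0" using t c0 by (simp add: \<phi>_def)
    have hn: "(h ^^ n) t \<noteq> 0 \<and> cmod ((h ^^ n) t) < \<delta>0 \<and> (poly f ^^ n) (1 / t) = 1 / (h ^^ n) t
       \<and> \<phi> ((h ^^ n) t) = \<phi> t ^ (d ^ n)" for n
    proof (induction n)
      case 0 show ?case using t t' by simp
    next
      case (Suc n)
      let ?x = "(h ^^ n) t"
      have x: "?x \<noteq> 0" "cmod ?x < \<delta>0" using Suc by auto
      have "h ?x \<noteq> 0" using x fr0 by (simp add: h_eq)
      moreover have "cmod (h ?x) < \<delta>0" using h_half[OF x(2)] x(2) norm_ge_zero[of "h ?x"] by linarith
      moreover have "poly f (1 / ?x) = 1 / h ?x" using poly_inverse_inf_conj[OF x(1)] by (simp add: h_def)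
      moreover have "\<phi> (h ?x) = \<phi> t ^ (d ^ Suc n)"
        using \<phi>_h[OF x(2)] Suc by (simp add: power_mult[symmetric] mult.commute)
      ultimately show ?case using Suc by simp
    qed
    \<comment> \<open>The bounded discrepancy between \<open>ln (cmod (\<phi> x))\<close> and
      \<open>ln (cmod x)\<close> at \<open>x = (h ^^ n) t\<close>; dividing by \<open>d ^ n\<close>
      removes it in the limit.\<close>
    define b where "b n = ln (cmod c) + Re (S ((h ^^ n) t))" for n
    have lp: "log_plus (cmod ((poly f ^^ n) (1 / t))) / real d ^ n = - ln (cmod (\<phi> t)) + b n / real d ^ n" for n
    proof -
      let ?x = "(h ^^ n) t"
      have x: "?x \<noteq> 0" "cmod ?x < \<delta>0" using hn by auto
      have "real (d ^ n) * ln (cmod (\<phi> t)) = ln (cmod (\<phi> ?x))"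
        using hn[of n] \<phi>t by (simp add: norm_power ln_realpow)
      also have "\<dots> = b n + ln (cmod ?x)"
        using x c0 by (simp add: \<phi>_def norm_mult ln_mult b_def)
      finally have "- ln (cmod ?x) = b n - real d ^ n * ln (cmod (\<phi> t))" by simp
      moreover have "log_plus (cmod ((poly f ^^ n) (1 / t))) = - ln (cmod ?x)"
      proof -
        have "cmod ((poly f ^^ n) (1 / t)) = 1 / cmod ?x" using hn[of n] by (simp only: norm_divide norm_one)
        moreover have "1 \<le> 1 / cmod ?x" using x \<delta>0 by simp
        ultimately have "log_plus (cmod ((poly f ^^ n) (1 / t))) = ln (1 / cmod ?x)"
          by (simp only: log_plus_def max_absorb2)
        then show ?thesis using x by (simp add: ln_div)
      qed
      ultimately show ?thesis using d by (simp add: field_simps)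
    qed
    have "(\<lambda>n. b n / real d ^ n) \<longlonglongrightarrow> 0"
    proof (rule Lim_null_comparison)
      show "\<forall>\<^sub>F n in sequentially. norm (b n / real d ^ n) \<le> (\<bar>ln (cmod c)\<bar> + 1) * (1 / real d) ^ n"
      proof (intro always_eventually allI)
        fix n
        have "\<bar>b n\<bar> \<le> \<bar>ln (cmod c)\<bar> + 1"
          using abs_Re_le_cmod[of "S ((h ^^ n) t)"] S_le[of "(h ^^ n) t"] hn[of n] by (simp add: b_def)
        then have "\<bar>b n\<bar> / real d ^ n \<le> (\<bar>ln (cmod c)\<bar> + 1) / real d ^ n"
          by (intro divide_right_mono) auto
        then show "norm (b n / real d ^ n) \<le> (\<bar>ln (cmod c)\<bar> + 1) * (1 / real d) ^ n"
          by (simp add: power_divide)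
      qed
      show "(\<lambda>n. (\<bar>ln (cmod c)\<bar> + 1) * (1 / real d) ^ n) \<longlonglongrightarrow> 0"
        using d by (intro tendsto_mult_right_zero LIMSEQ_power_zero) auto
    qed
    then have "(\<lambda>n. - ln (cmod (\<phi> t)) + b n / real d ^ n) \<longlonglongrightarrow> - ln (cmod (\<phi> t)) + 0"
      by (intro tendsto_intros)
    then show "\<phi> t \<noteq> 0 \<and> (\<lambda>n. log_plus (cmod ((poly f ^^ n) (1 / t))) / real (degree f) ^ n)
        \<longlonglongrightarrow> - ln (cmod (\<phi> t))"
      using \<phi>t lp by (simp add: d_def)
  qed
qed

section \<open>Continuation of the inverse Boettcher coordinate\<close>

text \<open>Holomorphic functions on a connected open set have no zero divisors; this makes the set
  of algebraic relations between two such functions a prime ideal.\<close>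

lemma product_vanishes_imp:
  fixes F G :: "complex \<Rightarrow> complex"
  assumes "open S" "connected S" "F holomorphic_on S" "G holomorphic_on S"
    and "\<And>z. z \<in> S \<Longrightarrow> F z * G z = 0"
  shows "(\<forall>z\<in>S. F z = 0) \<or> (\<forall>z\<in>S. G z = 0)"
proof (rule disjCI)
  assume "\<not> (\<forall>z\<in>S. G z = 0)"
  then obtain z0 where z0: "z0 \<in> S" "G z0 \<noteq> 0" by blast
  define U where "U = S \<inter> G -` (- {0})"
  have "open U" unfolding U_def
    by (rule continuous_open_preimage[OF holomorphic_on_imp_continuous_on[OF assms(4)] assms(1)]) auto
  moreover have "U \<noteq> {}" "U \<subseteq> S" using z0 by (auto simp: U_def)
  moreover have "F z = 0" if "z \<in> U" for z using assms(5)[of z] that by (auto simp: U_def)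
  ultimately show "\<forall>z\<in>S. F z = 0"
    using analytic_continuation_open[of U S F "\<lambda>_. 0"] assms by (auto intro: holomorphic_on_const)
qed

definition specialize :: "'a::comm_ring_1 poly poly \<Rightarrow> 'a \<Rightarrow> 'a poly" where
  "specialize G x = map_poly (\<lambda>c. poly c x) G"

lemma coeff_specialize [simp]: "coeff (specialize G x) i = poly (coeff G i) x"
  by (simp add: specialize_def coeff_map_poly)

lemma poly_specialize [simp]: "poly (specialize G x) y = eval2 G x y"
  by (simp add: specialize_def eval2_altdef)

lemma pderiv_specialize:
  fixes G :: "'a::idom poly poly"
  shows "pderiv (specialize G x) = specialize (pderiv G) x"
  by (rule poly_eqI) (simp add: coeff_pderiv)

lemma degree_specialize:
  assumes "poly (lead_coeff G) x \<noteq> 0"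
  shows "degree (specialize G x) = degree G"
  using assms by (intro antisym le_degree degree_le) (auto simp: coeff_eq_0)

lemma holomorphic_eval2 [holomorphic_intros]:
  "F holomorphic_on S \<Longrightarrow> H holomorphic_on S \<Longrightarrow> (\<lambda>z. eval2 G (F z) (H z)) holomorphic_on S"
  unfolding eval2_eq_sum by (intro holomorphic_intros)

text \<open>By the identity theorem the composition would vanish on the whole half-plane, confining
  \<Psi> to the finite root set of \<open>D\<close>.\<close>

lemma poly_compose_unbounded_vanishes:
  fixes D :: "complex poly" and \<Psi> :: "complex \<Rightarrow> complex"
  assumes hol: "\<Psi> holomorphic_on {z. Re z > R}"
    and unb: "\<And>M. \<exists>z. Re z > R \<and> cmod (\<Psi> z) > M"
    and U: "open U" "U \<noteq> {}" "U \<subseteq> {z. Re z > R}" "\<And>z. z \<in> U \<Longrightarrow> poly D (\<Psi> z) = 0"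
  shows "D = 0"
proof (rule ccontr)
  assume "D \<noteq> 0"
  have zero: "poly D (\<Psi> z) = 0" if "Re z > R" for z
    using analytic_continuation_open[of U "{z. Re z > R}" "\<lambda>z. poly D (\<Psi> z)" "\<lambda>_. 0" z] U that
      convex_connected[OF convex_halfspace_Re_gt] open_halfspace_Re_gt
    by (auto intro!: holomorphic_intros hol)
  have "bounded {x. poly D x = 0}" using poly_roots_finite[OF \<open>D \<noteq> 0\<close>] by (rule finite_imp_bounded)
  then obtain M where M: "\<And>x. poly D x = 0 \<Longrightarrow> cmod x \<le> M" unfolding bounded_iff by blast
  obtain z where z: "Re z > R" "cmod (\<Psi> z) > M" using unb by blast
  show False using M[OF zero[OF z(1)]] z(2) by simp
qed

lemma extend_across_imaginary_axis:
  fixes \<Psi> :: "complex \<Rightarrow> complex" and G :: "complex poly poly"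
  assumes hol_\<Psi>: "\<Psi> holomorphic_on {z. Re z > R}"
    and unb: "\<And>M. \<exists>z. Re z > R \<and> cmod (\<Psi> z) > M"
    and R0: "R \<ge> 0" and rR: "r > R" and G0: "G \<noteq> 0"
    and A: "infinite A" "bounded A" "\<And>z. z \<in> A \<Longrightarrow> Re z = r"
    and rel: "\<And>z. z \<in> A \<Longrightarrow> eval2 G (\<Psi> z) (cnj (\<Psi> z)) = 0"
  obtains t e b \<Psi>' where "e > 0" "b > R" "\<Psi>' holomorphic_on rect (-1) b t e"
    "\<And>z. z \<in> rect R b t e \<Longrightarrow> \<Psi>' z = \<Psi> z"
proof -
  define refl where "refl z = 2 * of_real r - cnj z" for z :: complex
  have refl: "Re (refl z) = 2 * r - Re z" "Im (refl z) = Im z" "refl (refl z) = z" for z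
    by (auto simp: refl_def)
  have hol_refl: "(\<lambda>z. cnj (F (refl z))) holomorphic_on T"
    if "open S" "F holomorphic_on S" "\<And>z. z \<in> T \<Longrightarrow> refl z \<in> S" for F S T
  proof -
    have "open (cnj ` S)" unfolding image_cnj_conv_vimage_cnj by (intro open_vimage that(1) continuous_intros)
    moreover have "cnj ` cnj ` S = S" by (auto simp: image_image)
    ultimately have "cnj \<circ> F \<circ> cnj holomorphic_on cnj ` S"
      using holomorphic_on_compose_cnj_cnj[of F "cnj ` S"] that(2) by simp
    moreover have "(\<lambda>z. 2 * of_real r - z) holomorphic_on T" by (intro holomorphic_intros)
    moreover have "(\<lambda>z. 2 * of_real r - z) ` T \<subseteq> cnj ` S"
    proof clarify
      fix z assume "z \<in> T"
      then have "refl z \<in> S" by (rule that)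
      then have "cnj (refl z) \<in> cnj ` S" by blast
      then show "2 * of_real r - z \<in> cnj ` S" by (simp add: refl_def)
    qed
    ultimately have "(cnj \<circ> F \<circ> cnj) \<circ> (\<lambda>z. 2 * of_real r - z) holomorphic_on T"
      by (metis holomorphic_on_compose_gen)
    then show ?thesis by (simp add: o_def refl_def)
  qed
  define \<Psi>s where "\<Psi>s z = cnj (\<Psi> (refl z))" for z
  define W where "W = {z. Re z > R} \<inter> {z. Re z < 2 * r - R}"
  have W: "open W" "connected W" unfolding W_def
    by (auto intro!: open_Int open_halfspace_Re_gt open_halfspace_Re_lt convex_connected convex_Int
        convex_halfspace_Re_gt convex_halfspace_Re_lt)
  have hol1: "\<Psi> holomorphic_on W" using hol_\<Psi> by (rule holomorphic_on_subset) (auto simp: W_def)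
  have hol2: "\<Psi>s holomorphic_on W" unfolding \<Psi>s_def
    by (rule hol_refl[OF open_halfspace_Re_gt hol_\<Psi>]) (auto simp: W_def refl)
  \<comment> \<open>The ideal of relations between \<Psi> and its reflection on the symmetric strip
    \<open>W\<close>. It is prime, and it contains no nonzero polynomial in \<Psi> alone because
    \<Psi> is unbounded.\<close>
  define N where "N = {F. \<forall>z\<in>W. eval2 F (\<Psi> z) (\<Psi>s z) = 0}"
  have zW: "of_real r \<in> W" using rR by (simp add: W_def)
  have not_vanish: "c = 0" if "\<forall>z\<in>W. poly c (\<Psi> z) = 0" for c
  proof (rule poly_compose_unbounded_vanishes[OF hol_\<Psi> unb W(1)])
    show "W \<noteq> {}" using zW by blast
    show "W \<subseteq> {z. Re z > R}" by (auto simp: W_def)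
  qed (use that in blast)
  \<comment> \<open>On \<open>A\<close> the reflection is the identity, so \<open>G\<close> gives a
    relation between \<Psi> and \<Psi>s there; an accumulation point inside \<open>W\<close> spreads
    it over the strip.\<close>
  obtain x where x: "x islimpt A" using bounded_infinite_imp_islimpt[OF subset_refl A(2,1)] .
  have "x \<in> {z. Re z = r}"
  proof -
    have "x islimpt {z. Re z = r}" by (rule islimpt_subset[OF x]) (use A(3) in blast)
    moreover have "closed {z. Re z = r}" by (rule closed_halfspace_Re_eq)
    ultimately show ?thesis using closed_limpt by blast
  qed
  then have xW: "x \<in> W" using rR by (simp add: W_def)
  have GN: "G \<in> N" unfolding N_def mem_Collect_eq
  proof
    fix z assume z: "z \<in> W"
    show "eval2 G (\<Psi> z) (\<Psi>s z) = 0"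
    proof (rule analytic_continuation[OF _ W _ xW x _ z])
      show "(\<lambda>z. eval2 G (\<Psi> z) (\<Psi>s z)) holomorphic_on W" by (intro holomorphic_intros hol1 hol2)
      show "A \<subseteq> W" using A(3) rR by (auto simp: W_def)
      fix z assume z: "z \<in> A"
      have "refl z = z" using A(3)[OF z] by (intro complex_eqI) (simp_all add: refl)
      then show "eval2 G (\<Psi> z) (\<Psi>s z) = 0" using rel[OF z] by (simp add: \<Psi>s_def)
    qed
  qed
  obtain H A' B' D where H: "H \<in> N" "degree H > 0" "D \<noteq> 0" "A' * H + B' * pderiv H = [:D:]"
  proof (rule vanishing_with_discriminant[OF _ _ _ _ GN G0])
    show "F1 \<in> N \<or> F2 \<in> N" if "F1 * F2 \<in> N" for F1 F2
      using product_vanishes_imp[OF W, of "\<lambda>z. eval2 F1 (\<Psi> z) (\<Psi>s z)" "\<lambda>z. eval2 F2 (\<Psi> z) (\<Psi>s z)"] that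
      by (auto simp: N_def intro!: holomorphic_intros hol1 hol2)
    show "[:c:] \<notin> N" if "c \<noteq> 0" for c
      using not_vanish[of c] that by (auto simp: N_def simp del: pCons_eq_0_iff)
  qed (auto simp: N_def)
  \<comment> \<open>Excludes both kinds of singular fibres: multiple roots, where \<open>D\<close>
    vanishes, and a drop of the degree, where the leading coefficient does.\<close>
  define D2 where "D2 = D * lead_coeff H"
  have D2: "D2 \<noteq> 0" using H by (auto simp: D2_def)
  \<comment> \<open>The right edge is the mirror image of \<open>Re z = -1\<close>. Only finitely
    many singular points lie in this compact box, so some height \<open>t\<close> between 0 and 1
    avoids all of them.\<close>
  define K where "K = cbox (Complex r 0) (Complex (2 * r + 1) 1)"
  have finK: "finite {z\<in>K. poly D2 (\<Psi> z) = 0}"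
  proof (cases "(\<lambda>z. poly D2 (\<Psi> z)) constant_on {z. Re z > R}")
    case True
    then obtain c where c: "\<And>z. Re z > R \<Longrightarrow> poly D2 (\<Psi> z) = c" by (auto simp: constant_on_def)
    have "c \<noteq> 0"
    proof
      assume "c = 0"
      then have "D2 = 0" using c by (intro not_vanish) (auto simp: W_def)
      with D2 show False by simp
    qed
    have "poly D2 (\<Psi> z) \<noteq> 0" if "z \<in> K" for z
      using c[of z] that rR \<open>c \<noteq> 0\<close> by (simp add: K_def in_cbox_complex_iff)
    then have "{z\<in>K. poly D2 (\<Psi> z) = 0} = {}" by blast
    then show ?thesis by (simp only: finite.emptyI)
  next
    case False
    show ?thesis
    proof (rule holomorphic_compact_finite_zeros[OF _ _ _ _ _ False])
      show "(\<lambda>z. poly D2 (\<Psi> z)) holomorphic_on {z. Re z > R}" by (intro holomorphic_intros hol_\<Psi>)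
      show "open {z. Re z > R}" by (rule open_halfspace_Re_gt)
      show "connected {z. Re z > R}" by (rule convex_connected[OF convex_halfspace_Re_gt])
      show "compact K" by (simp add: K_def)
      show "K \<subseteq> {z. Re z > R}" using rR by (auto simp: K_def in_cbox_complex_iff)
    qed
  qed
  then have finI: "finite (Im ` {z\<in>K. poly D2 (\<Psi> z) = 0})" by blast
  then have "infinite ({0..1} - Im ` {z\<in>K. poly D2 (\<Psi> z) = 0})"
    by (intro Diff_infinite_finite finI) simp
  then have "{0..1} - Im ` {z\<in>K. poly D2 (\<Psi> z) = 0} \<noteq> {}" by (rule infinite_imp_nonempty)
  then obtain t where "t \<in> {0..1} - Im ` {z\<in>K. poly D2 (\<Psi> z) = 0}" by blast
  then have t: "0 \<le> t" "t \<le> 1" "t \<notin> Im ` {z\<in>K. poly D2 (\<Psi> z) = 0}" by simp_all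
  define S where "S = {z. Re z > R} \<inter> (\<lambda>z. poly D2 (\<Psi> z)) -` (- {0})"
  have openS: "open S" unfolding S_def
    by (rule continuous_open_preimage[OF holomorphic_on_imp_continuous_on open_halfspace_Re_gt])
       (auto intro!: holomorphic_intros hol_\<Psi>)
  have seg: "Complex x t \<in> S" if "r \<le> x" "x \<le> 2 * r + 1" for x
  proof -
    have K: "Complex x t \<in> K" using that t by (simp add: K_def in_cbox_complex_iff)
    have "poly D2 (\<Psi> (Complex x t)) \<noteq> 0"
    proof
      assume "poly D2 (\<Psi> (Complex x t)) = 0"
      then have "Complex x t \<in> {z\<in>K. poly D2 (\<Psi> z) = 0}" using K by blast
      then have "Im (Complex x t) \<in> Im ` {z\<in>K. poly D2 (\<Psi> z) = 0}" by (rule imageI)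
      with t(3) show False by simp
    qed
    then show ?thesis using that rR by (simp add: S_def)
  qed
  interpret simple_root_family S "\<lambda>z. specialize H (\<Psi> z)" "degree H"
  proof
    show "open S" by (rule openS)
    show "(\<lambda>z. coeff (specialize H (\<Psi> z)) i) holomorphic_on S" for i
      unfolding coeff_specialize
      by (intro holomorphic_intros holomorphic_on_subset[OF hol_\<Psi>]) (auto simp: S_def)
    show "degree (specialize H (\<Psi> z)) = degree H" if "z \<in> S" for z
      using that by (intro degree_specialize) (auto simp: S_def D2_def)
    show "degree H > 0" by fact
    show "poly (pderiv (specialize H (\<Psi> z))) y \<noteq> 0" if "z \<in> S" "poly (specialize H (\<Psi> z)) y = 0" for z y
    proof
      assume "poly (pderiv (specialize H (\<Psi> z))) y = 0"
      then have "eval2 (A' * H + B' * pderiv H) (\<Psi> z) y = 0"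
        using that by (simp add: pderiv_specialize)
      then show False using that by (simp only: H(4)) (simp add: S_def D2_def)
    qed
  qed
  have "Complex r t \<in> S \<inter> W" using seg[of r] R0 rR by (auto simp: W_def)
  then obtain \<rho> where \<rho>: "\<rho> > 0" "ball (Complex r t) \<rho> \<subseteq> S \<inter> W"
    using open_Int[OF openS W(1)] open_contains_ball by metis
  define a b where "a = r - \<rho> / 2" and "b = r + \<rho> / 2"
  have rect_ball: "rect a b t (\<rho> / 2) \<subseteq> ball (Complex r t) \<rho>"
  proof
    fix z assume "z \<in> rect a b t (\<rho> / 2)"
    then have "\<bar>Re (z - Complex r t)\<bar> < \<rho> / 2" "\<bar>Im (z - Complex r t)\<bar> < \<rho> / 2"
      unfolding rect_def a_def b_def mem_Collect_eq minus_complex.simps complex.sel by linarith+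
    then have "cmod (z - Complex r t) < \<rho>"
      using cmod_le[of "z - Complex r t"] by simp
    then show "z \<in> ball (Complex r t) \<rho>" by (simp add: dist_norm norm_minus_commute)
  qed
  have ab: "a < b" "a < r" "r < b" using \<rho> by (auto simp: a_def b_def)
  have "Complex (r + \<rho> / 2) t \<in> ball (Complex r t) \<rho>" "Complex (r - \<rho> / 2) t \<in> ball (Complex r t) \<rho>"
    using \<rho>(1) by (simp_all add: dist_norm cmod_def)
  then have bW: "b < 2 * r - R" "R < a" using \<rho>(2) by (auto simp: W_def a_def b_def)
  have sub: "rect a b t (\<rho> / 2) \<subseteq> S" "rect a b t (\<rho> / 2) \<subseteq> W" using rect_ball \<rho>(2) by auto
  obtain e Y where e: "e > 0" "e \<le> \<rho> / 2" and Y: "Y holomorphic_on rect a (2 * r + 1) t e"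
    "\<And>z. z \<in> rect a b t e \<Longrightarrow> Y z = \<Psi>s z"
  proof (rule continue_root_along_segment[OF ab(1) _ _ sub(1)])
    show "\<rho> / 2 > 0" using \<rho> by simp
    show "\<Psi>s holomorphic_on rect a b t (\<rho> / 2)" using hol2 sub(2) holomorphic_on_subset by blast
    show "poly (specialize H (\<Psi> z)) (\<Psi>s z) = 0" if "z \<in> rect a b t (\<rho> / 2)" for z
      using H(1) sub(2) that by (auto simp: N_def)
    show "Complex x t \<in> S" if "b \<le> x" "x \<le> 2 * r + 1" for x
      using seg[of x] that ab by simp
  qed (use R0 rR bW in auto)
  \<comment> \<open>\<open>Y\<close> continues \<Psi>s to the right up to \<open>2 * r + 1\<close>;
    its reflection continues \<Psi> to the left down to \<open>-1\<close>. Agreement with \<Psi> is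
    first known only near the mirror line.\<close>
  define \<Psi>' where "\<Psi>' z = cnj (Y (refl z))" for z
  have hol': "\<Psi>' holomorphic_on rect (-1) (2 * r - a) t e" unfolding \<Psi>'_def
    by (rule hol_refl[OF open_rect Y(1)]) (auto simp: rect_def refl)
  show ?thesis
  proof (rule that[OF e(1) _ hol'])
    show "R < 2 * r - a" using ab rR by simp
    fix z assume z: "z \<in> rect R (2 * r - a) t e"
    show "\<Psi>' z = \<Psi> z"
    proof (rule analytic_continuation_open[OF open_rect open_rect _ connected_rect _ _ _ _ z])
        show "rect (2 * r - b) (2 * r - a) t e \<subseteq> rect R (2 * r - a) t e" using bW by (auto simp: rect_def)
        have "Complex (2 * r - (a + b) / 2) t \<in> rect (2 * r - b) (2 * r - a) t e"
          using ab e by (simp add: rect_def)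
        then show "rect (2 * r - b) (2 * r - a) t e \<noteq> {}" by blast
        show "\<Psi>' holomorphic_on rect R (2 * r - a) t e"
          by (rule holomorphic_on_subset[OF hol']) (use R0 in \<open>auto simp: rect_def\<close>)
        show "\<Psi> holomorphic_on rect R (2 * r - a) t e"
          by (rule holomorphic_on_subset[OF hol_\<Psi>]) (auto simp: rect_def)
        show "\<Psi>' z = \<Psi> z" if "z \<in> rect (2 * r - b) (2 * r - a) t e" for z
          using Y(2)[of "refl z"] that by (auto simp: \<Psi>'_def \<Psi>s_def refl rect_def)
    qed
  qed
qed

section \<open>Magnification by iterates and descent to the punctured plane\<close>

lemma holomorphic_on_funpow_poly:
  "F holomorphic_on S \<Longrightarrow> (\<lambda>z. (poly f ^^ n) (F z)) holomorphic_on S"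
  by (induction n) (auto intro!: holomorphic_intros)

text \<open>The quantity \<open>C * max 1 (cmod z)\<close> is at most raised to the power
  \<open>degree f\<close> by each application of \<open>f\<close>, because
  \<open>C ^ 2 \<le> C ^ degree f\<close> for \<open>C \<ge> 1\<close> and degree at least
  2.\<close>

lemma poly_iterate_bound:
  fixes f :: "complex poly"
  assumes d: "degree f \<ge> 2"
  obtains B where "B \<ge> 1" "\<And>n z. cmod z \<le> M \<Longrightarrow> cmod ((poly f ^^ n) z) \<le> B ^ (degree f ^ n)"
proof -
  let ?d = "degree f"
  define C where "C = 1 + (\<Sum>i\<le>?d. cmod (coeff f i))"
  define M1 where "M1 = max 1 M"
  have C: "C \<ge> 1" by (simp add: C_def sum_nonneg)
  have M1: "M1 \<ge> 1" by (simp add: M1_def)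
  have step: "max 1 (cmod (poly f z)) \<le> C * max 1 (cmod z) ^ ?d" for z
  proof -
    have "cmod (poly f z) \<le> (\<Sum>i\<le>?d. cmod (coeff f i) * cmod z ^ i)"
      unfolding poly_altdef by (rule order.trans[OF norm_sum]) (simp add: norm_mult norm_power)
    also have "\<dots> \<le> (\<Sum>i\<le>?d. cmod (coeff f i) * max 1 (cmod z) ^ ?d)"
    proof (intro sum_mono mult_left_mono)
      fix i assume "i \<in> {..?d}"
      have "cmod z ^ i \<le> max 1 (cmod z) ^ i" by (intro power_mono) auto
      also have "\<dots> \<le> max 1 (cmod z) ^ ?d" using \<open>i \<in> _\<close> by (intro power_increasing) auto
      finally show "cmod z ^ i \<le> max 1 (cmod z) ^ ?d" .
    qed auto
    also have "\<dots> \<le> C * max 1 (cmod z) ^ ?d"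
      unfolding C_def sum_distrib_right[symmetric] by (intro mult_right_mono) auto
    finally have "cmod (poly f z) \<le> C * max 1 (cmod z) ^ ?d" .
    moreover have "1 * 1 \<le> C * max 1 (cmod z) ^ ?d" using C by (intro mult_mono one_le_power) auto
    ultimately show ?thesis by simp
  qed
  have bound: "C * max 1 (cmod ((poly f ^^ n) z)) \<le> (C * M1) ^ (?d ^ n)" if z: "cmod z \<le> M" for n z
  proof (induction n)
    case 0 then show ?case using C z by (auto simp: M1_def intro!: mult_left_mono)
  next
    case (Suc n)
    let ?m = "max 1 (cmod ((poly f ^^ n) z))"
    have "C * max 1 (cmod ((poly f ^^ Suc n) z)) \<le> C * (C * ?m ^ ?d)"
      using step[of "(poly f ^^ n) z"] C by (intro mult_left_mono) auto
    also have "\<dots> = C ^ 2 * ?m ^ ?d" by (simp add: power2_eq_square)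
    also have "\<dots> \<le> C ^ ?d * ?m ^ ?d" using C d by (intro mult_right_mono power_increasing) auto
    also have "\<dots> = (C * ?m) ^ ?d" by (simp add: power_mult_distrib)
    also have "\<dots> \<le> ((C * M1) ^ (?d ^ n)) ^ ?d" using Suc.IH C by (intro power_mono) auto
    also have "\<dots> = (C * M1) ^ (?d ^ Suc n)" by (simp add: power_mult[symmetric] mult.commute)
    finally show ?case .
  qed
  show ?thesis
  proof (rule that[of "C * M1"])
    show "C * M1 \<ge> 1" using mult_mono[OF C M1] C by simp
    fix n z assume z: "cmod z \<le> M"
    have "1 * cmod ((poly f ^^ n) z) \<le> C * max 1 (cmod ((poly f ^^ n) z))"
      using C by (intro mult_mono) auto
    then show "cmod ((poly f ^^ n) z) \<le> (C * M1) ^ (?d ^ n)" using bound[OF z, of n] by linarith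
  qed
qed

text \<open>Rotating \<open>w\<close> by \<tau> before applying the principal logarithm yields a
  logarithm whose imaginary part is within \<open>pi\<close> of \<tau>, at whatever height the
  rectangle lies.\<close>

lemma exp_uminus_in_rect:
  assumes "w \<noteq> 0" "a < - ln (cmod w)" "- ln (cmod w) < b" "e > pi"
  obtains z where "z \<in> rect a b \<tau> e" "exp (- z) = w" "Re z = - ln (cmod w)" "\<bar>Im z - \<tau>\<bar> \<le> pi"
proof -
  define v where "v = w * exp (\<i> * of_real \<tau>)"
  have v: "v \<noteq> 0" using assms(1) by (simp add: v_def)
  define z where "z = \<i> * of_real \<tau> - Ln v"
  have "cmod v = cmod w" by (simp add: v_def norm_mult)
  then have re: "Re z = - ln (cmod w)" using v by (simp add: z_def)
  have im: "\<bar>Im z - \<tau>\<bar> \<le> pi" using mpi_less_Im_Ln[OF v] Im_Ln_le_pi[OF v] by (simp add: z_def abs_le_iff)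
  have "exp (- z) = exp (Ln v) / exp (\<i> * of_real \<tau>)" by (simp add: z_def exp_diff)
  also have "\<dots> = w" using v by (simp add: v_def)
  finally have "exp (- z) = w" .
  then show ?thesis using that[of z] re im assms by (auto simp: rect_def)
qed

text \<open>Periodicity is assumed only for real parts above \<open>c\<close>. The points that stay
  in the rectangle under a given shift form a convex set, so the identity theorem extends it to the
  left edge. The half height exceeds \<open>pi\<close>, so every \<open>w\<close> in the annulus has
  a logarithm in the rectangle.\<close>

lemma periodic_factors_through_exp:
  fixes F :: "complex \<Rightarrow> complex"
  assumes hol: "F holomorphic_on rect a b \<tau> e" and c: "a \<le> c" "c < b" and e: "e > pi"
    and per: "\<And>z k. z \<in> rect c b \<tau> e \<Longrightarrow> z + of_int k * (2 * of_real pi * \<i>) \<in> rect c b \<tau> e \<Longrightarrow>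
       F (z + of_int k * (2 * of_real pi * \<i>)) = F z"
  obtains K where "K holomorphic_on {w. exp (- b) < cmod w \<and> cmod w < exp (- a)}"
    "\<And>z. z \<in> rect a b \<tau> e \<Longrightarrow> K (exp (- z)) = F z"
proof -
  define P where "P k = of_int k * (2 * of_real pi * \<i>)" for k :: int
  have P: "Re (P k) = 0" "Im (P k) = 2 * pi * of_int k" for k by (simp_all add: P_def)
  have shift: "F (z + P k) = F z" if z: "z \<in> rect a b \<tau> e" "z + P k \<in> rect a b \<tau> e" for z k
  proof -
    define T where "T x = rect x b \<tau> e \<inter> rect x b (\<tau> - Im (P k)) e" for x
    have T: "T x = {z \<in> rect x b \<tau> e. z + P k \<in> rect x b \<tau> e}" for x
      by (auto simp: T_def rect_def P algebra_simps)
    have "open (T x)" "connected (T x)" for x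
      unfolding T_def by (auto intro!: convex_connected convex_Int convex_rect)
    moreover have "T c \<subseteq> T a" using c by (auto simp: T rect_def)
    moreover have "Complex ((c + b) / 2) (Im z) \<in> T c"
      using z c by (auto simp: T rect_def P)
    moreover have "(\<lambda>z. F (z + P k)) holomorphic_on T a"
      by (rule holomorphic_on_compose_gen[OF _ hol, unfolded o_def])
         (auto intro!: holomorphic_intros simp: T)
    moreover have "F holomorphic_on T a" by (rule holomorphic_on_subset[OF hol]) (auto simp: T)
    moreover have "F (z + P k) = F z" if "z \<in> T c" for z
      using per[of z k] that by (auto simp: T P_def)
    moreover have "z \<in> T a" using z by (simp add: T)
    ultimately show ?thesis
      by (intro analytic_continuation_open[of "T c" "T a" "\<lambda>z. F (z + P k)" F z]) auto
  qed
  have well: "F z = F z'" if "z \<in> rect a b \<tau> e" "z' \<in> rect a b \<tau> e" "exp (- z) = exp (- z')" for z z'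
  proof -
    have "exp z = exp z'" using that(3) by (simp add: exp_minus)
    then obtain n :: int where "z = z' + (of_int (2 * n) * pi) * \<i>" unfolding exp_eq by blast
    then have "z = z' + P n" by (simp add: P_def algebra_simps)
    then show ?thesis using shift[of z' n] that by simp
  qed
  define K where "K w = F (SOME z. z \<in> rect a b \<tau> e \<and> exp (- z) = w)" for w
  have K: "K (exp (- z)) = F z" if "z \<in> rect a b \<tau> e" for z
  proof -
    have "\<exists>z'. z' \<in> rect a b \<tau> e \<and> exp (- z') = exp (- z)" using that by blast
    from someI_ex[OF this] show ?thesis unfolding K_def using well that by blast
  qed
  have "K holomorphic_on {w. exp (- b) < cmod w \<and> cmod w < exp (- a)}"
  proof (subst holomorphic_on_open)
    show "open {w::complex. exp (- b) < cmod w \<and> cmod w < exp (- a)}"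
      by (intro open_Collect_conj open_Collect_less continuous_intros)
    show "\<forall>w\<in>{w. exp (- b) < cmod w \<and> cmod w < exp (- a)}. \<exists>f'. (K has_field_derivative f') (at w)"
    proof
      fix w0 assume w0: "w0 \<in> {w. exp (- b) < cmod w \<and> cmod w < exp (- a)}"
      then have w0nz: "w0 \<noteq> 0" by (auto intro: less_trans[OF exp_gt_zero])
      have "a < - ln (cmod w0)" "- ln (cmod w0) < b"
        using w0 w0nz ln_less_cancel_iff[of "cmod w0" "exp (- a)"] ln_less_cancel_iff[of "exp (- b)" "cmod w0"] by auto
      then obtain z0 where z0: "z0 \<in> rect a b \<tau> e" "exp (- z0) = w0"
        using exp_uminus_in_rect[OF w0nz _ _ e] by metis
      \<comment> \<open>The branch of \<open>- log w\<close> through \<open>z0\<close>; near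
        \<open>w0\<close> it stays in the rectangle, so \<open>K\<close> is locally \<open>F\<close>
        composed with it.\<close>
      define l where "l w = z0 - Ln (w / w0)" for w
      have l0: "l w0 = z0" using w0nz by (simp add: l_def)
      have "1 \<notin> \<real>\<^sub>\<le>\<^sub>0" by simp
      then have dl: "(l has_field_derivative - (1 / w0)) (at w0)"
        unfolding l_def using w0nz by (auto intro!: derivative_eq_intros simp: field_simps)
      then have "isCont l w0" by (rule DERIV_isCont)
      then have "eventually (\<lambda>w. l w \<in> rect a b \<tau> e) (nhds w0)"
        unfolding eventually_nhds_conv_at isCont_def
        using topological_tendstoD[of l "l w0" "at w0" "rect a b \<tau> e"] z0(1) l0 by simp
      moreover have "eventually (\<lambda>w. w \<in> - {0}) (nhds w0)"
        using w0nz by (intro eventually_nhds_in_open) auto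
      ultimately have "eventually (\<lambda>w. K w = F (l w)) (nhds w0)"
      proof eventually_elim
        case (elim w)
        have "exp (- l w) = exp (Ln (w / w0)) * exp (- z0)" by (simp add: l_def exp_add[symmetric])
        also have "\<dots> = w" using elim w0nz unfolding z0(2) by simp
        finally have "exp (- l w) = w" .
        then show ?case using K[OF elim(1)] by simp
      qed
      moreover obtain F' where "(F has_field_derivative F') (at (l w0))"
        using hol z0 l0 by (auto simp: holomorphic_on_open)
      then have "((\<lambda>w. F (l w)) has_field_derivative F' * (- (1 / w0))) (at w0)"
        using dl by (rule DERIV_chain2)
      ultimately have "(K has_field_derivative F' * (- (1 / w0))) (at w0)"
        using DERIV_cong_ev[of w0 w0 K "\<lambda>w. F (l w)"] by blast
      then show "\<exists>f'. (K has_field_derivative f') (at w0)" by blast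
    qed
  qed
  then show ?thesis using that K by blast
qed

lemma extension_imp_polynomial:
  fixes f :: "complex poly" and q \<Psi>' :: "complex \<Rightarrow> complex"
  assumes d2: "degree f \<ge> 2" and \<eta>: "0 < \<eta>" "\<eta> < 1" and hol_q: "q holomorphic_on ball 0 \<eta>"
    and eqn: "\<And>w. w \<noteq> 0 \<Longrightarrow> cmod w < \<eta> \<Longrightarrow> poly f (q w / w) = q (w ^ degree f) / w ^ degree f"
    and e: "e > 0" and b: "b > - ln \<eta>" and hol': "\<Psi>' holomorphic_on rect (-1) b t e"
    and ext: "\<And>z. z \<in> rect (- ln \<eta>) b t e \<Longrightarrow> \<Psi>' z = q (exp (- z)) / exp (- z)"
  obtains Q :: "complex poly" where "\<And>w. w \<in> ball 0 \<eta> \<Longrightarrow> q w = poly Q w"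
proof -
  define d where "d = degree f"
  define R where "R = - ln \<eta>"
  have R: "R > 0" "exp (- R) = \<eta>" using \<eta> by (auto simp: R_def)
  define \<Psi> where "\<Psi> z = q (exp (- z)) / exp (- z)" for z
  have small: "cmod (exp (- z)) < \<eta>" if "Re z > R" for z
    using that R by (metis exp_less_mono neg_less_iff_less norm_exp_eq_Re uminus_complex.simps(1))
  have hol\<Psi>: "\<Psi> holomorphic_on {z. Re z > R}" unfolding \<Psi>_def
    by (intro holomorphic_intros holomorphic_on_compose_gen[OF _ hol_q, unfolded o_def]) (use small in auto)
  have iter: "(poly f ^^ n) (\<Psi> z) = \<Psi> (of_nat (d ^ n) * z)" if z: "Re z > R" for n z
  proof (induction n)
    case (Suc n)
    let ?z = "of_nat (d ^ n) * z"
    have "1 * Re z \<le> real (d ^ n) * Re z" using d2 z R by (intro mult_right_mono) (auto simp: d_def)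
    then have "Re ?z > R" using z by simp
    then have "poly f (\<Psi> ?z) = q (exp (- ?z) ^ d) / exp (- ?z) ^ d"
      unfolding \<Psi>_def d_def by (intro eqn small) auto
    also have "exp (- ?z) ^ d = exp (- (of_nat (d ^ Suc n) * z))"
      by (simp add: exp_of_nat_mult[symmetric] algebra_simps)
    finally show ?case using Suc by (simp add: \<Psi>_def)
  qed auto
  \<comment> \<open>A compact segment halfway beyond the axis on which the continuation is bounded.
    Its multiple by \<open>d ^ n\<close> covers, through \<open>exp (- z)\<close>, the circle of
    radius \<open>exp (d ^ n / 2)\<close> once \<open>n\<close> is large.\<close>
  define L where "L = (\<lambda>y. Complex (- 1/2) y) ` {t - e/2..t + e/2}"
  have "compact L" unfolding L_def Complex_eq
    by (intro compact_continuous_image continuous_intros compact_Icc)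
  moreover have "b > 0" using b R(1) unfolding R_def by linarith
  then have L_rect: "L \<subseteq> rect (-1) b t e" using e by (auto simp: L_def rect_def)
  ultimately have "bounded (\<Psi>' ` L)"
    using hol' by (meson compact_continuous_image compact_imp_bounded continuous_on_subset holomorphic_on_imp_continuous_on)
  then obtain M where M: "\<And>z. z \<in> L \<Longrightarrow> cmod (\<Psi>' z) \<le> M" by (auto simp: bounded_iff)
  obtain B where B: "B \<ge> 1" "\<And>n z. cmod z \<le> M \<Longrightarrow> cmod ((poly f ^^ n) z) \<le> B ^ (d ^ n)"
    using poly_iterate_bound[OF d2, of M] unfolding d_def by blast
  \<comment> \<open>Cauchy's estimate on the circle of radius \<open>exp (d ^ n / 2)\<close>, where
    the extended \<open>q\<close> is at most this radius times \<open>B ^ (d ^ n)\<close>. The bound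
    \<open>2 * pi\<close>, twice what the descent to \<open>w\<close> needs, keeps the scaled
    logarithm in the middle half of the rectangle and thus on \<open>L\<close>.\<close>
  have est: "cmod ((deriv ^^ j) q 0) \<le> fact j * (exp (1/2) * B / exp (1/2) ^ j) ^ (d ^ n)"
    if n: "e * real (d ^ n) \<ge> 2 * pi" for n j
  proof -
    define D where "D = real (d ^ n)"
    have "d ^ n \<ge> 1" using d2 by (simp add: d_def)
    then have D: "D \<ge> 1" "D > 0" unfolding D_def by linarith+
    have eD: "e * D > pi" using n pi_gt_zero unfolding D_def[symmetric] by linarith
    define F where "F z = (poly f ^^ n) (\<Psi>' (z / of_real D))" for z
    have scale: "z / of_real D \<in> rect x y t e \<longleftrightarrow> z \<in> rect (x * D) (y * D) (t * D) (e * D)" for z x y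
    proof -
      have "Im z / D - t = (Im z - t * D) / D" using D by (simp add: field_simps)
      then have "\<bar>Im z / D - t\<bar> < e \<longleftrightarrow> \<bar>Im z - t * D\<bar> < e * D" using D by (simp add: field_simps)
      then show ?thesis using D by (auto simp: rect_def field_simps)
    qed
    have holF: "F holomorphic_on rect (- D) (b * D) (t * D) (e * D)" unfolding F_def
      using scale[of _ "-1" b] D
      by (intro holomorphic_on_funpow_poly holomorphic_on_compose_gen[OF _ hol', unfolded o_def] holomorphic_intros) auto
    have F1: "F z = \<Psi> z" if "z \<in> rect (R * D) (b * D) (t * D) (e * D)" for z
    proof -
      have z: "z / of_real D \<in> rect R b t e" using that scale by simp
      then have "\<Psi>' (z / of_real D) = \<Psi> (z / of_real D)" using ext by (simp add: R_def \<Psi>_def)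
      moreover have "Re (z / of_real D) > R" using z by (simp add: rect_def)
      moreover have "of_nat (d ^ n) * (z / of_real D) = z" using D by (simp add: D_def)
      ultimately show ?thesis using iter[of "z / of_real D" n] by (simp add: F_def)
    qed
    have RD: "R \<le> R * D" "R * D < b * D"
      using mult_left_mono[OF D(1), of R] mult_strict_right_mono[OF _ D(2), of R b] R(1) b
      by (simp_all add: R_def)
    have F2: "F z = \<Psi> z" if z: "z \<in> rect R (b * D) (t * D) (e * D)" for z
    proof (rule analytic_continuation_open[OF open_rect open_rect _ connected_rect _ _ _ _ z])
      show "rect (R * D) (b * D) (t * D) (e * D) \<subseteq> rect R (b * D) (t * D) (e * D)"
        using RD by (auto simp: rect_def)
      obtain x where "R * D < x" "x < b * D" using dense[OF RD(2)] by blast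
      moreover have "0 < e * D" using eD pi_gt_zero by linarith
      ultimately have "Complex x (t * D) \<in> rect (R * D) (b * D) (t * D) (e * D)"
        unfolding rect_def by simp
      then show "rect (R * D) (b * D) (t * D) (e * D) \<noteq> {}" by blast
      show "F holomorphic_on rect R (b * D) (t * D) (e * D)"
        by (rule holomorphic_on_subset[OF holF]) (use R D in \<open>auto simp: rect_def\<close>)
      show "\<Psi> holomorphic_on rect R (b * D) (t * D) (e * D)"
        by (rule holomorphic_on_subset[OF hol\<Psi>]) (auto simp: rect_def)
    qed (rule F1)
    have per: "\<Psi> (z + of_int k * (2 * of_real pi * \<i>)) = \<Psi> z" for z k
    proof -
      have "exp (- (z + of_int k * (2 * of_real pi * \<i>))) = exp (- z)"
        unfolding exp_eq by (rule exI[of _ "- k"]) (simp add: algebra_simps)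
      then show ?thesis by (simp add: \<Psi>_def)
    qed
    define An where "An = {w. exp (- (b * D)) < cmod w \<and> cmod w < exp D}"
    obtain K where K: "K holomorphic_on An" "\<And>z. z \<in> rect (- D) (b * D) (t * D) (e * D) \<Longrightarrow> K (exp (- z)) = F z"
    proof (rule periodic_factors_through_exp[OF holF _ _ eD, of "R * D"])
      show "- D \<le> R * D" using D R by (simp add: order.trans[of _ 0])
      show "R * D < b * D" by (rule RD)
    qed (use F1 per in \<open>auto simp: An_def\<close>)
    have lnAn: "w \<noteq> 0" "- D < - ln (cmod w)" "- ln (cmod w) < b * D" if "w \<in> An" for w
    proof -
      show nz: "w \<noteq> 0" using that by (auto simp: An_def intro: less_trans[OF exp_gt_zero])
      show "- D < - ln (cmod w)" "- ln (cmod w) < b * D"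
        using that nz ln_less_cancel_iff[of "cmod w" "exp D"] ln_less_cancel_iff[of "exp (- (b * D))" "cmod w"]
        by (auto simp: An_def)
    qed
    \<comment> \<open>The disc and the annulus overlap because
      \<open>exp (- (b * D)) < \<eta>\<close>, so the glued function is holomorphic on the full disc
      of radius \<open>exp D\<close>; the factor \<open>w\<close> cancels the pole of the inverse
      Boettcher coordinate.\<close>
    define q' where "q' w = (if w \<in> ball 0 \<eta> then q w else w * K w)" for w
    have "q' holomorphic_on ball 0 \<eta> \<union> An" unfolding q'_def
    proof (rule holomorphic_on_If_Un[OF hol_q])
      show "(\<lambda>w. w * K w) holomorphic_on An" by (intro holomorphic_intros K)
      show "open An" unfolding An_def by (intro open_Collect_conj open_Collect_less continuous_intros)
      fix w assume w: "w \<in> ball 0 \<eta>" "w \<in> An"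
      obtain z where z: "z \<in> rect (- D) (b * D) (t * D) (e * D)" "exp (- z) = w" "Re z = - ln (cmod w)"
        using exp_uminus_in_rect[OF lnAn[OF w(2)] eD] by metis
      have "Re z > R" using w(1) lnAn(1)[OF w(2)] \<eta> by (simp add: z R_def)
      then have "z \<in> rect R (b * D) (t * D) (e * D)" using z(1) by (auto simp: rect_def)
      then have "K w = q w / w" using K(2)[OF z(1)] F2 z(2) by (simp add: \<Psi>_def)
      then show "q w = w * K w" using lnAn(1)[OF w(2)] by simp
    qed auto
    moreover have "ball 0 (exp D) \<subseteq> ball 0 \<eta> \<union> An"
    proof
      fix w :: complex assume w: "w \<in> ball 0 (exp D)"
      have "exp (- (b * D)) < \<eta>" using RD R by (metis exp_less_mono neg_less_iff_less order.strict_trans1)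
      then show "w \<in> ball 0 \<eta> \<union> An" using w by (auto simp: An_def)
    qed
    ultimately have holq': "q' holomorphic_on ball 0 (exp D)" by (rule holomorphic_on_subset)
    define \<rho> where "\<rho> = exp (D / 2)"
    have \<rho>: "\<rho> > 0" "\<rho> < exp D" "1 \<le> \<rho>" using D by (auto simp: \<rho>_def)
    have "cmod ((deriv ^^ j) q' 0) \<le> fact j * (\<rho> * B ^ (d ^ n)) / \<rho> ^ j"
    proof (rule Cauchy_inequality)
      show "q' holomorphic_on ball 0 \<rho>" using holq' by (rule holomorphic_on_subset) (use \<rho> in auto)
      have "cball 0 \<rho> \<subseteq> ball (0::complex) (exp D)" using \<rho> by auto
      then show "continuous_on (cball 0 \<rho>) q'"
        using holq' by (meson continuous_on_subset holomorphic_on_imp_continuous_on)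
      fix w :: complex assume "cmod (0 - w) = \<rho>"
      then have w: "cmod w = \<rho>" by simp
      have "exp (- (b * D)) < 1" using RD R D by (simp add: mult_pos_pos less_trans)
      then have "exp (- (b * D)) < cmod w" "cmod w < exp D" using w \<rho>(2,3) by linarith+
      then have "w \<in> An" unfolding An_def by blast
      then obtain z where z: "z \<in> rect (- D) (b * D) (t * D) (e * D)" "exp (- z) = w"
          "Re z = - ln (cmod w)" "\<bar>Im z - t * D\<bar> \<le> pi"
        using exp_uminus_in_rect[OF lnAn eD] by metis
      have "Re z = - D / 2" using z(3) w by (simp add: \<rho>_def)
      moreover have "\<bar>Im z / D - t\<bar> \<le> e / 2"
      proof -
        have "Im z / D - t = (Im z - t * D) / D" using D by (simp add: field_simps)
        then have "\<bar>Im z / D - t\<bar> \<le> pi / D" using D z(4) by (simp add: divide_right_mono)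
        also have "\<dots> \<le> e / 2"
        proof (subst pos_divide_le_eq[OF D(2)])
          have "2 * pi \<le> e * D" using n by (simp only: D_def)
          moreover have "e / 2 * D = (e * D) / 2" by simp
          ultimately show "pi \<le> e / 2 * D" by linarith
        qed
        finally show ?thesis .
      qed
      then have "t - e / 2 \<le> Im z / D" "Im z / D \<le> t + e / 2" unfolding abs_le_iff by linarith+
      ultimately have "z / of_real D \<in> L"
        using D unfolding L_def by (intro image_eqI[of _ _ "Im z / D"]) (simp_all add: complex_eq_iff)
      then have "cmod (F z) \<le> B ^ (d ^ n)" unfolding F_def by (intro B M)
      then have "cmod (w * K w) \<le> \<rho> * B ^ (d ^ n)"
        using K(2)[OF z(1)] z(2) w \<rho> by (simp add: norm_mult mult_left_mono)
      moreover have "w \<notin> ball 0 \<eta>" using w \<rho> \<eta> by simp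
      ultimately show "cmod (q' w) \<le> \<rho> * B ^ (d ^ n)" by (simp add: q'_def)
    qed (use \<rho> in auto)
    moreover have "(deriv ^^ j) q' 0 = (deriv ^^ j) q 0"
    proof (rule higher_deriv_cong_ev)
      have "eventually (\<lambda>w. w \<in> ball 0 \<eta>) (nhds (0::complex))"
        using \<eta> by (intro eventually_nhds_in_open) auto
      then show "eventually (\<lambda>w. q' w = q w) (nhds 0)" by eventually_elim (simp add: q'_def)
    qed simp
    moreover have "fact j * (\<rho> * B ^ (d ^ n)) / \<rho> ^ j = fact j * (exp (1/2) * B / exp (1/2) ^ j) ^ (d ^ n)"
    proof -
      have "\<rho> = exp (1/2) ^ (d ^ n)" by (simp add: \<rho>_def D_def exp_of_nat_mult[symmetric])
      then show ?thesis
        by (simp add: power_divide power_mult_distrib power_mult[symmetric] mult.commute)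
    qed
    ultimately show ?thesis by simp
  qed
  \<comment> \<open>From order \<open>J\<close> on the base in \<open>est\<close> is less than 1.
    The derivative at 0 does not depend on \<open>n\<close>, so letting \<open>n\<close> grow forces
    it to vanish.\<close>
  obtain J where J: "exp (1/2) * B < exp (1/2 :: real) ^ J"
    using real_arch_pow[of "exp (1/2)"] by auto
  have zero: "(deriv ^^ j) q 0 = 0" if "j \<ge> J" for j
  proof -
    define \<rho> where "\<rho> = exp (1/2) * B / exp (1/2) ^ j"
    have "exp (1/2 :: real) ^ J \<le> exp (1/2) ^ j" using that by (intro power_increasing) auto
    with J have "exp (1/2) * B < exp (1/2 :: real) ^ j" by (rule less_le_trans)
    then have "\<rho> < 1" unfolding \<rho>_def by (subst divide_less_eq_1_pos) simp_all
    moreover have "0 \<le> \<rho>" using B(1) by (simp add: \<rho>_def)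
    ultimately have \<rho>: "0 \<le> \<rho>" "\<rho> < 1" by simp_all
    obtain n0 where n0: "2 * pi / e < real n0" using reals_Archimedean2 by blast
    have "cmod ((deriv ^^ j) q 0) \<le> fact j * \<rho> ^ n" if "n \<ge> n0" for n
    proof -
      have "n < 2 ^ n" by (rule less_exp)
      also have "2 ^ n \<le> d ^ n" using d2 by (intro power_mono) (auto simp: d_def)
      finally have nd: "n < d ^ n" .
      have "2 * pi \<le> e * real n0" using n0 e by (simp add: field_simps)
      also have "\<dots> \<le> e * real (d ^ n)" using nd that e by (intro mult_left_mono) linarith+
      finally have "cmod ((deriv ^^ j) q 0) \<le> fact j * \<rho> ^ (d ^ n)" using est unfolding \<rho>_def by blast
      also have "\<dots> \<le> fact j * \<rho> ^ n"
        using \<rho> nd by (intro mult_left_mono power_decreasing) auto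
      finally show ?thesis .
    qed
    moreover have "(\<lambda>n. fact j * \<rho> ^ n) \<longlonglongrightarrow> 0"
      using \<rho> by (intro tendsto_mult_right_zero LIMSEQ_power_zero) auto
    ultimately have "cmod ((deriv ^^ j) q 0) \<le> 0"
      by (intro LIMSEQ_le_const[of "\<lambda>n. fact j * \<rho> ^ n"]) auto
    then show ?thesis by simp
  qed
  define Q where "Q = (\<Sum>j<J. monom ((deriv ^^ j) q 0 / fact j) j)"
  show ?thesis
  proof (rule that[of Q])
    fix w :: complex assume "w \<in> ball 0 \<eta>"
    then have "(\<lambda>j. (deriv ^^ j) q 0 / fact j * (w - 0) ^ j) sums q w"
      by (rule holomorphic_power_series[OF hol_q])
    moreover have "(\<lambda>j. (deriv ^^ j) q 0 / fact j * (w - 0) ^ j) sums (\<Sum>j<J. (deriv ^^ j) q 0 / fact j * (w - 0) ^ j)"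
      by (rule sums_finite) (use zero in auto)
    ultimately have "q w = (\<Sum>j<J. (deriv ^^ j) q 0 / fact j * (w - 0) ^ j)" by (rule sums_unique2)
    then show "q w = poly Q w" by (simp add: Q_def poly_sum poly_monom)
  qed
qed

section \<open>Laurent polynomials semiconjugate to a power map\<close>

lemma poly_eq_infinite:
  fixes p q :: "'a::idom poly"
  assumes "infinite A" "\<And>x. x \<in> A \<Longrightarrow> poly p x = poly q x"
  shows "p = q"
proof (rule ccontr)
  assume "p \<noteq> q"
  then have "finite {x. poly (p - q) x = 0}" by (intro poly_roots_finite) simp
  moreover have "A \<subseteq> {x. poly (p - q) x = 0}" using assms(2) by auto
  ultimately show False using assms(1) finite_subset by blast
qed

lemma joukowski_surj:
  fixes y :: complex
  obtains v where "v \<noteq> 0" "v + 1 / v = y"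
proof -
  define v where "v = (y + csqrt (y\<^sup>2 - 4)) / 2"
  have "2 * v - y = csqrt (y\<^sup>2 - 4)" by (simp add: v_def field_simps)
  then have "(2 * v - y)\<^sup>2 = y\<^sup>2 - 4" by (simp only: power2_csqrt)
  moreover have "4 * (v * (y - v)) = y\<^sup>2 - (2 * v - y)\<^sup>2"
    by (simp add: power2_eq_square algebra_simps)
  ultimately have eq: "v * (y - v) = 1" by simp
  then have "v \<noteq> 0" by auto
  moreover have "v + 1 / v = y" using eq \<open>v \<noteq> 0\<close> by (simp add: field_simps)
  ultimately show ?thesis using that by blast
qed

text \<open>The identity behind \<open>cos (n * t)\<close> as a polynomial in \<open>cos t\<close>,
  with \<open>v\<close> in place of \<open>exp (\<i> * t)\<close>.\<close>

lemma chebyshev_joukowski: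
  assumes "v \<noteq> 0"
  shows "poly (chebyshev_T n) ((v + 1 / v) / 2) = (v ^ n + 1 / v ^ n) / 2"
proof (induction n rule: chebyshev_T.induct)
  case (3 n)
  have p: "poly [:0, 2:] ((v + 1 / v) / 2) = v + 1 / v" by simp
  have "poly (chebyshev_T (Suc (Suc n))) ((v + 1 / v) / 2)
      = (v + 1 / v) * ((v ^ Suc n + 1 / v ^ Suc n) / 2) - (v ^ n + 1 / v ^ n) / 2"
    by (simp only: chebyshev_T.simps poly_diff poly_mult 3 p)
  also have "\<dots> = (v ^ Suc (Suc n) + 1 / v ^ Suc (Suc n)) / 2"
    using assms by (simp add: field_simps)
  finally show ?case .
qed auto

lemma holomorphic_on_ball_imp_isCont:
  assumes "F holomorphic_on ball z e" "e > 0"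
  shows "isCont F z"
  using assms by (intro field_differentiable_imp_continuous_at
      holomorphic_on_imp_differentiable_at[OF _ open_ball, of F z e]) auto

text \<open>A nonconstant image would be open, but a point of the unit circle multiplied by
  \<open>1 + e / 2\<close> leaves the circle.\<close>

lemma constant_modulus_imp_constant:
  assumes "\<mu> holomorphic_on S" "open S" "connected S" "S \<noteq> {}" "\<And>z. z \<in> S \<Longrightarrow> cmod (\<mu> z) = 1"
  shows "\<mu> constant_on S"
proof (rule ccontr)
  assume "\<not> \<mu> constant_on S"
  then have "open (\<mu> ` S)" using assms by (intro open_mapping_thm[of \<mu> S S]) auto
  moreover obtain z where z: "z \<in> S" using assms(4) by blast
  ultimately obtain e where e: "e > 0" "ball (\<mu> z) e \<subseteq> \<mu> ` S" using open_contains_ball by blast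
  have "cmod (\<mu> z - of_real (1 + e / 2) * \<mu> z) = e / 2"
  proof -
    have eq: "\<mu> z - of_real (1 + e / 2) * \<mu> z = of_real (- (e / 2)) * \<mu> z" by (simp add: algebra_simps)
    show ?thesis unfolding eq norm_mult norm_of_real assms(5)[OF z] using e(1) by simp
  qed
  then have "of_real (1 + e / 2) * \<mu> z \<in> \<mu> ` S" using e by (intro subsetD[OF e(2)]) (simp add: dist_norm)
  then have "cmod (of_real (1 + e / 2) * \<mu> z) = 1" using assms(5) by auto
  then show False unfolding norm_mult norm_of_real assms(5)[OF z] using e(1) by simp
qed

text \<open>Iterating the relation, \<open>cmod (\<mu> v) ^ (d ^ n)\<close> equals the modulus of
  \<mu> at \<open>v ^ (d ^ n)\<close> and converges to \<open>cmod (\<mu> 0) \<noteq> 0\<close>. A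
  modulus below 1 would give limit 0, one above 1 would diverge.\<close>

lemma power_relation_imp_modulus_1:
  fixes \<mu> :: "complex \<Rightarrow> complex"
  assumes d: "d \<ge> 2" and \<epsilon>: "\<epsilon> \<le> 1" and cont: "isCont \<mu> 0" and nz: "\<mu> 0 \<noteq> 0"
    and rel: "\<And>v. v \<noteq> 0 \<Longrightarrow> cmod v < \<epsilon> \<Longrightarrow> \<mu> (v ^ d) = \<mu> v ^ d"
    and v: "v \<noteq> 0" "cmod v < \<epsilon>"
  shows "cmod (\<mu> v) = 1"
proof -
  have it: "\<mu> (v ^ (d ^ n)) = \<mu> v ^ (d ^ n)" for n
  proof (induction n)
    case (Suc n)
    have "cmod (v ^ (d ^ n)) \<le> cmod v"
      using power_decreasing[of 1 "d ^ n" "cmod v"] d v \<epsilon> by (simp add: norm_power)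
    then have "\<mu> ((v ^ (d ^ n)) ^ d) = \<mu> (v ^ (d ^ n)) ^ d" using v by (intro rel) auto
    then show ?case using Suc by (simp add: power_mult[symmetric] mult.commute)
  qed auto
  have dn: "filterlim (\<lambda>n. d ^ n) sequentially sequentially"
  proof (rule filterlim_at_top_mono[OF filterlim_ident])
    show "\<forall>\<^sub>F n in sequentially. n \<le> d ^ n"
    proof (intro always_eventually allI)
      fix n
      have "n \<le> 2 ^ n" using less_exp[of n] by simp
      also have "\<dots> \<le> d ^ n" using d by (intro power_mono) auto
      finally show "n \<le> d ^ n" .
    qed
  qed
  have "(\<lambda>n. v ^ n) \<longlonglongrightarrow> 0" using v \<epsilon> by (intro LIMSEQ_power_zero) auto
  from filterlim_compose[OF this dn] have "(\<lambda>n. v ^ (d ^ n)) \<longlonglongrightarrow> 0" .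
  then have "(\<lambda>n. cmod (\<mu> (v ^ (d ^ n)))) \<longlonglongrightarrow> cmod (\<mu> 0)"
    by (intro tendsto_norm isCont_tendsto_compose[OF cont])
  then have lim: "(\<lambda>n. cmod (\<mu> v) ^ (d ^ n)) \<longlonglongrightarrow> cmod (\<mu> 0)" by (simp add: it norm_power)
  show ?thesis
  proof (rule linorder_cases[of "cmod (\<mu> v)" 1])
    assume "cmod (\<mu> v) < 1"
    then have "(\<lambda>n. cmod (\<mu> v) ^ n) \<longlonglongrightarrow> 0" by (intro LIMSEQ_power_zero) auto
    from filterlim_compose[OF this dn] lim show ?thesis using nz LIMSEQ_unique by fastforce
  next
    assume "cmod (\<mu> v) > 1"
    then have "(\<lambda>n. (1 / cmod (\<mu> v)) ^ n) \<longlonglongrightarrow> 0"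
      by (intro LIMSEQ_power_zero) (simp add: norm_divide divide_less_eq)
    from tendsto_mult[OF lim filterlim_compose[OF this dn]]
    have "(\<lambda>n. cmod (\<mu> v) ^ (d ^ n) * (1 / cmod (\<mu> v)) ^ (d ^ n)) \<longlonglongrightarrow> 0" by simp
    moreover have "cmod (\<mu> v) ^ k * (1 / cmod (\<mu> v)) ^ k = 1" for k
    proof -
      have "cmod (\<mu> v) * (1 / cmod (\<mu> v)) = 1" using \<open>cmod (\<mu> v) > 1\<close> by auto
      then show ?thesis by (simp only: power_mult_distrib[symmetric] power_one)
    qed
    ultimately have "(\<lambda>n::nat. 1::real) \<longlonglongrightarrow> 0" by simp
    then show ?thesis by (simp add: LIMSEQ_const_iff)
  qed simp
qed

text \<open>Write \<open>k w = Q w / w\<close> and \<open>m = degree Q - 1\<close>. The function \<open>v \<mapsto> \<phi> (1 / k (1 / v))\<close> commutes with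
  the \<open>d\<close>-th power and has a zero of order \<open>m\<close>, hence equals \<open>c * v ^ m\<close>. So \<open>k (1 / v) = k (c * v ^ m)\<close>,
  and comparing degrees gives \<open>m = 1\<close>.\<close>

lemma laurent_semiconjugacy_degree:
  fixes f Q :: "complex poly"
  assumes d2: "degree f \<ge> 2" and Q0: "poly Q 0 \<noteq> 0" and dQ: "degree Q \<ge> 2"
    and eqn: "\<And>w. w \<noteq> 0 \<Longrightarrow> poly f (poly Q w / w) = poly Q (w ^ degree f) / w ^ degree f"
    and \<delta>: "\<delta> > 0" and \<phi>: "\<phi> holomorphic_on ball 0 \<delta>" "\<phi> 0 = 0" "inj_on \<phi> (ball 0 \<delta>)" "deriv \<phi> 0 \<noteq> 0"
    and \<phi>_conj: "\<And>t. t \<in> ball 0 \<delta> \<Longrightarrow> \<phi> (inf_conj f t) = \<phi> t ^ degree f"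
    and \<eta>: "\<eta> > 0" and inv: "\<And>w. w \<in> ball 0 \<eta> \<Longrightarrow> w \<noteq> 0 \<Longrightarrow> w / poly Q w \<in> ball 0 \<delta> \<and> \<phi> (w / poly Q w) = w"
  shows "degree Q = 2"
proof -
  define m where "m = degree Q - 1"
  define d where "d = degree f"
  define R where "R = reflect_poly Q"
  have m: "m \<ge> 1" "degree Q = Suc m" using dQ by (auto simp: m_def)
  have R0: "poly R 0 \<noteq> 0" using dQ by (auto simp: R_def poly_0_coeff_0)
  have QR: "poly Q (1 / v) = poly R v / v ^ Suc m" if "v \<noteq> 0" for v
    using poly_reflect_poly_nz[of v Q] that m by (simp add: R_def field_simps)
  \<comment> \<open>This is \<open>1 / k (1 / v)\<close>, the map \<open>k\<close> read in the
    coordinates at infinity on both sides; \<open>m\<close> is the order of the pole of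
    \<open>k\<close> there.\<close>
  define s where "s v = v ^ m / poly R v" for v
  have s0: "s 0 = 0" using m by (simp add: s_def)
  have "isCont s 0" "isCont (poly R) 0" unfolding s_def by (intro continuous_intros R0)+
  note cont = this
  obtain e1 where e1: "e1 > 0" "\<And>v. cmod v < e1 \<Longrightarrow> cmod (s v) < \<delta>"
    using cont(1) \<delta> unfolding continuous_at_eps_delta dist_norm s0 diff_zero by blast
  obtain e2 where e2: "e2 > 0" "\<And>v. cmod v < e2 \<Longrightarrow> poly R v \<noteq> 0"
    using continuous_at_avoid[OF cont(2) R0] by auto
  define \<epsilon>0 where "\<epsilon>0 = min e1 e2"
  have \<epsilon>0: "\<epsilon>0 > 0" "\<And>v. cmod v < \<epsilon>0 \<Longrightarrow> s v \<in> ball 0 \<delta> \<and> poly R v \<noteq> 0"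
    using e1 e2 by (auto simp: \<epsilon>0_def)
  define \<epsilon> where "\<epsilon> = min 1 \<epsilon>0"
  have \<epsilon>: "\<epsilon> > 0" "\<epsilon> \<le> 1" "\<And>v. cmod v < \<epsilon> \<Longrightarrow> s v \<in> ball 0 \<delta>" "\<And>v. cmod v < \<epsilon> \<Longrightarrow> poly R v \<noteq> 0"
    using \<epsilon>0 by (auto simp: \<epsilon>_def)
  have pow_le: "cmod (v ^ d) < \<epsilon>" if "cmod v < \<epsilon>" for v
    using power_decreasing[of 1 d "cmod v"] that \<epsilon> d2 by (simp add: norm_power d_def)
  have s_conj: "inf_conj f (s v) = s (v ^ d)" if v: "v \<noteq> 0" "cmod v < \<epsilon>" for v
  proof -
    have sv: "s v \<noteq> 0" "s (v ^ d) \<noteq> 0" using v \<epsilon>(4) pow_le[OF v(2)] by (auto simp: s_def)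
    have k: "1 / s v = poly Q (1 / v) / (1 / v)" if "v \<noteq> 0" for v
      using that by (simp add: s_def QR)
    have "1 / inf_conj f (s v) = poly f (1 / s v)" using poly_inverse_inf_conj[OF sv(1)] by simp
    also have "\<dots> = poly Q (1 / v ^ d) / (1 / v ^ d)"
      using eqn[of "1 / v"] v by (simp add: k d_def power_one_over)
    also have "\<dots> = 1 / s (v ^ d)" using k[of "v ^ d"] v by simp
    finally show ?thesis by simp
  qed
  define \<phi>1 where "\<phi>1 t = (if t = 0 then deriv \<phi> 0 else \<phi> t / t)" for t
  have \<phi>1: "\<phi>1 holomorphic_on ball 0 \<delta>" unfolding \<phi>1_def
    by (rule pole_theorem_0[OF \<phi>(1)]) (use \<delta> \<phi>(2) in auto)
  have \<phi>\<phi>1: "\<phi> t = t * \<phi>1 t" for t using \<phi>(2) by (simp add: \<phi>1_def)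
  \<comment> \<open>The nonvanishing factor in \<open>\<phi> (s v) = v ^ m * \<mu> v\<close>.
    Compatibility with the \<open>d\<close>-th power passes to it, which forces modulus 1 and hence
    constancy.\<close>
  define \<mu> where "\<mu> v = \<phi>1 (s v) / poly R v" for v
  have \<mu>_hol: "\<mu> holomorphic_on ball 0 \<epsilon>" unfolding \<mu>_def s_def
    by (intro holomorphic_intros holomorphic_on_compose_gen[OF _ \<phi>1, unfolded o_def])
       (use \<epsilon> in \<open>auto simp: s_def\<close>)
  have lam: "\<phi> (s v) = v ^ m * \<mu> v" for v by (simp add: \<phi>\<phi>1[of "s v"] \<mu>_def) (simp add: s_def)
  have \<mu>0: "\<mu> 0 \<noteq> 0" using \<phi>(4) R0 s0 by (simp add: \<mu>_def \<phi>1_def)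
  have \<mu>_rel: "\<mu> (v ^ d) = \<mu> v ^ d" if v: "v \<noteq> 0" "cmod v < \<epsilon>" for v
  proof -
    have "(v ^ m * \<mu> v) ^ d = \<phi> (inf_conj f (s v))"
      using \<phi>_conj[OF \<epsilon>(3)[OF v(2)]] lam by (simp add: d_def)
    also have "\<dots> = (v ^ d) ^ m * \<mu> (v ^ d)" by (simp add: s_conj[OF v] lam)
    finally show ?thesis using v by (simp add: power_mult_distrib power_mult[symmetric] mult.commute)
  qed
  have "isCont \<mu> 0"
    by (rule holomorphic_on_ball_imp_isCont[OF \<mu>_hol \<epsilon>(1)])
  then have mod1: "cmod (\<mu> v) = 1" if "v \<noteq> 0" "cmod v < \<epsilon>" for v
    using power_relation_imp_modulus_1[of d \<epsilon> \<mu> v] d2 \<epsilon>(2) \<mu>0 \<mu>_rel that by (simp add: d_def)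
  have "\<mu> constant_on (ball 0 \<epsilon> - {0})"
  proof (rule constant_modulus_imp_constant)
    show "\<mu> holomorphic_on ball 0 \<epsilon> - {0}" using \<mu>_hol holomorphic_on_subset by blast
    show "connected (ball 0 \<epsilon> - {0::complex})" by (rule connected_punctured_ball) simp
    have "of_real (\<epsilon> / 2) \<in> ball 0 \<epsilon> - {0::complex}" using \<epsilon> by simp
    then show "ball 0 \<epsilon> - {0::complex} \<noteq> {}" by blast
  qed (use mod1 in auto)
  then obtain c where c: "\<And>v. v \<noteq> 0 \<Longrightarrow> cmod v < \<epsilon> \<Longrightarrow> \<mu> v = c" by (auto simp: constant_on_def)
  have c1: "cmod c = 1" using mod1[of "of_real (\<epsilon> / 2)"] c[of "of_real (\<epsilon> / 2)"] \<epsilon> by simp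
  define \<epsilon>' where "\<epsilon>' = min \<epsilon> \<eta>"
  have \<epsilon>': "\<epsilon>' > 0" "\<epsilon>' \<le> \<epsilon>" "\<epsilon>' \<le> \<eta>" using \<epsilon> \<eta> by (auto simp: \<epsilon>'_def)
  have key: "c * poly R v = poly Q (c * v ^ m)" if v: "v \<noteq> 0" "cmod v < \<epsilon>'" for v
  proof -
    define w where "w = c * v ^ m"
    have vm: "cmod (v ^ m) \<le> cmod v"
      using power_decreasing[of 1 m "cmod v"] v \<epsilon>' \<epsilon> m by (simp add: norm_power)
    then have w: "w \<in> ball 0 \<eta>" "w \<noteq> 0" using v \<epsilon>' c1 by (auto simp: w_def norm_mult)
    have "\<phi> (s v) = \<phi> (w / poly Q w)" using lam[of v] c[of v] v \<epsilon>' inv[OF w] by (simp add: w_def)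
    moreover have "s v \<in> ball 0 \<delta>" "w / poly Q w \<in> ball 0 \<delta>" using \<epsilon> v \<epsilon>' inv[OF w] by auto
    ultimately have eq: "s v = w / poly Q w" using \<phi>(3) by (auto dest: inj_onD)
    have "s v \<noteq> 0" using v \<epsilon>' \<epsilon>(4)[of v] by (auto simp: s_def)
    then have "poly Q w \<noteq> 0" using eq by auto
    then show ?thesis using eq v \<epsilon>' \<epsilon>(4)[of v] by (simp add: s_def w_def field_simps)
  qed
  \<comment> \<open>The left side has degree \<open>m + 1\<close> because
    \<open>poly Q 0 \<noteq> 0\<close>, the right side \<open>(m + 1) * m\<close>.\<close>
  have "smult c R = pcompose Q (monom c m)"
  proof (rule poly_eq_infinite)
    show "infinite (ball (0::complex) \<epsilon>' - {0})"
    proof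
      assume "finite (ball (0::complex) \<epsilon>' - {0})"
      then have "ball (0::complex) \<epsilon>' - {0} = {}" by (rule finite_imp_not_open) auto
      moreover have "of_real (\<epsilon>' / 2) \<in> ball (0::complex) \<epsilon>' - {0}" using \<epsilon>' by simp
      ultimately show False by blast
    qed
    show "poly (smult c R) v = poly (pcompose Q (monom c m)) v" if "v \<in> ball 0 \<epsilon>' - {0}" for v
      using key[of v] that by (simp add: poly_pcompose poly_monom)
  qed
  moreover have "degree (smult c R) = Suc m" using c1 Q0 m
    by (auto simp: R_def poly_0_coeff_0 degree_reflect_poly_eq)
  moreover have "degree (pcompose Q (monom c m)) = Suc m * m"
  proof -
    have "c \<noteq> 0" using c1 by auto
    then show ?thesis using m by (simp add: degree_pcompose degree_monom_eq)
  qed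
  ultimately have "Suc m * m = Suc m * 1" by simp
  then have "m = 1" by (subst (asm) mult_cancel1) auto
  then show ?thesis using m by simp
qed

section \<open>Reading off the conjugacy class from the Laurent polynomial\<close>

lemma affine_conjugateI:
  assumes "a \<noteq> 0" "infinite A" "\<And>x. x \<in> A \<Longrightarrow> b + a * poly f x = poly g (b + a * x)"
  shows "affine_conjugate f g"
  unfolding affine_conjugate_def
proof (intro exI[of _ "[:b, a:]"] conjI)
  show "pcompose [:b, a:] f = pcompose g [:b, a:]"
    by (rule poly_eq_infinite[OF assms(2)]) (use assms(3) in \<open>simp add: poly_pcompose mult.commute\<close>)
qed (use assms in auto)

text \<open>Here \<open>poly Q w / w = c1 + c0 / w\<close>, so
  \<open>x \<mapsto> (x - c1) / c0\<close> recovers \<open>1 / w\<close>, on which \<open>f\<close>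
  acts as a power. The value \<open>x = c1\<close> would correspond to \<open>w\<close> at infinity
  and is left out.\<close>

lemma degree_1_semiconjugacy_exceptional:
  fixes f Q :: "complex poly"
  assumes Q0: "poly Q 0 \<noteq> 0" and dQ: "degree Q \<le> 1"
    and eqn: "\<And>w. w \<noteq> 0 \<Longrightarrow> poly f (poly Q w / w) = poly Q (w ^ degree f) / w ^ degree f"
  shows "affine_conjugate f (monom 1 (degree f))"
proof -
  define c0 c1 where "c0 = coeff Q 0" and "c1 = coeff Q (Suc 0)"
  have Q: "Q = [:c0, c1:]"
    using dQ by (intro poly_eqI) (auto simp: c0_def c1_def coeff_pCons coeff_eq_0 split: nat.splits)
  have c0: "c0 \<noteq> 0" using Q0 by (simp add: Q)
  show ?thesis
  proof (rule affine_conjugateI[of "1 / c0" "- {c1}" "- (c1 / c0)"])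
    show "infinite (- {c1})" by (simp add: infinite_UNIV_char_0 Compl_eq_Diff_UNIV)
    fix x assume x: "x \<in> - {c1}"
    define w where "w = c0 / (x - c1)"
    have w: "w \<noteq> 0" "poly Q w / w = x" using x c0 by (auto simp: w_def Q field_simps)
    have fx: "poly f x = c1 + c0 / w ^ degree f"
      using eqn[OF w(1)] w by (simp add: Q field_simps)
    have w1: "1 / w = - (c1 / c0) + 1 / c0 * x" using x c0 by (simp add: w_def field_simps)
    have "- (c1 / c0) + 1 / c0 * poly f x = (1 / w) ^ degree f"
      using c0 by (simp add: fx distrib_left power_one_over)
    then show "- (c1 / c0) + 1 / c0 * poly f x = poly (monom 1 (degree f)) (- (c1 / c0) + 1 / c0 * x)"
      unfolding w1 poly_monom by simp
  qed (use c0 in auto)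
qed

lemma degree_2_semiconjugacy_exceptional:
  fixes f Q :: "complex poly"
  assumes d2: "degree f \<ge> 2" and Q0: "poly Q 0 \<noteq> 0" and dQ: "degree Q = 2"
    and eqn: "\<And>w. w \<noteq> 0 \<Longrightarrow> poly f (poly Q w / w) = poly Q (w ^ degree f) / w ^ degree f"
  shows "affine_conjugate f (chebyshev_T (degree f)) \<or> affine_conjugate f (- chebyshev_T (degree f))"
proof -
  define d where "d = degree f"
  define c0 c1 c2 where "c0 = coeff Q 0" and "c1 = coeff Q 1" and "c2 = coeff Q 2"
  have Q: "poly Q w = c0 + c1 * w + c2 * w\<^sup>2" for w
    using dQ by (simp add: poly_altdef c0_def c1_def c2_def numeral_2_eq_2)
  have c0: "c0 \<noteq> 0" using Q0 by (simp add: Q)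
  have c2: "c2 \<noteq> 0" using dQ by (metis c2_def leading_coeff_0_iff degree_0 zero_neq_numeral)
  \<comment> \<open>The substitution \<open>w = e * v\<close> gives \<open>v\<close> and
    \<open>1 / v\<close> the same coefficient \<open>s\<close>, so that \<open>k\<close> becomes an
    affine function of \<open>v + 1 / v\<close>.\<close>
  define e where "e = csqrt (c0 / c2)"
  have e2: "e\<^sup>2 = c0 / c2" by (simp add: e_def)
  then have e: "e \<noteq> 0" using c0 c2 by auto
  define s where "s = c2 * e"
  have s: "s \<noteq> 0" "c0 = s * e" using c2 e e2 by (auto simp: s_def power2_eq_square field_simps)
  define A B where "A = c2 * e ^ d" and "B = c0 / e ^ d"
  have f_eq: "poly f (c1 + s * (v + 1 / v)) = c1 + A * v ^ d + B / v ^ d" if v: "v \<noteq> 0" for v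
  proof -
    have "poly Q (e * v) / (e * v) = c1 + s * (v + 1 / v)"
      using e v s by (simp add: Q s_def field_simps power2_eq_square)
    moreover have "poly Q ((e * v) ^ d) / (e * v) ^ d = c1 + A * v ^ d + B / v ^ d"
      using e v by (simp add: Q A_def B_def field_simps power2_eq_square power_mult_distrib)
    ultimately show ?thesis using eqn[of "e * v"] e v by (simp add: d_def)
  qed
  \<comment> \<open>The left side of \<open>f_eq\<close> is unchanged under
    \<open>v \<mapsto> 1 / v\<close>; comparing \<open>v = 2\<close> with \<open>v = 1 / 2\<close>
    already forces equality. Since \<open>A * B = c0 * c2 = s * s\<close>, the only freedom left is
    the sign \<sigma>.\<close>
  have "A = B"
  proof -
    have "poly f (c1 + s * (2 + 1 / 2)) = c1 + A * 2 ^ d + B / 2 ^ d" by (rule f_eq) simp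
    moreover have "poly f (c1 + s * (1 / 2 + 1 / (1 / 2))) = c1 + A * (1 / 2) ^ d + B / (1 / 2) ^ d"
      by (rule f_eq) simp
    ultimately have "A * 2 ^ d + B / 2 ^ d = A / 2 ^ d + B * 2 ^ d" by (simp add: power_one_over)
    then have "(A - B) * (2 ^ d * 2 ^ d - 1) = 0" by (simp add: field_simps)
    moreover have "(2::complex) ^ d * 2 ^ d \<noteq> 1"
    proof
      assume "(2::complex) ^ d * 2 ^ d = 1"
      then have "(of_nat (2 ^ (d + d)) :: complex) = of_nat 1" by (simp add: power_add)
      then have "(2::nat) ^ (d + d) = 1" using of_nat_eq_iff by blast
      then show False using d2 by (simp add: d_def)
    qed
    ultimately show ?thesis by simp
  qed
  moreover have "A * B = s * s" using e s by (simp add: A_def B_def s_def)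
  ultimately have "A * A = s * s" by simp
  then have "A = s \<or> A = - s" by (rule square_eq_iff[THEN iffD1])
  then obtain \<sigma> where \<sigma>: "\<sigma> = 1 \<or> \<sigma> = - 1" "A = \<sigma> * s" by force
  have "affine_conjugate f (smult \<sigma> (chebyshev_T d))"
  proof (rule affine_conjugateI[of "1 / (2 * s)" UNIV "- (c1 / (2 * s))"])
    fix x
    obtain v where v: "v \<noteq> 0" "v + 1 / v = (x - c1) / s" using joukowski_surj .
    then have x: "x = c1 + s * (v + 1 / v)" using s by (simp add: field_simps)
    have "- (c1 / (2 * s)) + 1 / (2 * s) * x = (v + 1 / v) / 2" using s unfolding x by (simp add: field_simps)
    moreover have "poly f x = c1 + \<sigma> * s * (v ^ d + 1 / v ^ d)"
      unfolding x f_eq[OF v(1)] \<open>A = B\<close>[symmetric] \<sigma>(2) by (simp add: algebra_simps)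
    ultimately show "- (c1 / (2 * s)) + 1 / (2 * s) * poly f x
        = poly (smult \<sigma> (chebyshev_T d)) (- (c1 / (2 * s)) + 1 / (2 * s) * x)"
      using chebyshev_joukowski[OF v(1), of d] s by (simp add: add_divide_distrib)
  qed (use s in \<open>auto simp: infinite_UNIV_char_0\<close>)
  then show ?thesis using \<sigma>(1) by (auto simp: d_def)
qed

section \<open>Level curves of exceptional polynomials\<close>

text \<open>Pulled back along \<open>z \<mapsto> b + a * z\<close>, the conjugacy to the model map,
  so that circles for power maps and ellipses for Chebyshev polynomials are handled
  together.\<close>

definition affine_ellipse :: "complex \<Rightarrow> complex \<Rightarrow> real \<Rightarrow> real \<Rightarrow> complex set" where
  "affine_ellipse b a \<alpha> \<beta> = {z. (Re (b + a * z) / \<alpha>)\<^sup>2 + (Im (b + a * z) / \<beta>)\<^sup>2 = 1}"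

lemma affine_ellipse_image:
  assumes "a \<noteq> 0" "\<alpha> > 0" "\<beta> > 0"
  shows "affine_ellipse b a \<alpha> \<beta> = (\<lambda>u. (Complex (\<alpha> * Re u) (\<beta> * Im u) - b) / a) ` sphere 0 1"
proof
  show "(\<lambda>u. (Complex (\<alpha> * Re u) (\<beta> * Im u) - b) / a) ` sphere 0 1 \<subseteq> affine_ellipse b a \<alpha> \<beta>"
  proof clarify
    fix u :: complex assume "u \<in> sphere 0 1"
    then have "(Re u)\<^sup>2 + (Im u)\<^sup>2 = 1" by (simp add: cmod_def)
    moreover have "b + a * ((Complex (\<alpha> * Re u) (\<beta> * Im u) - b) / a) = Complex (\<alpha> * Re u) (\<beta> * Im u)"
      using assms(1) by simp
    ultimately show "(Complex (\<alpha> * Re u) (\<beta> * Im u) - b) / a \<in> affine_ellipse b a \<alpha> \<beta>"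
      unfolding affine_ellipse_def mem_Collect_eq using assms(2,3) by simp
  qed
  show "affine_ellipse b a \<alpha> \<beta> \<subseteq> (\<lambda>u. (Complex (\<alpha> * Re u) (\<beta> * Im u) - b) / a) ` sphere 0 1"
  proof
    fix z assume z: "z \<in> affine_ellipse b a \<alpha> \<beta>"
    define u where "u = Complex (Re (b + a * z) / \<alpha>) (Im (b + a * z) / \<beta>)"
    have "Complex (\<alpha> * Re u) (\<beta> * Im u) = b + a * z"
      using assms(2,3) by (simp add: u_def complex_eq_iff)
    then have "z = (Complex (\<alpha> * Re u) (\<beta> * Im u) - b) / a" using assms(1) by simp
    moreover have "u \<in> sphere 0 1" using z by (simp add: affine_ellipse_def u_def cmod_def)
    ultimately show "z \<in> (\<lambda>u. (Complex (\<alpha> * Re u) (\<beta> * Im u) - b) / a) ` sphere 0 1" by (rule image_eqI)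
  qed
qed

lemma connected_affine_ellipse:
  assumes "a \<noteq> 0" "\<alpha> > 0" "\<beta> > 0"
  shows "connected (affine_ellipse b a \<alpha> \<beta>)"
  unfolding affine_ellipse_image[OF assms] Complex_eq
  by (intro connected_continuous_image connected_sphere continuous_intros) (use assms in auto)

lemma semialgebraic_affine_ellipse: "semialgebraic (affine_ellipse b a \<alpha> \<beta>)"
proof -
  let ?X = "[:[:0, 1:]:] :: real poly poly" and ?Y = "[:0, 1:] :: real poly poly"
  let ?c = "\<lambda>r. [:[:r:]:] :: real poly poly"
  define P where "P = (?c (1 / \<alpha>) * (?c (Re b) + ?c (Re a) * ?X - ?c (Im a) * ?Y)) ^ 2
     + (?c (1 / \<beta>) * (?c (Im b) + ?c (Re a) * ?Y + ?c (Im a) * ?X)) ^ 2 - ?c 1"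
  have "eval2 P x y = ((Re b + Re a * x - Im a * y) / \<alpha>)\<^sup>2 + ((Im b + Re a * y + Im a * x) / \<beta>)\<^sup>2 - 1" for x y
    by (simp add: P_def del: pCons_eq_0_iff mult_pCons_left mult_pCons_right add_pCons diff_pCons one_poly_def)
  then have "eval_plane P z = (Re (b + a * z) / \<alpha>)\<^sup>2 + (Im (b + a * z) / \<beta>)\<^sup>2 - 1" for z
    by (simp add: eval_plane_def eval2_def[symmetric] add_diff_eq add.assoc)
  then have "affine_ellipse b a \<alpha> \<beta> = (\<Union>(E, G) \<in> {({P}, {})}. {z. (\<forall>P\<in>E. eval_plane P z = 0) \<and> (\<forall>Q\<in>G. eval_plane Q z > 0)})"
    by (auto simp: affine_ellipse_def)
  then show ?thesis unfolding semialgebraic_def by (intro exI[of _ "{({P}, {})}"]) auto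
qed

lemma Euclidean_space_1_homeomorphic_real: "euclideanreal homeomorphic_space Euclidean_space 1"
proof -
  have "continuous_map euclideanreal (Euclidean_space 1) (\<lambda>x i. if i < 1 then x else 0)"
    by (subst continuous_map_componentwise_Euclidean_space) auto
  moreover have "continuous_map (Euclidean_space 1) euclideanreal (\<lambda>f. f 0)"
    unfolding continuous_map_Euclidean_space_iff
    by (rule continuous_on_subset[OF continuous_on_product_coordinates]) simp
  ultimately have "homeomorphic_maps euclideanreal (Euclidean_space 1) (\<lambda>x i. if i < 1 then x else 0) (\<lambda>f. f 0)"
    unfolding homeomorphic_maps_def by (auto simp: topspace_Euclidean_space fun_eq_iff)
  then show ?thesis using homeomorphic_space by (meson homeomorphic_space_def)
qed

text \<open>The half with \<open>Re (b + a * z) > 0\<close> is a line, with the tangent of the angle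
  as coordinate. A cell of dimension at least 2 would contain a copy of the plane, whose image is
  open by invariance of domain; but moving radially from a point of an ellipse leaves it.\<close>

lemma has_dimension_affine_ellipse:
  assumes a: "a \<noteq> 0" and \<alpha>: "\<alpha> > 0" and \<beta>: "\<beta> > 0"
  shows "has_dimension (affine_ellipse b a \<alpha> \<beta>) 1"
  unfolding has_dimension_def
proof (intro conjI allI impI)
  define g where "g x = (Complex (\<alpha> * cos (arctan x)) (\<beta> * sin (arctan x)) - b) / a" for x
  define k where "k z = (Im (b + a * z) / \<beta>) / (Re (b + a * z) / \<alpha>)" for z
  have gb: "b + a * g x = Complex (\<alpha> * cos (arctan x)) (\<beta> * sin (arctan x))" for x
    using a by (simp add: g_def)
  have kg: "k (g x) = x" for x
  proof -
    have "k (g x) = tan (arctan x)" using \<alpha> \<beta> unfolding k_def gb by (simp add: tan_def)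
    then show ?thesis by (simp add: tan_arctan)
  qed
  have cg: "continuous_on UNIV g" unfolding g_def Complex_eq by (intro continuous_intros) (use a in auto)
  have ck: "continuous_on (range g) k" unfolding k_def
  proof (intro continuous_intros ballI)
    fix z assume "z \<in> range g"
    then obtain x where z: "z = g x" by blast
    have "Re (b + a * z) = \<alpha> * cos (arctan x)" unfolding z gb by simp
    then show "Re (b + a * z) / \<alpha> \<noteq> 0" using \<alpha> cos_arctan_not_zero[of x] by simp
  qed (use \<alpha> \<beta> in auto)
  have "homeomorphic_maps euclideanreal (top_of_set (range g)) g k"
    unfolding homeomorphic_maps_def using cg ck kg by (auto simp: continuous_map_in_subtopology)
  then have "top_of_set (range g) homeomorphic_space euclideanreal"
    using homeomorphic_space_sym homeomorphic_space_def by blast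
  then have "top_of_set (range g) homeomorphic_space Euclidean_space 1"
    using Euclidean_space_1_homeomorphic_real homeomorphic_space_trans by blast
  moreover have "range g \<subseteq> affine_ellipse b a \<alpha> \<beta>"
  proof clarify
    fix x show "g x \<in> affine_ellipse b a \<alpha> \<beta>"
      using \<alpha> \<beta> unfolding affine_ellipse_def mem_Collect_eq gb by simp
  qed
  ultimately show "contains_cell (affine_ellipse b a \<alpha> \<beta>) 1" unfolding contains_cell_def by blast
next
  fix m assume "contains_cell (affine_ellipse b a \<alpha> \<beta>) m"
  then obtain U where U: "U \<subseteq> affine_ellipse b a \<alpha> \<beta>" "Euclidean_space m homeomorphic_space top_of_set U"
    unfolding contains_cell_def using homeomorphic_space_sym by blast
  then obtain h where h: "homeomorphic_map (Euclidean_space m) (top_of_set U) h"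
    unfolding homeomorphic_space by blast
  show "m \<le> 1"
  proof (rule ccontr)
    assume m: "\<not> m \<le> 1"
    \<comment> \<open>The plane as the first two coordinates of the cell.\<close>
    define c where "c z = (\<lambda>i. if i < m then (if i = 0 then Re z else if i = 1 then Im z else 0) else 0)" for z :: complex
    have c: "continuous_map euclidean (Euclidean_space m) c"
      unfolding c_def
    proof (subst continuous_map_componentwise_Euclidean_space, intro allI impI)
      fix i
      show "continuous_map euclidean euclideanreal (\<lambda>z. if i = 0 then Re z else if i = 1 then Im z else 0)"
        by (cases "i = 0"; cases "i = 1") (auto intro!: continuous_intros)
    qed
    have "continuous_map euclidean (top_of_set U) (h \<circ> c)"
      using c h by (metis continuous_map_compose homeomorphic_imp_continuous_map)
    then have cont: "continuous_on UNIV (h \<circ> c)" and img: "range (h \<circ> c) \<subseteq> U"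
      by (auto simp: continuous_map_in_subtopology)
    have top: "c z \<in> topspace (Euclidean_space m)" for z
      using c by (auto simp: continuous_map_def)
    have inj_h: "inj_on h (topspace (Euclidean_space m))" using h by (rule homeomorphic_imp_injective_map)
    have "inj (h \<circ> c)"
    proof (rule injI)
      fix z z' assume "(h \<circ> c) z = (h \<circ> c) z'"
      then have "h (c z) = h (c z')" by simp
      then have eq: "c z = c z'" by (rule inj_onD[OF inj_h _ top top])
      show "z = z'" using fun_cong[OF eq, of 0] fun_cong[OF eq, of 1] m by (simp add: c_def complex_eq_iff)
    qed
    then have op: "open (range (h \<circ> c))" by (rule invariance_of_domain[OF cont open_UNIV])
    define z where "z = (h \<circ> c) 0"
    define p where "p \<epsilon> = ((1 + of_real \<epsilon>) * (b + a * z) - b) / a" for \<epsilon> :: real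
    have "isCont p 0" unfolding p_def using a by (intro continuous_intros)
    moreover have "p 0 = z" using a by (simp add: p_def)
    ultimately have "eventually (\<lambda>\<epsilon>. p \<epsilon> \<in> range (h \<circ> c)) (at 0)"
      using op by (intro topological_tendstoD[of p z]) (auto simp: isCont_def z_def)
    then obtain \<delta> where \<delta>: "\<delta> > 0" "\<And>\<epsilon>. \<epsilon> \<noteq> 0 \<Longrightarrow> \<bar>\<epsilon>\<bar> < \<delta> \<Longrightarrow> p \<epsilon> \<in> range (h \<circ> c)"
      by (auto simp: eventually_at dist_norm)
    have "p (\<delta> / 2) \<in> range (h \<circ> c)" by (rule \<delta>(2)) (use \<delta>(1) in simp_all)
    then have "p (\<delta> / 2) \<in> affine_ellipse b a \<alpha> \<beta>" using img U(1) by blast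
    moreover have "z \<in> affine_ellipse b a \<alpha> \<beta>" using img U(1) unfolding z_def by blast
    moreover have "b + a * p (\<delta> / 2) = of_real (1 + \<delta> / 2) * (b + a * z)" using a by (simp add: p_def)
    then have scale: "Re (b + a * p (\<delta> / 2)) = (1 + \<delta> / 2) * Re (b + a * z)"
       "Im (b + a * p (\<delta> / 2)) = (1 + \<delta> / 2) * Im (b + a * z)" by (simp_all del: of_real_add)
    have "(Re (b + a * p (\<delta> / 2)) / \<alpha>)\<^sup>2 + (Im (b + a * p (\<delta> / 2)) / \<beta>)\<^sup>2
        = (1 + \<delta> / 2)\<^sup>2 * ((Re (b + a * z) / \<alpha>)\<^sup>2 + (Im (b + a * z) / \<beta>)\<^sup>2)"
      unfolding scale times_divide_eq_right[symmetric] power_mult_distrib distrib_left ..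
    ultimately have "(1 + \<delta> / 2)\<^sup>2 = 1" unfolding affine_ellipse_def mem_Collect_eq by (simp only: mult_1_right)
    then show False using \<delta> by (simp add: power2_eq_1_iff)
  qed
qed

lemma semialgebraic_curve_affine_ellipse:
  assumes "a \<noteq> 0" "\<alpha> > 0" "\<beta> > 0"
  shows "semialgebraic_curve (affine_ellipse b a \<alpha> \<beta>)"
  unfolding semialgebraic_curve_def
  using semialgebraic_affine_ellipse has_dimension_affine_ellipse[OF assms] by blast

text \<open>\<open>y n\<close> is the orbit in the coordinate of the model map. Its logarithm is
  \<open>degree f ^ n\<close> up to a bounded error, and the affine change of coordinate adds
  another bounded error; both vanish after division.\<close>

lemma green_eq_1:
  assumes d: "degree f \<ge> 2" and a: "a \<noteq> 0"
    and y: "\<And>n. b + a * (poly f ^^ n) z = y n"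
    and bound: "\<And>n. \<bar>ln (cmod (y n)) - real (degree f) ^ n\<bar> \<le> K" "\<And>n. y n \<noteq> 0"
  shows "green f z = 1"
proof -
  define D where "D n = real (degree f) ^ n" for n
  have D: "filterlim D at_top sequentially"
  proof (rule filterlim_at_top_mono[OF filterlim_real_sequentially])
    show "\<forall>\<^sub>F n in sequentially. real n \<le> D n"
    proof (intro always_eventually allI)
      fix n
      have "n \<le> 2 ^ n" using less_exp[of n] by simp
      also have "\<dots> \<le> degree f ^ n" using d by (intro power_mono) auto
      finally show "real n \<le> D n" unfolding D_def of_nat_power[symmetric] by (rule of_nat_mono)
    qed
  qed
  have inv: "(\<lambda>n. 1 / D n) \<longlonglongrightarrow> 0"
    using tendsto_inverse_0_at_top[OF D] by (simp add: inverse_eq_divide)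
  have lny: "filterlim (\<lambda>n. ln (cmod (y n))) at_top sequentially"
  proof (rule filterlim_at_top_mono)
    show "filterlim (\<lambda>n. - K + D n) at_top sequentially"
      by (intro filterlim_tendsto_add_at_top[OF tendsto_const D])
    show "\<forall>\<^sub>F n in sequentially. - K + D n \<le> ln (cmod (y n))"
      using bound(1) by (intro always_eventually) (auto simp: D_def abs_le_iff algebra_simps)
  qed
  have "filterlim (\<lambda>n. exp (ln (cmod (y n)))) at_top sequentially"
    by (rule filterlim_compose[OF exp_at_top lny])
  then have ymod: "filterlim (\<lambda>n. cmod (y n)) at_top sequentially" using bound(2) by simp
  then have "filterlim y at_infinity sequentially" by (simp add: filterlim_at_infinity_conv_norm_at_top)
  then have "(\<lambda>n. b / y n) \<longlonglongrightarrow> 0" by (intro tendsto_divide_0[OF tendsto_const])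
  then have "(\<lambda>n. ln (cmod (1 - b / y n))) \<longlonglongrightarrow> ln (cmod (1 - 0))"
    by (intro tendsto_intros) auto
  then have corr: "(\<lambda>n. ln (cmod (1 - b / y n))) \<longlonglongrightarrow> 0" by simp
  have z: "(poly f ^^ n) z = (y n - b) / a" for n using y[of n] a by (simp add: field_simps)
  have lnyD: "(\<lambda>n. ln (cmod (y n)) / D n) \<longlonglongrightarrow> 1"
  proof -
    have "(\<lambda>n. ln (cmod (y n)) / D n - 1) \<longlonglongrightarrow> 0"
    proof (rule Lim_null_comparison)
      show "\<forall>\<^sub>F n in sequentially. norm (ln (cmod (y n)) / D n - 1) \<le> K * (1 / D n)"
      proof (intro always_eventually allI)
        fix n
        have "D n > 0" using d by (simp add: D_def)
        moreover have "ln (cmod (y n)) / D n - 1 = (ln (cmod (y n)) - D n) / D n"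
          using \<open>D n > 0\<close> by (simp add: field_simps)
        ultimately show "norm (ln (cmod (y n)) / D n - 1) \<le> K * (1 / D n)"
          using bound(1)[of n] by (simp add: D_def divide_right_mono)
      qed
      show "(\<lambda>n. K * (1 / D n)) \<longlonglongrightarrow> 0" using tendsto_mult_right_zero[OF inv] by simp
    qed
    then show ?thesis by (simp add: LIM_zero_cancel)
  qed
  have "(\<lambda>n. ln (cmod (y n)) / D n + (ln (cmod (1 - b / y n)) - ln (cmod a)) * (1 / D n)) \<longlonglongrightarrow> 1 + (0 - ln (cmod a)) * 0"
    by (intro tendsto_intros lnyD corr inv)
  moreover have "\<forall>\<^sub>F n in sequentially. ln (cmod (y n)) / D n + (ln (cmod (1 - b / y n)) - ln (cmod a)) * (1 / D n)
      = log_plus (cmod ((poly f ^^ n) z)) / D n"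
    using filterlim_at_top_dense[THEN iffD1, OF ymod, rule_format, of "cmod b + cmod a"]
  proof eventually_elim
    case (elim n)
    have y0: "y n \<noteq> 0" by (rule bound)
    have ge: "cmod (y n - b) \<ge> cmod a" using elim norm_triangle_ineq2[of "y n" b] by linarith
    then have nb: "y n - b \<noteq> 0" using a by auto
    have eq: "y n - b = y n * (1 - b / y n)" using y0 by (simp add: algebra_simps)
    then have nz: "1 - b / y n \<noteq> 0" using nb by auto
    have "ln (cmod ((y n - b) / a)) = ln (cmod (y n)) + ln (cmod (1 - b / y n)) - ln (cmod a)"
      unfolding eq norm_divide norm_mult using y0 nz a by (simp add: ln_div ln_mult)
    moreover have "cmod ((y n - b) / a) \<ge> 1" using ge a by (simp add: norm_divide)
    ultimately have "log_plus (cmod ((poly f ^^ n) z)) = ln (cmod (y n)) + ln (cmod (1 - b / y n)) - ln (cmod a)"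
      by (simp only: z log_plus_def max_absorb2)
    then show ?case by (simp add: diff_divide_distrib add_divide_distrib)
  qed
  ultimately have "(\<lambda>n. log_plus (cmod ((poly f ^^ n) z)) / D n) \<longlonglongrightarrow> 1"
    using Lim_transform_eventually by fastforce
  then show ?thesis unfolding green_def D_def by (rule limI)
qed

lemma affine_conjugateE:
  assumes "affine_conjugate f g"
  obtains a b where "a \<noteq> 0" "\<And>n z. b + a * (poly f ^^ n) z = (poly g ^^ n) (b + a * z)"
proof -
  obtain L where L: "degree L = 1" "pcompose L f = pcompose g L" using assms by (auto simp: affine_conjugate_def)
  obtain b a where Lba: "L = [:b, a:]" "a \<noteq> 0" using degree1_coeffs[OF L(1)] by metis
  have step: "b + a * poly f z = poly g (b + a * z)" for z
    using arg_cong[OF L(2), of "\<lambda>p. poly p z"] by (simp add: poly_pcompose Lba mult.commute)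
  have "b + a * (poly f ^^ n) z = (poly g ^^ n) (b + a * z)" for n z
    by (induction n) (auto simp: step)
  then show ?thesis using that Lba(2) by blast
qed

lemma power_conjugate_level_curve:
  assumes d: "degree f \<ge> 2" and conj: "affine_conjugate f (monom 1 (degree f))"
  shows "\<exists>C. C \<subseteq> level_curve f 1 \<and> connected C \<and> semialgebraic_curve C"
proof -
  obtain a b where a: "a \<noteq> 0" and it: "\<And>n z. b + a * (poly f ^^ n) z = (poly (monom 1 (degree f)) ^^ n) (b + a * z)"
    using affine_conjugateE[OF conj] by metis
  have pw: "(poly (monom 1 (degree f)) ^^ n) w = w ^ (degree f ^ n)" for n and w :: complex
    by (induction n) (auto simp: poly_monom power_mult[symmetric] mult.commute)
  have "green f z = 1" if z: "z \<in> affine_ellipse b a (exp 1) (exp 1)" for z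
  proof (rule green_eq_1[OF d a])
    show "b + a * (poly f ^^ n) z = (b + a * z) ^ (degree f ^ n)" for n using it pw by simp
    have "(Re (b + a * z))\<^sup>2 + (Im (b + a * z))\<^sup>2 = (exp 1)\<^sup>2"
      using z by (simp add: affine_ellipse_def power_divide add_divide_distrib[symmetric])
    then have m: "cmod (b + a * z) = exp 1" by (simp add: cmod_def)
    then show "(b + a * z) ^ (degree f ^ n) \<noteq> 0" for n by auto
    show "\<bar>ln (cmod ((b + a * z) ^ (degree f ^ n))) - real (degree f) ^ n\<bar> \<le> 0" for n
      unfolding norm_power m by (simp add: ln_realpow)
  qed
  then show ?thesis
    using connected_affine_ellipse[OF a, of "exp 1" "exp 1"] semialgebraic_curve_affine_ellipse[OF a, of "exp 1" "exp 1"]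
    by (intro exI[of _ "affine_ellipse b a (exp 1) (exp 1)"]) (auto simp: level_curve_def)
qed

text \<open>The map \<open>v \<mapsto> (v + 1 / v) / 2\<close> multiplies the cosine of the angle by
  \<open>cosh 1\<close> and the sine by \<open>sinh 1\<close> on the circle of radius
  \<open>exp 1\<close>.\<close>

lemma ellipse_joukowski:
  assumes "(Re w / cosh 1)\<^sup>2 + (Im w / sinh 1)\<^sup>2 = 1"
  obtains v where "cmod v = exp 1" "w = (v + 1 / v) / 2"
proof -
  obtain t where t: "Re w / cosh 1 = cos t" "Im w / sinh 1 = sin t"
    using sincos_total_2pi[OF assms] by metis
  have pos: "cosh (1::real) > 0" "sinh (1::real) > 0" by (auto simp: sinh_def)
  define v where "v = of_real (exp 1) * cis t"
  have "1 / v = of_real (exp (- 1)) * cis (- t)"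
    by (simp add: v_def exp_minus cis_inverse[symmetric] field_simps)
  then have v: "Re v = exp 1 * cos t" "Im v = exp 1 * sin t"
      "Re (1 / v) = exp (- 1) * cos t" "Im (1 / v) = - (exp (- 1) * sin t)"
    by (simp_all only: v_def) simp_all
  have "(v + 1 / v) / 2 = Complex ((Re v + Re (1 / v)) / 2) ((Im v + Im (1 / v)) / 2)"
    by (simp add: complex_eq_iff)
  also have "\<dots> = Complex (cosh 1 * cos t) (sinh 1 * sin t)"
    unfolding v by (simp add: cosh_field_def sinh_field_def field_simps)
  also have "\<dots> = w" using t pos by (simp add: complex_eq_iff field_simps)
  finally show ?thesis by (intro that[of v]) (auto simp: v_def norm_mult)
qed

lemma chebyshev_conjugate_level_curve:
  assumes d: "degree f \<ge> 2" and \<sigma>: "\<sigma> = 1 \<or> \<sigma> = - 1" and conj: "affine_conjugate f (smult \<sigma> (chebyshev_T (degree f)))"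
  shows "\<exists>C. C \<subseteq> level_curve f 1 \<and> connected C \<and> semialgebraic_curve C"
proof -
  let ?d = "degree f"
  obtain a b where a: "a \<noteq> 0" and it: "\<And>n z. b + a * (poly f ^^ n) z = (poly (smult \<sigma> (chebyshev_T ?d)) ^^ n) (b + a * z)"
    using affine_conjugateE[OF conj] by metis
  have green: "green f z = 1" if z: "z \<in> affine_ellipse b a (cosh 1) (sinh 1)" for z
  proof -
    obtain v where v: "cmod v = exp 1" "b + a * z = (v + 1 / v) / 2"
      using ellipse_joukowski[of "b + a * z"] z unfolding affine_ellipse_def by blast
    have "\<exists>u. cmod u = exp (real (?d ^ n)) \<and> b + a * (poly f ^^ n) z = (u + 1 / u) / 2" for n
      unfolding it
    proof (induction n)
      case 0 show ?case using v by (intro exI[of _ v]) simp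
    next
      case (Suc n)
      then obtain u where u: "cmod u = exp (real (?d ^ n))"
        "(poly (smult \<sigma> (chebyshev_T ?d)) ^^ n) (b + a * z) = (u + 1 / u) / 2" by blast
      have u0: "u \<noteq> 0" using u by auto
      \<comment> \<open>The sign is absorbed into the new \<open>u\<close>, as \<sigma> is its own
        inverse.\<close>
      have "(poly (smult \<sigma> (chebyshev_T ?d)) ^^ Suc n) (b + a * z) = (\<sigma> * u ^ ?d + 1 / (\<sigma> * u ^ ?d)) / 2"
        using \<sigma> by (auto simp: u(2) chebyshev_joukowski[OF u0])
      moreover have "cmod (\<sigma> * u ^ ?d) = exp (real (?d ^ Suc n))"
        using \<sigma> by (auto simp: norm_mult norm_power u(1) exp_of_nat_mult[symmetric])
      ultimately show ?case by blast
    qed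
    then obtain u where u: "\<And>n. cmod (u n) = exp (real (?d ^ n))" "\<And>n. b + a * (poly f ^^ n) z = (u n + 1 / u n) / 2"
      by metis
    \<comment> \<open>With \<open>E = cmod (u n) \<ge> 2\<close> the term \<open>1 / u n\<close> has
      modulus at most \<open>1 / 2\<close>; the factor 4 becomes the error bound
      \<open>ln 4\<close>.\<close>
    have est: "cmod ((u n + 1 / u n) / 2) \<le> exp (real (?d ^ n))" "exp (real (?d ^ n)) / 4 \<le> cmod ((u n + 1 / u n) / 2)" for n
    proof -
      define E where "E = exp (real (?d ^ n))"
      have "real (?d ^ n) \<ge> 1" using d by (metis One_nat_def Suc_le_lessD Suc_1 Suc_leD less_le_trans of_nat_1 of_nat_le_iff one_le_power)
      then have "E \<ge> exp 1" by (simp add: E_def)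
      moreover have "exp (1::real) \<ge> 2" using exp_ge_add_one_self[of 1] by simp
      ultimately have E: "E \<ge> 2" by linarith
      have 1: "cmod (u n) = E" "cmod (1 / u n) = 1 / E" using u(1)[of n] by (auto simp: E_def norm_divide)
      have inv: "1 / E \<le> 1 / 2" using E by simp
      have "cmod (u n + 1 / u n) \<le> E + 1 / E" using norm_triangle_ineq[of "u n" "1 / u n"] 1 by simp
      moreover have "cmod (u n + 1 / u n) \<ge> E - 1 / E" using norm_diff_ineq[of "u n" "1 / u n"] 1 by simp
      moreover have "cmod ((u n + 1 / u n) / 2) = cmod (u n + 1 / u n) / 2" by (simp add: norm_divide)
      ultimately show "cmod ((u n + 1 / u n) / 2) \<le> exp (real (?d ^ n))" "exp (real (?d ^ n)) / 4 \<le> cmod ((u n + 1 / u n) / 2)"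
        unfolding E_def[symmetric] using E inv by linarith+
    qed
    have pos: "cmod ((u n + 1 / u n) / 2) > 0" for n using est(2)[of n] by (rule less_le_trans[rotated]) simp
    show ?thesis
    proof (rule green_eq_1[OF d a u(2)])
      show "\<bar>ln (cmod ((u n + 1 / u n) / 2)) - real ?d ^ n\<bar> \<le> ln 4" for n
      proof -
        have "ln (cmod ((u n + 1 / u n) / 2)) \<le> ln (exp (real (?d ^ n)))"
          using est(1)[of n] pos[of n] by (subst ln_le_cancel_iff) auto
        moreover have "ln (exp (real (?d ^ n)) / 4) \<le> ln (cmod ((u n + 1 / u n) / 2))"
          using est(2)[of n] pos[of n] by (subst ln_le_cancel_iff) auto
        moreover have "ln (4::real) \<ge> 0" by simp
        ultimately show ?thesis by (simp add: ln_div)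
      qed
      show "(u n + 1 / u n) / 2 \<noteq> 0" for n using pos[of n] unfolding zero_less_norm_iff .
    qed
  qed
  have "cosh (1::real) > 0" "sinh (1::real) > 0" by auto
  then show ?thesis
    using connected_affine_ellipse[OF a, of "cosh 1" "sinh 1"] semialgebraic_curve_affine_ellipse[OF a, of "cosh 1" "sinh 1"] green
    by (intro exI[of _ "affine_ellipse b a (cosh 1) (sinh 1)"]) (auto simp: level_curve_def)
qed

lemma exceptional_level_curve:
  assumes "degree f \<ge> 2" "exceptional f"
  shows "\<exists>C. C \<subseteq> level_curve f 1 \<and> connected C \<and> semialgebraic_curve C"
  using assms power_conjugate_level_curve chebyshev_conjugate_level_curve[of f 1] chebyshev_conjugate_level_curve[of f "- 1"]
  unfolding exceptional_def by auto

section \<open>Semialgebraic subsets of level curves\<close>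

lemma contains_cell_1_uncountable:
  assumes "contains_cell S 1"
  shows "uncountable S"
proof -
  obtain U where U: "U \<subseteq> S" "top_of_set U homeomorphic_space Euclidean_space 1"
    using assms by (auto simp: contains_cell_def)
  then have "euclideanreal homeomorphic_space top_of_set U"
    using Euclidean_space_1_homeomorphic_real homeomorphic_space_sym homeomorphic_space_trans by blast
  then obtain h where h: "homeomorphic_map euclideanreal (top_of_set U) h"
    unfolding homeomorphic_space by blast
  have "inj h" using homeomorphic_imp_injective_map[OF h] by simp
  moreover have "range h = U" using homeomorphic_imp_surjective_map[OF h] by simp
  ultimately have "uncountable U" using uncountable_UNIV_real countable_image_inj_on by metis
  then show ?thesis using U(1) countable_subset by blast
qed

lemma eval_plane_continuous: "continuous_on A (eval_plane P)"
  unfolding eval_plane_def[abs_def] eval2_def[symmetric] eval2_eq_sum by (intro continuous_intros)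

text \<open>One of the finitely many pieces is uncountable. Either it satisfies a nontrivial
  equation, or it is given by strict inequalities alone and is open.\<close>

lemma semialgebraic_uncountable_zeros:
  assumes "semialgebraic S" "uncountable S"
  obtains A P where "A \<subseteq> S" "uncountable A" "P \<noteq> 0" "\<And>z. z \<in> A \<Longrightarrow> eval_plane P z = 0"
proof -
  obtain F :: "(real poly poly set \<times> real poly poly set) set" where F: "finite F"
      "\<And>E G. (E, G) \<in> F \<Longrightarrow> finite E \<and> finite G"
      "S = (\<Union>(E, G) \<in> F. {z. (\<forall>P\<in>E. eval_plane P z = 0) \<and> (\<forall>Q\<in>G. eval_plane Q z > 0)})"
    using assms(1) unfolding semialgebraic_def by blast
  define T where "T E G = {z. (\<forall>P\<in>E. eval_plane P z = 0) \<and> (\<forall>Q\<in>G. eval_plane Q z > 0)}" for E G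
  have S: "S = (\<Union>x \<in> F. T (fst x) (snd x))" unfolding F(3) T_def by (auto split: prod.splits)
  have "\<exists>x\<in>F. uncountable (T (fst x) (snd x))"
    using assms(2) countable_UN[OF countable_finite[OF F(1)], of "\<lambda>x. T (fst x) (snd x)"] unfolding S by blast
  then obtain E G where EG: "(E, G) \<in> F" "uncountable (T E G)" by auto
  have TS: "T E G \<subseteq> S" using EG(1) unfolding S by force
  show ?thesis
  proof (cases "\<exists>P\<in>E. P \<noteq> 0")
    case True
    then obtain P where "P \<in> E" "P \<noteq> 0" by blast
    then show ?thesis using that[of "T E G" P] TS EG(2) by (auto simp: T_def)
  next
    case False
    then have T_eq: "T E G = (\<Inter>Q\<in>G. {z. eval_plane Q z > 0})" by (auto simp: T_def eval_plane_def)
    have "open (T E G)" unfolding T_eq using F(2)[OF EG(1)]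
      by (intro open_INT ballI open_Collect_less eval_plane_continuous continuous_on_const) auto
    moreover obtain z0 where z0: "z0 \<in> T E G" using EG(2) by (metis countable_empty ex_in_conv)
    ultimately obtain \<rho> where \<rho>: "\<rho> > 0" "ball z0 \<rho> \<subseteq> T E G" using open_contains_ball by blast
    \<comment> \<open>An open piece is not excluded here; it contains a horizontal segment.\<close>
    define A where "A = (\<lambda>x. Complex x (Im z0)) ` {Re z0 - \<rho><..<Re z0 + \<rho>}"
    have "uncountable A"
    proof
      assume "countable A"
      then have "countable {Re z0 - \<rho><..<Re z0 + \<rho>}"
        unfolding A_def by (rule countable_image_inj_on) (auto simp: inj_on_def)
      then show False using \<rho>(1) uncountable_open_interval[of "Re z0 - \<rho>" "Re z0 + \<rho>"] by simp
    qed
    moreover have "A \<subseteq> ball z0 \<rho>"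
    proof
      fix z assume "z \<in> A"
      then have "Im z = Im z0" "\<bar>Re z - Re z0\<bar> < \<rho>" by (auto simp: A_def)
      then show "z \<in> ball z0 \<rho>" by (simp add: dist_norm cmod_def abs_minus_commute)
    qed
    moreover have "eval_plane [:[:- Im z0:], 1:] z = 0" if "z \<in> A" for z
      using that by (auto simp: A_def eval_plane_def)
    ultimately show ?thesis using that[of A "[:[:- Im z0:], 1:]"] \<rho>(2) TS by auto
  qed
qed

text \<open>A bounded orbit would have Green value 0, so some iterate enters the domain of \<phi>.
  There the level fixes \<open>cmod (\<phi> t)\<close>, and further iterations raise it to
  \<open>d\<close>-th powers until it drops below \<eta>.\<close>

lemma green_level_escapes:
  fixes f :: "complex poly"
  assumes d2: "degree f \<ge> 2" and r: "r > 0" "green f z = r" and \<delta>: "\<delta> > 0" and \<eta>: "\<eta> > 0"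
    and h: "\<And>t. t \<in> ball 0 \<delta> \<Longrightarrow> inf_conj f t \<in> ball 0 \<delta>"
    and \<phi>h: "\<And>t. t \<in> ball 0 \<delta> \<Longrightarrow> \<phi> (inf_conj f t) = \<phi> t ^ degree f" and \<phi>0: "\<phi> 0 = 0"
    and lim: "\<And>t. t \<in> ball 0 \<delta> \<Longrightarrow> t \<noteq> 0 \<Longrightarrow> \<phi> t \<noteq> 0 \<and>
      (\<lambda>n. log_plus (cmod ((poly f ^^ n) (1 / t))) / real (degree f) ^ n) \<longlonglongrightarrow> - ln (cmod (\<phi> t))"
  shows "\<exists>n t. t \<in> ball 0 \<delta> \<and> t \<noteq> 0 \<and> (poly f ^^ n) z = 1 / t \<and>
    cmod (\<phi> t) = exp (- (r * real (degree f) ^ n)) \<and> cmod (\<phi> t) < \<eta>"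
proof -
  let ?d = "degree f"
  define X where "X n = log_plus (cmod ((poly f ^^ n) z)) / real ?d ^ n" for n
  have "\<exists>n. cmod ((poly f ^^ n) z) > 1 / \<delta>"
  proof (rule ccontr)
    assume "\<not> ?thesis"
    then have bnd: "cmod ((poly f ^^ n) z) \<le> 1 / \<delta>" for n by (simp add: not_less)
    define K where "K = ln (max 1 (1 / \<delta>))"
    have "X \<longlonglongrightarrow> 0"
    proof (rule Lim_null_comparison)
      show "\<forall>\<^sub>F n in sequentially. norm (X n) \<le> K * (1 / real ?d) ^ n"
      proof (intro always_eventually allI)
        fix n
        have "max 1 (cmod ((poly f ^^ n) z)) \<le> max 1 (1 / \<delta>)" using bnd[of n] by linarith
        then have "log_plus (cmod ((poly f ^^ n) z)) \<le> K" "0 \<le> log_plus (cmod ((poly f ^^ n) z))"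
          by (auto simp: log_plus_def K_def)
        then show "norm (X n) \<le> K * (1 / real ?d) ^ n"
          by (simp add: X_def power_divide divide_right_mono)
      qed
      show "(\<lambda>n. K * (1 / real ?d) ^ n) \<longlonglongrightarrow> 0"
        using d2 by (intro tendsto_mult_right_zero LIMSEQ_power_zero) auto
    qed
    then have "green f z = 0" unfolding green_def X_def[symmetric] by (rule limI)
    then show False using r by simp
  qed
  then obtain n0 where n0: "cmod ((poly f ^^ n0) z) > 1 / \<delta>" by blast
  define t0 where "t0 = 1 / (poly f ^^ n0) z"
  have nz: "(poly f ^^ n0) z \<noteq> 0" using n0 \<delta> by (auto simp: divide_less_0_iff)
  have t0: "t0 \<in> ball 0 \<delta>" "t0 \<noteq> 0" "(poly f ^^ n0) z = 1 / t0"
    using n0 \<delta> nz by (auto simp: t0_def norm_divide field_simps)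
  \<comment> \<open>The sequence of \<open>z\<close> itself shifted by \<open>n0\<close>; the extra
    division accounts for the iterations already spent.\<close>
  have "(\<lambda>n. log_plus (cmod ((poly f ^^ n) (1 / t0))) / real ?d ^ n / real ?d ^ n0)
      \<longlonglongrightarrow> - ln (cmod (\<phi> t0)) / real ?d ^ n0"
    using lim[OF t0(1,2)] d2 by (intro tendsto_divide tendsto_const) auto
  moreover have "(\<lambda>n. log_plus (cmod ((poly f ^^ n) (1 / t0))) / real ?d ^ n / real ?d ^ n0) = (\<lambda>n. X (n + n0))"
    by (simp add: X_def t0(3)[symmetric] power_add funpow_add)
  ultimately have "(\<lambda>n. X (n + n0)) \<longlonglongrightarrow> - ln (cmod (\<phi> t0)) / real ?d ^ n0" by simp
  then have "X \<longlonglongrightarrow> - ln (cmod (\<phi> t0)) / real ?d ^ n0" by (rule LIMSEQ_offset)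
  then have "green f z = - ln (cmod (\<phi> t0)) / real ?d ^ n0" unfolding green_def X_def[symmetric] by (rule limI)
  then have "ln (cmod (\<phi> t0)) = - (r * real ?d ^ n0)" using r d2 by (simp add: field_simps)
  moreover have \<phi>t0: "\<phi> t0 \<noteq> 0" using lim[OF t0(1,2)] by blast
  ultimately have mod0: "cmod (\<phi> t0) = exp (- (r * real ?d ^ n0))" by (metis exp_ln zero_less_norm_iff)
  define t where "t m = (inf_conj f ^^ m) t0" for m
  have t: "t m \<in> ball 0 \<delta> \<and> t m \<noteq> 0 \<and> (poly f ^^ (m + n0)) z = 1 / t m \<and>
      cmod (\<phi> (t m)) = exp (- (r * real ?d ^ (m + n0)))" for m
  proof (induction m)
    case 0 then show ?case using t0 mod0 by (simp add: t_def)
  next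
    case (Suc m)
    have tS: "t (Suc m) = inf_conj f (t m)" by (simp add: t_def)
    have \<phi>S: "\<phi> (t (Suc m)) = \<phi> (t m) ^ ?d" unfolding tS using \<phi>h Suc by blast
    have modS: "cmod (\<phi> (t (Suc m))) = exp (- (r * real ?d ^ (Suc m + n0)))"
    proof -
      have "cmod (\<phi> (t (Suc m))) = exp (- (r * real ?d ^ (m + n0))) ^ ?d"
        using Suc unfolding \<phi>S norm_power by simp
      then show ?thesis by (simp add: exp_of_nat_mult[symmetric] algebra_simps)
    qed
    have "t (Suc m) \<noteq> 0"
    proof
      assume "t (Suc m) = 0"
      then have "\<phi> (t (Suc m)) = 0" using \<phi>0 by simp
      then show False using modS by simp
    qed
    moreover have "(poly f ^^ (Suc m + n0)) z = 1 / t (Suc m)"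
      using Suc poly_inverse_inf_conj[of "t m" f] by (simp add: tS)
    moreover have "t (Suc m) \<in> ball 0 \<delta>" unfolding tS using h Suc by blast
    ultimately show ?case using modS by blast
  qed
  obtain m where m: "- ln \<eta> / r < real m" using reals_Archimedean2 by blast
  have "m + n0 < 2 ^ (m + n0)" by (rule less_exp)
  also have "(2::nat) ^ (m + n0) \<le> ?d ^ (m + n0)" using d2 by (intro power_mono) auto
  finally have "real m \<le> real ?d ^ (m + n0)" by (metis add_leD1 less_imp_le of_nat_le_iff of_nat_power)
  then have "- ln \<eta> / r < real ?d ^ (m + n0)" using m by linarith
  then have "- ln \<eta> < r * real ?d ^ (m + n0)" using r by (simp add: field_simps)
  then have "exp (- (r * real ?d ^ (m + n0))) < exp (ln \<eta>)" by simp
  then have "cmod (\<phi> (t m)) < \<eta>" using t[of m] \<eta> by simp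
  then show ?thesis using t[of m] by blast
qed

section \<open>From an algebraic subset of a level curve to an exceptional polynomial\<close>

lemma iterate_poly:
  fixes f :: "'a::{comm_semiring_1, semiring_no_zero_divisors} poly"
  obtains p where "\<And>z. poly p z = (poly f ^^ n) z" "degree p = degree f ^ n"
proof -
  define p where "p n = (pcompose f ^^ n) [:0, 1:]" for n
  have "poly (p n) z = (poly f ^^ n) z" for n z
    by (induction n) (auto simp: p_def poly_pcompose)
  moreover have "degree (p n) = degree f ^ n" for n
    by (induction n) (auto simp: p_def degree_pcompose)
  ultimately show ?thesis using that by blast
qed

lemma infinite_poly_image:
  fixes p :: "'a::idom poly"
  assumes "infinite A" "degree p > 0"
  shows "infinite (poly p ` A)"
proof
  assume fin: "finite (poly p ` A)"
  have "finite {z. poly p z = u}" for u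
  proof -
    have "p - [:u:] \<noteq> 0" using assms(2) by auto
    from poly_roots_finite[OF this] show ?thesis by simp
  qed
  then have "finite (\<Union>u\<in>poly p ` A. {z. poly p z = u})" using fin by blast
  moreover have "A \<subseteq> (\<Union>u\<in>poly p ` A. {z. poly p z = u})" by auto
  ultimately show False using assms(1) finite_subset by blast
qed

lemma algebraic_level_set_imp_exceptional:
  fixes f :: "complex poly"
  assumes d2: "degree f \<ge> 2" and r: "r > 0" and A: "A \<subseteq> level_curve f r" "uncountable A"
    and P: "P \<noteq> 0" "\<And>z. z \<in> A \<Longrightarrow> eval_plane P z = 0"
  shows "exceptional f"
proof -
  let ?d = "degree f"
  obtain \<phi> \<theta> \<delta> \<eta>0 where b: "\<delta> > 0" "\<delta> < 1" "\<eta>0 > 0"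
    and \<phi>: "\<phi> holomorphic_on ball 0 \<delta>" "\<phi> 0 = 0" "inj_on \<phi> (ball 0 \<delta>)" "deriv \<phi> 0 \<noteq> 0"
    and h: "\<And>t. t \<in> ball 0 \<delta> \<Longrightarrow> inf_conj f t \<in> ball 0 \<delta>"
    and \<phi>h: "\<And>t. t \<in> ball 0 \<delta> \<Longrightarrow> \<phi> (inf_conj f t) = \<phi> t ^ ?d"
    and \<theta>0: "\<theta> holomorphic_on ball 0 \<eta>0" "\<And>w. w \<in> ball 0 \<eta>0 \<Longrightarrow> \<theta> w \<in> ball 0 \<delta> \<and> \<phi> (\<theta> w) = w"
    and lim: "\<And>t. t \<in> ball 0 \<delta> \<Longrightarrow> t \<noteq> 0 \<Longrightarrow> \<phi> t \<noteq> 0 \<and>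
      (\<lambda>n. log_plus (cmod ((poly f ^^ n) (1 / t))) / real ?d ^ n) \<longlonglongrightarrow> - ln (cmod (\<phi> t))"
    by (rule boettcher[OF d2]) (rule that)
  define \<eta> where "\<eta> = min \<eta>0 (1 / 2)"
  have \<eta>: "0 < \<eta>" "\<eta> < 1" "\<eta> \<le> \<eta>0" using b by (auto simp: \<eta>_def)
  have \<theta>: "\<theta> holomorphic_on ball 0 \<eta>"
    by (rule holomorphic_on_subset[OF \<theta>0(1)]) (use \<eta> in auto)
  have \<theta>\<delta>: "\<theta> w \<in> ball 0 \<delta>" and \<phi>\<theta>: "\<phi> (\<theta> w) = w" if "cmod w < \<eta>" for w
    using \<theta>0(2)[of w] that \<eta> by auto
  have \<theta>_unique: "t = \<theta> w" if "t \<in> ball 0 \<delta>" "\<phi> t = w" "cmod w < \<eta>" for t w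
    using inj_onD[OF \<phi>(3), of t "\<theta> w"] that \<theta>\<delta> \<phi>\<theta> by simp
  have \<theta>_0: "\<theta> 0 = 0" using \<theta>_unique[of 0 0] b \<phi>(2) \<eta> by simp
  have \<theta>_nz: "\<theta> w \<noteq> 0" if "w \<noteq> 0" "cmod w < \<eta>" for w
    using \<phi>\<theta>[OF that(2)] \<phi>(2) that(1) by auto
  have d\<theta>: "deriv \<theta> 0 \<noteq> 0"
  proof
    assume d0: "deriv \<theta> 0 = 0"
    have "(\<theta> has_field_derivative deriv \<theta> 0) (at 0)"
      by (rule holomorphic_derivI[OF \<theta>]) (use \<eta> in auto)
    moreover have "(\<phi> has_field_derivative deriv \<phi> 0) (at (\<theta> 0))"
      unfolding \<theta>_0 by (rule holomorphic_derivI[OF \<phi>(1)]) (use b in auto)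
    ultimately have "((\<lambda>w. \<phi> (\<theta> w)) has_field_derivative deriv \<phi> 0 * deriv \<theta> 0) (at 0)"
      by (rule DERIV_chain2[rotated])
    moreover have "((\<lambda>w. \<phi> (\<theta> w)) has_field_derivative 1) (at 0)"
    proof (rule has_field_derivative_transform_within_open[of "\<lambda>w. w" _ _ "ball 0 \<eta>"])
      show "((\<lambda>w. w) has_field_derivative 1) (at 0)" by (rule DERIV_ident)
    qed (use \<eta> \<phi>\<theta> in auto)
    ultimately have "deriv \<phi> 0 * deriv \<theta> 0 = 1" by (rule DERIV_unique)
    then show False using d0 by simp
  qed
  define \<theta>1 where "\<theta>1 w = (if w = 0 then deriv \<theta> 0 else \<theta> w / w)" for w
  have \<theta>1: "\<theta>1 holomorphic_on ball 0 \<eta>" unfolding \<theta>1_def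
    by (rule pole_theorem_0[OF \<theta>]) (use \<eta> \<theta>_0 in auto)
  \<comment> \<open>So \<open>q w / w = 1 / \<theta> w\<close> is the inverse Boettcher coordinate
    \<open>k\<close>, and \<open>q\<close> is its holomorphic numerator, nonzero at 0 because the
    pole is simple.\<close>
  define q where "q w = 1 / \<theta>1 w" for w
  have "\<theta>1 w \<noteq> 0" if "cmod w < \<eta>" for w using \<theta>_nz that d\<theta> by (auto simp: \<theta>1_def)
  then have hol_q: "q holomorphic_on ball 0 \<eta>" unfolding q_def by (intro holomorphic_intros \<theta>1) auto
  have q0: "q 0 \<noteq> 0" using d\<theta> by (simp add: q_def \<theta>1_def)
  have qw: "q w / w = 1 / \<theta> w" if "w \<noteq> 0" for w using that by (simp add: q_def \<theta>1_def)
  have pow_le: "cmod (w ^ ?d) < \<eta>" if "cmod w < \<eta>" for w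
    using power_decreasing[of 1 ?d "cmod w"] that \<eta> d2 by (simp add: norm_power)
  have eqn: "poly f (q w / w) = q (w ^ ?d) / w ^ ?d" if w: "w \<noteq> 0" "cmod w < \<eta>" for w
  proof -
    have "\<phi> (inf_conj f (\<theta> w)) = w ^ ?d" using \<phi>h[OF \<theta>\<delta>[OF w(2)]] \<phi>\<theta>[OF w(2)] by simp
    then have "inf_conj f (\<theta> w) = \<theta> (w ^ ?d)"
      by (rule \<theta>_unique[OF h[OF \<theta>\<delta>[OF w(2)]] _ pow_le[OF w(2)]])
    then show ?thesis
      using qw[OF w(1)] qw[of "w ^ ?d"] w(1) poly_inverse_inf_conj[OF \<theta>_nz[OF w], of f] by simp
  qed
  have "\<forall>z\<in>A. \<exists>n t. t \<in> ball 0 \<delta> \<and> t \<noteq> 0 \<and> (poly f ^^ n) z = 1 / t \<and>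
    cmod (\<phi> t) = exp (- (r * real ?d ^ n)) \<and> cmod (\<phi> t) < \<eta>"
  proof
    fix z assume "z \<in> A"
    then have "green f z = r" using A(1) by (auto simp: level_curve_def)
    then show "\<exists>n t. t \<in> ball 0 \<delta> \<and> t \<noteq> 0 \<and> (poly f ^^ n) z = 1 / t \<and>
        cmod (\<phi> t) = exp (- (r * real ?d ^ n)) \<and> cmod (\<phi> t) < \<eta>"
      by (intro green_level_escapes[OF d2 r _ b(1) \<eta>(1) h \<phi>h \<phi>(2) lim])
  qed
  then obtain N T where NT: "\<And>z. z \<in> A \<Longrightarrow> T z \<in> ball 0 \<delta> \<and> T z \<noteq> 0 \<and> (poly f ^^ N z) z = 1 / T z \<and>
      cmod (\<phi> (T z)) = exp (- (r * real ?d ^ N z)) \<and> cmod (\<phi> (T z)) < \<eta>"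
    by metis
  \<comment> \<open>Uncountability of \<open>A\<close> provides one iterate that works for infinitely many points.\<close>
  have "\<exists>n. uncountable {z \<in> A. N z = n}"
  proof (rule ccontr)
    assume "\<not> ?thesis"
    then have "countable (\<Union>n. {z \<in> A. N z = n})" by (intro countable_UN) auto
    moreover have "(\<Union>n. {z \<in> A. N z = n}) = A" by auto
    ultimately show False using A(2) by simp
  qed
  then obtain n where n: "uncountable {z \<in> A. N z = n}" ..
  define An where "An = {z \<in> A. N z = n}"
  have infAn: "infinite An" using n countable_finite unfolding An_def by blast
  define r' where "r' = r * real ?d ^ n"
  have TAn: "T z \<in> ball 0 \<delta>" "T z \<noteq> 0" "(poly f ^^ n) z = 1 / T z" "cmod (\<phi> (T z)) = exp (- r')" "cmod (\<phi> (T z)) < \<eta>"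
    if "z \<in> An" for z using NT[of z] that by (auto simp: An_def r'_def)
  define R where "R = - ln \<eta>"
  have R: "R \<ge> 0" "exp (- R) = \<eta>" using \<eta> by (auto simp: R_def)
  obtain z1 where "z1 \<in> An" using infAn by (metis finite.emptyI ex_in_conv)
  then have "exp (- r') < exp (- R)" using TAn(4,5)[of z1] R by simp
  then have r'R: "r' > R" by simp
  obtain F :: "complex poly poly" where F: "F \<noteq> 0" "\<And>z. eval2 F z (cnj z) = of_real (eval_plane P z)"
    by (rule complexify_plane_polynomial[OF P(1)]) (rule that)
  obtain p where p: "\<And>z. poly p z = (poly f ^^ n) z" "degree p = ?d ^ n" by (rule iterate_poly) (rule that)
  \<comment> \<open>The second variable stands for \<open>cnj z\<close>, and the conjugated
    polynomial sends \<open>cnj z\<close> to \<open>cnj (poly p z)\<close>.\<close>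
  obtain G where G: "G \<noteq> 0" "\<And>x y. eval2 F x y = 0 \<Longrightarrow> eval2 G (poly p x) (poly (map_poly cnj p) y) = 0"
    by (rule eliminate_both[OF F(1)]) (rule that)
  have Gz: "eval2 G (poly p z) (cnj (poly p z)) = 0" if "z \<in> An" for z
    using that P(2)[of z] unfolding poly_cnj by (intro G(2)) (simp add: F(2) An_def)
  define \<Psi> where "\<Psi> z = q (exp (- z)) / exp (- z)" for z
  have small: "cmod (exp (- z)) < \<eta>" if "Re z > R" for z
    using that R(2) by (metis exp_less_mono neg_less_iff_less norm_exp_eq_Re uminus_complex.simps(1))
  have hol\<Psi>: "\<Psi> holomorphic_on {z. Re z > R}" unfolding \<Psi>_def
    by (intro holomorphic_intros holomorphic_on_compose_gen[OF _ hol_q, unfolded o_def]) (use small in auto)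
  have unb: "\<exists>z. Re z > R \<and> cmod (\<Psi> z) > M" for M
  proof -
    have "isCont \<theta> 0"
      by (rule holomorphic_on_ball_imp_isCont[OF \<theta> \<eta>(1)])
    then obtain e where e: "e > 0" "\<And>w. cmod w < e \<Longrightarrow> cmod (\<theta> w) < 1 / (\<bar>M\<bar> + 1)"
      unfolding continuous_at_eps_delta dist_norm \<theta>_0
      by (metis diff_zero abs_ge_zero add_nonneg_pos zero_less_divide_1_iff zero_less_one)
    define x where "x = max (R + 1) (1 - ln e)"
    have x: "x > R" "exp (- x) < e"
    proof -
      have "exp (- x) < exp (ln e)" by (subst exp_less_cancel_iff) (simp add: x_def)
      then show "exp (- x) < e" using e(1) by simp
    qed (simp add: x_def)
    define w where "w = exp (- complex_of_real x)"
    have w: "w \<noteq> 0" "cmod w < e" "cmod w < \<eta>" using x small[of "of_real x"] by (auto simp: w_def)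
    have "\<theta> w \<noteq> 0" using \<theta>_nz w by blast
    moreover have "cmod (\<theta> w) * (\<bar>M\<bar> + 1) < 1" using e(2)[OF w(2)] by (simp add: field_simps)
    ultimately have "M < 1 / cmod (\<theta> w)" by (simp add: less_divide_eq field_simps) (smt (verit) mult_right_mono norm_ge_zero zero_less_norm_iff)
    moreover have "\<Psi> (of_real x) = 1 / \<theta> w" using qw[OF w(1)] by (simp add: \<Psi>_def w_def)
    ultimately show ?thesis using x(1) by (intro exI[of _ "of_real x"]) (simp add: norm_divide)
  qed
  define Z where "Z = {z. Re z = r' \<and> \<bar>Im z\<bar> \<le> pi \<and> eval2 G (\<Psi> z) (cnj (\<Psi> z)) = 0}"
  have "poly p ` An \<subseteq> \<Psi> ` Z"
  proof clarify
    fix z assume z: "z \<in> An"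
    define w where "w = \<phi> (T z)"
    have w: "cmod w < \<eta>" "cmod w = exp (- r')" "w \<noteq> 0" using TAn[OF z] by (auto simp: w_def)
    have "T z = \<theta> w" using \<theta>_unique[OF TAn(1)[OF z]] w by (simp add: w_def)
    then have pz: "poly p z = 1 / \<theta> w" using TAn(3)[OF z] p by simp
    define \<zeta> where "\<zeta> = - Ln w"
    have "exp (- \<zeta>) = w" using w by (simp add: \<zeta>_def)
    then have \<Psi>\<zeta>: "\<Psi> \<zeta> = poly p z" using qw[OF w(3)] pz by (simp add: \<Psi>_def)
    have "Re \<zeta> = r'" using w by (simp add: \<zeta>_def)
    moreover have "\<bar>Im \<zeta>\<bar> \<le> pi" using mpi_less_Im_Ln[OF w(3)] Im_Ln_le_pi[OF w(3)] by (simp add: \<zeta>_def abs_le_iff)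
    ultimately have "\<zeta> \<in> Z" using Gz[OF z] \<Psi>\<zeta> by (simp add: Z_def)
    then show "poly p z \<in> \<Psi> ` Z" using \<Psi>\<zeta> by (metis imageI)
  qed
  moreover have "infinite (poly p ` An)" using infAn p(2) d2 by (intro infinite_poly_image) auto
  ultimately have infZ: "infinite Z" using finite_subset finite_imageI by blast
  have bddZ: "bounded Z"
  proof (rule boundedI)
    fix z assume "z \<in> Z"
    then show "cmod z \<le> \<bar>r'\<bar> + pi" using cmod_le[of z] by (simp add: Z_def)
  qed
  obtain t e b \<Psi>' where ext: "e > 0" "b > R" "\<Psi>' holomorphic_on rect (-1) b t e"
    "\<And>z. z \<in> rect R b t e \<Longrightarrow> \<Psi>' z = \<Psi> z"
    by (rule extend_across_imaginary_axis[OF hol\<Psi> unb R(1) r'R G(1) infZ bddZ]) (auto simp: Z_def intro: that)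
  obtain Q where Q: "\<And>w. w \<in> ball 0 \<eta> \<Longrightarrow> q w = poly Q w"
    by (rule extension_imp_polynomial[OF d2 \<eta>(1,2) hol_q eqn ext(1) ext(2)[unfolded R_def] ext(3)])
       (use ext(4) in \<open>auto simp: R_def \<Psi>_def intro: that\<close>)
  have Q0: "poly Q 0 \<noteq> 0" using Q[of 0] q0 \<eta> by simp
  \<comment> \<open>Once \<open>q\<close> is a polynomial, both sides are holomorphic away from 0,
    so the functional equation leaves the small disc and the behaviour of \<open>k\<close> at
    infinity becomes accessible.\<close>
  have Qeqn: "poly f (poly Q w / w) = poly Q (w ^ ?d) / w ^ ?d" if "w \<noteq> 0" for w
  proof (rule analytic_continuation_open[of "ball 0 \<eta> - {0}" "- {0}"
        "\<lambda>w. poly f (poly Q w / w)" "\<lambda>w. poly Q (w ^ ?d) / w ^ ?d"])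
    show "open (ball (0::complex) \<eta> - {0})" "open (- {0::complex})" by auto
    have "of_real (\<eta> / 2) \<in> ball (0::complex) \<eta> - {0}" using \<eta> by simp
    then show "ball (0::complex) \<eta> - {0} \<noteq> {}" by blast
    show "connected (- {0::complex})" by (rule connected_punctured_universe) simp
    show "(\<lambda>w. poly f (poly Q w / w)) holomorphic_on - {0}" by (intro holomorphic_intros) auto
    show "(\<lambda>w. poly Q (w ^ ?d) / w ^ ?d) holomorphic_on - {0}" by (intro holomorphic_intros) auto
    show "poly f (poly Q w / w) = poly Q (w ^ ?d) / w ^ ?d" if "w \<in> ball 0 \<eta> - {0}" for w
      using eqn[of w] Q[of w] Q[of "w ^ ?d"] pow_le[of w] that by simp
  qed (use that in auto)
  show ?thesis
  proof (cases "degree Q \<le> 1")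
    case True
    then show ?thesis
      unfolding exceptional_def using degree_1_semiconjugacy_exceptional[OF Q0 True Qeqn] by blast
  next
    case False
    have "degree Q = 2"
    proof (rule laurent_semiconjugacy_degree[OF d2 Q0 _ Qeqn b(1) \<phi> \<phi>h \<eta>(1)])
      show "w / poly Q w \<in> ball 0 \<delta> \<and> \<phi> (w / poly Q w) = w" if w: "w \<in> ball 0 \<eta>" "w \<noteq> 0" for w
      proof -
        have eq: "poly Q w / w = 1 / \<theta> w" using qw[OF w(2)] Q[OF w(1)] by simp
        have "w / poly Q w = 1 / (poly Q w / w)" by simp
        also have "\<dots> = \<theta> w" unfolding eq by simp
        finally have "w / poly Q w = \<theta> w" .
        then show ?thesis using \<theta>\<delta> \<phi>\<theta> w(1) by simp
      qed
    qed (use False in auto)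
    from degree_2_semiconjugacy_exceptional[OF d2 Q0 this Qeqn] show ?thesis
      unfolding exceptional_def by blast
  qed
qed

theorem theorem4:
  fixes f :: "complex poly"
  assumes "degree f \<ge> 2"
  shows "(\<exists>r>0. \<exists>C. C \<subseteq> level_curve f r \<and> connected C \<and> semialgebraic_curve C) \<longleftrightarrow> exceptional f"
proof
  assume "\<exists>r>0. \<exists>C. C \<subseteq> level_curve f r \<and> connected C \<and> semialgebraic_curve C"
  then obtain r C where r: "r > 0" and C: "C \<subseteq> level_curve f r" "semialgebraic C" "contains_cell C 1"
    unfolding semialgebraic_curve_def has_dimension_def by blast
  obtain A P where "A \<subseteq> C" "uncountable A" "P \<noteq> 0" "\<And>z. z \<in> A \<Longrightarrow> eval_plane P z = 0"
    using semialgebraic_uncountable_zeros[OF C(2) contains_cell_1_uncountable[OF C(3)]] by blast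
  then show "exceptional f"
    using algebraic_level_set_imp_exceptional[OF assms r, of A P] C(1) by blast
next
  assume "exceptional f"
  then show "\<exists>r>0. \<exists>C. C \<subseteq> level_curve f r \<and> connected C \<and> semialgebraic_curve C"
    using exceptional_level_curve[OF assms] zero_less_one by blast
qed

end
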